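(* Let $d\mu_p=\frac{e^{-\beta d^p}}{Z}\,d\lambda$ be a probability measure defined with $\beta\in(0,\infty)$ and $p\in(1,\infty)$ ($Z$ being the normalisation constant). Suppose $0<\frac1\sigma\le|\nabla d|\le 1$, for some $\sigma\in[1,\infty)$, and $\Delta d\le K+\beta p\,\varepsilon\, d^{p-1}$ outside the unit ball $B\equiv\{x: d(x)<1\}$ for some $K\in[0,\infty)$ and $\varepsilon\in[0,\frac1{\sigma^2})$. Then there exist constants $C,D\in(0,\infty)$, independent of the function $f$, such that the following bound is true: $$\int |f|\,d^{p-1}\,d\mu_p\le C\int|\nabla f|\,d\mu_p+D\int|f|\,d\mu_p .$$
   Context: $\lambda$ is Lebesgue measure on $\mathbb{R}^N$. $\nabla=(X_1,\dots,X_k)$ is a subgradient in $\mathbb{R}^N$, i.e. a finite collection of possibly noncommuting vector fields, each of which has zero divergence with respect to Lebesgue measure; $\nabla f=(X_1f,\dots,X_kf)$, $|\nabla f|=(\sum_i (X_if)^2)^{1/2}$ and $\Delta=\sum_i X_i^2$. $d\ge 0$ is a function on $\mathbb{R}^N$, the distance from the origin in the metric under consideration (for example the Carnot-Carathéodory distance on the Heisenberg group, with $\nabla$ the horizontal gradient). $f$ is a function for which the length of the gradient $|\nabla f|$ is well defined.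
   Formalization: The metric whose distance from the origin is d is additionally assumed to induce the usual topology of R^N and to have compact closed balls (true for Carnot groups); without this the bound can fail. Gradients and the bound on Δd are understood in the weak sense. *)

theory Defs
  imports "HOL-Probability.Probability"
begin

definition C1 :: "('a::euclidean_space \<Rightarrow> 'b::euclidean_space) \<Rightarrow> bool" where
  "C1 F \<longleftrightarrow> (\<exists>F'. (\<forall>x. (F has_derivative blinfun_apply (F' x)) (at x)) \<and> continuous_on UNIV F')"

definition divergence :: "(real^'n \<Rightarrow> real^'n) \<Rightarrow> real^'n \<Rightarrow> real" where
  "divergence F x = trace (jacobian F (at x))"

text \<open>A family \<open>X\<close> of vector fields \<open>X\<^sub>i = \<Sum>\<^sub>j X i x $ j \<partial>\<^sub>j\<close>, indexed by a finite
  type. \<open>C\<^sup>1\<close> coefficients are all that is needed; smooth fields are included.\<close>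

definition subgradient :: "('k::finite \<Rightarrow> real^'n \<Rightarrow> real^'n) \<Rightarrow> bool" where
  "subgradient X \<longleftrightarrow> (\<forall>i. C1 (X i) \<and> (\<forall>x. divergence (X i) x = 0))"

definition grad :: "('k::finite \<Rightarrow> real^'n \<Rightarrow> real^'n) \<Rightarrow> (real^'n \<Rightarrow> real) \<Rightarrow> real^'n \<Rightarrow> real^'k" where
  "grad X \<phi> x = (\<chi> i. frechet_derivative \<phi> (at x) (X i x))"

definition test_function :: "(real^'n) set \<Rightarrow> (real^'n \<Rightarrow> real) \<Rightarrow> bool" where
  "test_function U \<phi> \<longleftrightarrow> C1 \<phi> \<and> compact (closure {x. \<phi> x \<noteq> 0}) \<and> closure {x. \<phi> x \<noteq> 0} \<subseteq> U"

definition locally_integrable_on ::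
    "(real^'n) set \<Rightarrow> (real^'n \<Rightarrow> 'b::euclidean_space) \<Rightarrow> bool" where
  "locally_integrable_on U g \<longleftrightarrow> (\<forall>K. compact K \<and> K \<subseteq> U \<longrightarrow> g absolutely_integrable_on K)"

text \<open>\<open>g = (X\<^sub>1 u, \<dots>, X\<^sub>k u)\<close> in the weak sense on the open set \<open>U\<close>. As the fields are
  divergence free, the formal adjoint of \<open>X\<^sub>i\<close> is \<open>- X\<^sub>i\<close>. A Carnot--Caratheodory distance need
  not be differentiable everywhere (on the Heisenberg group it is not differentiable on the
  centre), so gradients are understood in this sense; for \<open>C\<^sup>1\<close> functions this is the classical
  gradient \<open>grad X u\<close>, up to null sets.\<close>

definition weak_gradient_on ::
    "(real^'n) set \<Rightarrow> ('k::finite \<Rightarrow> real^'n \<Rightarrow> real^'n) \<Rightarrow> (real^'n \<Rightarrow> real) \<Rightarrow> (real^'n \<Rightarrow> real^'k) \<Rightarrow> bool"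
  where
  "weak_gradient_on U X u g \<longleftrightarrow>
     locally_integrable_on U u \<and> locally_integrable_on U g \<and>
     (\<forall>\<phi>. test_function U \<phi> \<longrightarrow>
        (LINT x|lebesgue. u x *\<^sub>R grad X \<phi> x) = - (LINT x|lebesgue. \<phi> x *\<^sub>R g x))"

text \<open>\<open>\<Delta> u \<le> h\<close> on the open set \<open>U\<close>, where \<open>\<Delta> = \<Sum>\<^sub>i X\<^sub>i\<^sup>2\<close>, in the weak sense: tested against
  nonnegative \<open>\<phi>\<close>, with one \<open>X\<^sub>i\<close> moved onto \<open>\<phi>\<close>. For \<open>u\<close> of class \<open>C\<^sup>2\<close> this is the pointwise
  inequality; for less regular \<open>u\<close> a pointwise inequality almost everywhere would disregard
  any singular part of \<open>\<Delta> u\<close>.\<close>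

definition laplacian_le_on ::
    "(real^'n) set \<Rightarrow> ('k::finite \<Rightarrow> real^'n \<Rightarrow> real^'n) \<Rightarrow> (real^'n \<Rightarrow> real) \<Rightarrow> (real^'n \<Rightarrow> real) \<Rightarrow> bool"
  where
  "laplacian_le_on U X u h \<longleftrightarrow>
     locally_integrable_on U h \<and>
     (\<exists>g. weak_gradient_on U X u g \<and>
        (\<forall>\<phi>. test_function U \<phi> \<and> (\<forall>x. 0 \<le> \<phi> x) \<longrightarrow>
           - (LINT x|lebesgue. g x \<bullet> grad X \<phi> x) \<le> (LINT x|lebesgue. h x * \<phi> x)))"

text \<open>A metric on \<open>\<real>\<^sup>N\<close> inducing the usual topology whose closed balls are compact, as is the case
  for the Carnot--Caratheodory metric of a Carnot group.\<close>

definition proper_metric :: "(real^'n \<Rightarrow> real^'n \<Rightarrow> real) \<Rightarrow> bool" where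
  "proper_metric \<rho> \<longleftrightarrow>
     Metric_space UNIV \<rho> \<and> Metric_space.mtopology UNIV \<rho> = euclidean \<and>
     (\<forall>x r. compact {y. \<rho> x y \<le> r})"

text \<open>If \<open>exp (- \<beta> d\<^sup>p)\<close> is not integrable then the normalisation constant is \<open>0\<close> and this is the
  zero measure; so \<open>prob_space (mu \<beta> p d)\<close> does express that the normalisation is possible.\<close>

definition mu :: "real \<Rightarrow> real \<Rightarrow> (real^'n \<Rightarrow> real) \<Rightarrow> (real^'n) measure" where
  "mu \<beta> p d = density lebesgue
     (\<lambda>x. ennreal (exp (- \<beta> * d x powr p) / (LINT y|lebesgue. exp (- \<beta> * d y powr p))))"

end

theory Submission
  imports Defs
begin

text \<open>For regular data, integrating \<open>\<nabla>(f \<eta>(d)) \<bullet> \<nabla>d\<close> by parts with \<open>\<eta>(t) = exp (- \<beta> t\<^sup>p)\<close>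
  and \<open>f \<ge> 0\<close> gives
  \<open>\<integral> f (- \<eta>'(d)) \<bar>\<nabla>d\<bar>\<^sup>2 \<le> \<integral> f \<eta>(d) \<Delta>d + \<integral> \<bar>\<nabla>f\<bar> \<eta>(d)\<close>; since \<open>- \<eta>' = \<beta> p t\<^sup>p\<^sup>-\<^sup>1 \<eta>\<close>, the bounds on \<open>\<bar>\<nabla>d\<bar>\<close> and \<open>\<Delta>d\<close>
  leave \<open>\<beta> p (1/\<sigma>\<^sup>2 - \<epsilon>) \<integral> f d\<^sup>p\<^sup>-\<^sup>1 \<eta>(d)\<close> on the left. Cutting \<open>\<eta>\<close> off near \<open>d = 1\<close> and near infinity costs
  only a multiple of \<open>\<integral> f \<eta>(d)\<close>.

  With weak derivatives, \<open>f \<eta>(d)\<close> is no admissible test function, so \<open>d\<close> and \<open>f\<close> are mollified in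
  turn and \<open>\<bar>f\<bar>\<close> is replaced by \<open>sqrt (f\<^sup>2 + \<kappa>\<^sup>2)\<close>. The passage to the limit rests on Friedrichs' lemma:
  for a divergence-free \<open>C\<^sup>1\<close> field, mollification commutes with the derivative up to an error that
  vanishes in \<open>L\<^sup>1\<close>, which suffices because \<open>\<nabla>d\<close> is bounded.\<close>

section \<open>Functions with a continuous gradient\<close>

text \<open>The order of the two mollifications is forced. Pairing the gradient \<open>g\<close> of
  \<open>d\<close> with the gradient of \<open>A * \<eta> (v)\<close> produces
  \<open>A * \<eta>' (v)\<close> times \<open>g \<bullet> grad X v\<close>, and
  \<open>grad X v\<close> tends to \<open>g\<close> only in L1. That error is harmless if everything
  multiplying it is bounded, which holds for a fixed continuous \<open>A\<close> on a compact set
  but not for a weakly differentiable f. So \<open>d\<close> is regularised first, with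
  \<open>A\<close> held fixed. Afterwards all weights are bounded functions of the point alone, and
  L1 convergence of the approximations of f and of its gradient is enough. A second obstacle is that
  the Laplacian bound speaks of some weak gradient of \<open>d\<close>, while the bounds on the
  length of the gradient speak of a given one. Since mollifications of one function approximate each
  of its weak gradients, the two agree almost everywhere. All estimates before the last limit live
  on compact annuli, so that every integral there is finite; the final inequality is one between
  values in [0, \<infinity>] and also covers f for which the right-hand side is infinite.\<close>

definition has_grad :: "('a::euclidean_space \<Rightarrow> real) \<Rightarrow> ('a \<Rightarrow> 'a) \<Rightarrow> bool" where
  "has_grad \<phi> G \<longleftrightarrow> continuous_on UNIV G \<and> (\<forall>x. (\<phi> has_derivative (\<lambda>h. G x \<bullet> h)) (at x))"

lemma has_gradD:
  assumes "has_grad \<phi> G"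
  shows "continuous_on UNIV G" "(\<phi> has_derivative (\<lambda>h. G x \<bullet> h)) (at x)"
  using assms by (auto simp: has_grad_def)

lemma has_grad_continuous: "has_grad \<phi> G \<Longrightarrow> continuous_on S \<phi>"
  by (meson continuous_at_imp_continuous_on has_derivative_continuous has_gradD(2))

lemma has_grad_continuous_grad: "has_grad \<phi> G \<Longrightarrow> continuous_on S G"
  using continuous_on_subset has_gradD(1) by blast

lemma has_grad_imp_C1:
  assumes "has_grad \<phi> G" shows "C1 \<phi>"
  unfolding C1_def
proof (intro exI[of _ "\<lambda>x. blinfun_inner_left (G x)"] conjI allI)
  show "continuous_on UNIV (\<lambda>x. blinfun_inner_left (G x))"
    by (intro continuous_intros bounded_linear.continuous_on[OF bounded_linear_blinfun_inner_left]
        has_grad_continuous_grad[OF assms])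
  show "(\<phi> has_derivative blinfun_apply (blinfun_inner_left (G x))) (at x)" for x
    using has_gradD(2)[OF assms, of x] by (simp add: inner_commute)
qed

text \<open>The coordinates of the representing vector are the values of the derivative on the
  basis. With a vector in place of a linear map, applying a field becomes an inner product.\<close>

lemma C1_imp_has_grad:
  fixes \<phi> :: "'a::euclidean_space \<Rightarrow> real"
  assumes "C1 \<phi>" obtains G where "has_grad \<phi> G"
proof -
  obtain F' where F': "\<And>x. (\<phi> has_derivative blinfun_apply (F' x)) (at x)" "continuous_on UNIV F'"
    using assms by (auto simp: C1_def)
  define G where "G x = (\<Sum>b\<in>Basis. blinfun_apply (F' x) b *\<^sub>R b)" for x
  have *: "blinfun_apply (F' x) h = G x \<bullet> h" for x h
  proof -
    have "blinfun_apply (F' x) h = blinfun_apply (F' x) (\<Sum>b\<in>Basis. (h \<bullet> b) *\<^sub>R b)"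
      by (simp add: euclidean_representation)
    also have "\<dots> = (\<Sum>b\<in>Basis. (h \<bullet> b) * blinfun_apply (F' x) b)"
      by (simp add: blinfun.sum_right blinfun.scaleR_right)
    also have "\<dots> = G x \<bullet> h"
      unfolding G_def inner_sum_left by (intro sum.cong) (auto simp: inner_commute)
    finally show ?thesis .
  qed
  have "continuous_on UNIV G"
    unfolding G_def by (intro continuous_intros F')
  moreover have "(\<phi> has_derivative (\<lambda>h. G x \<bullet> h)) (at x)" for x
    proof -
    have "blinfun_apply (F' x) = (\<lambda>h. G x \<bullet> h)" using * by blast
    with F'(1)[of x] show ?thesis by simp
  qed
  ultimately have "has_grad \<phi> G"
    by (simp add: has_grad_def)
  then show ?thesis by (rule that)
qed

lemma has_grad_support:
  assumes "has_grad \<phi> G" "open S" "\<And>y. y \<in> S \<Longrightarrow> \<phi> y = c" "x \<in> S"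
  shows "G x = 0"
proof -
  have "(\<phi> has_derivative (\<lambda>h. 0)) (at x)"
  proof (rule has_derivative_transform_within_open[OF has_derivative_const[of c] assms(2) assms(4)])
    show "\<And>y. y \<in> S \<Longrightarrow> c = \<phi> y" using assms(3) by auto
  qed
  from has_derivative_unique[OF this has_gradD(2)[OF assms(1), of x]]
  have "(\<lambda>h. 0) = (\<lambda>h. G x \<bullet> h)" .
  from fun_cong[OF this, of "G x"] show ?thesis by simp
qed

lemma has_grad_off:
  assumes "has_grad \<phi> G" "compact K" "\<And>x. x \<notin> K \<Longrightarrow> \<phi> x = 0" "x \<notin> K"
  shows "G x = 0"
  by (rule has_grad_support[OF assms(1), of "- K" 0]) (use assms compact_imp_closed in \<open>auto simp: open_Compl\<close>)

lemma has_grad_const: "has_grad (\<lambda>x. c) (\<lambda>x. 0)"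
  by (auto simp: has_grad_def)

lemma has_grad_mult:
  assumes "has_grad u G" "has_grad v H"
  shows "has_grad (\<lambda>x. u x * v x) (\<lambda>x. u x *\<^sub>R H x + v x *\<^sub>R G x)"
  unfolding has_grad_def
proof (intro conjI allI)
  show "continuous_on UNIV (\<lambda>x. u x *\<^sub>R H x + v x *\<^sub>R G x)"
    by (intro continuous_intros has_grad_continuous_grad[OF assms(1)] has_grad_continuous_grad[OF assms(2)]
        has_grad_continuous[OF assms(1)] has_grad_continuous[OF assms(2)])
  show "((\<lambda>x. u x * v x) has_derivative (\<lambda>h. (u x *\<^sub>R H x + v x *\<^sub>R G x) \<bullet> h)) (at x)" for x
    by (rule has_derivative_eq_rhs, rule has_derivative_mult[OF has_gradD(2)[OF assms(1)] has_gradD(2)[OF assms(2)]])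
       (auto simp: algebra_simps inner_add_left)
qed

lemma has_grad_compose:
  assumes "has_grad u G" "\<And>t. (s has_real_derivative s' t) (at t)" "continuous_on UNIV s'"
  shows "has_grad (\<lambda>x. s (u x)) (\<lambda>x. s' (u x) *\<^sub>R G x)"
  unfolding has_grad_def
proof (intro conjI allI)
  show "continuous_on UNIV (\<lambda>x. s' (u x) *\<^sub>R G x)"
    by (intro continuous_intros has_grad_continuous_grad[OF assms(1)]
        continuous_on_compose2[OF assms(3)] has_grad_continuous[OF assms(1)]) auto
  show "((\<lambda>x. s (u x)) has_derivative (\<lambda>h. (s' (u x) *\<^sub>R G x) \<bullet> h)) (at x)" for x
    by (rule has_derivative_eq_rhs, rule has_derivative_compose[OF has_gradD(2)[OF assms(1)] 
        assms(2)[unfolded has_field_derivative_def]])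
       (auto simp: algebra_simps)
qed

lemma has_grad_lipschitz:
  assumes "has_grad \<phi> G" "\<And>x. norm (G x) \<le> B"
  shows "\<bar>\<phi> x - \<phi> y\<bar> \<le> B * norm (x - y)"
proof -
  have "norm (\<phi> x - \<phi> y) \<le> B * norm (x - y)"
  proof (rule differentiable_bound[OF convex_UNIV])
    show "(\<phi> has_derivative (\<lambda>h. G x \<bullet> h)) (at x within UNIV)" for x
      using has_gradD(2)[OF assms(1)] by simp
    show "onorm ((\<bullet>) (G x)) \<le> B" for x
      by (rule onorm_le) (metis assms(2) mult_right_mono norm_ge_zero order_trans Cauchy_Schwarz_ineq2 real_norm_def)
  qed auto
  then show ?thesis by simp
qed

lemma compact_support_bounded:
  fixes G :: "'a::euclidean_space \<Rightarrow> 'b::real_normed_vector"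
  assumes "continuous_on UNIV G" "compact K" "\<And>x. x \<notin> K \<Longrightarrow> G x = 0"
  obtains B where "0 < B" "\<And>x. norm (G x) \<le> B"
proof -
  have "bounded (G ` K)"
    by (intro compact_imp_bounded compact_continuous_image continuous_on_subset[OF assms(1)] assms(2)) auto
  then obtain B where B: "B > 0" "\<And>x. x \<in> K \<Longrightarrow> norm (G x) \<le> B"
    by (auto simp: bounded_pos)
  show ?thesis
    by (rule that[of B]) (use B assms(3) in \<open>auto, metis less_eq_real_def norm_zero\<close>)
qed

section \<open>Invariance of Lebesgue measure and integrals of derivatives\<close>

lemma integrable_compact_support:
  fixes G :: "'a::euclidean_space \<Rightarrow> 'b::euclidean_space"
  assumes "continuous_on UNIV G" "compact K" "\<And>x. x \<notin> K \<Longrightarrow> G x = 0"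
  shows "integrable lborel G"
proof -
  have "set_integrable lborel K G"
    unfolding set_integrable_def using assms by (intro borel_integrable_compact) (auto intro: continuous_on_subset)
  moreover have "(\<lambda>x. indicator K x *\<^sub>R G x) = G"
    using assms(3) by (auto simp: indicator_def fun_eq_iff)
  ultimately show ?thesis by (simp add: set_integrable_def)
qed

lemma integrable_translate:
  fixes f :: "'a::euclidean_space \<Rightarrow> 'b::{banach, second_countable_topology}"
  assumes "integrable lborel f"
  shows "integrable lborel (\<lambda>x. f (c + x))" "(LINT x|lborel. f (c + x)) = (LINT x|lborel. f x)"
proof -
  have [measurable]: "f \<in> borel_measurable borel" using assms by auto
  have "integrable (distr lborel borel ((+) c)) f" using assms by (simp add: lborel_distr_plus)
  then show "integrable lborel (\<lambda>x. f (c + x))" by (subst (asm) integrable_distr_eq) auto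
  have "(LINT x|lborel. f x) = (LINT x|distr lborel borel ((+) c). f x)" by (simp add: lborel_distr_plus)
  also have "\<dots> = (LINT x|lborel. f (c + x))" by (subst integral_distr) auto
  finally show "(LINT x|lborel. f (c + x)) = (LINT x|lborel. f x)" by simp
qed

text \<open>The affine change of variables with factor -1, whose Jacobian has absolute value
  1.\<close>

lemma lborel_distr_reflect:
  fixes c :: "'a::euclidean_space"
  shows "distr lborel borel (\<lambda>x. c - x) = lborel"
proof -
  have "(lborel :: 'a measure) = density (distr lborel borel (\<lambda>x. c + (- 1) *\<^sub>R x)) (\<lambda>_. ennreal (\<bar>- 1 :: real\<bar> ^ DIM('a)))"
    by (rule lborel_affine) simp
  also have "\<dots> = distr lborel borel (\<lambda>x. c - x)"
    by (simp add: density_1)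
  finally show ?thesis by simp
qed

lemma integrable_reflect:
  fixes f :: "'a::euclidean_space \<Rightarrow> 'b::{banach, second_countable_topology}"
  assumes "integrable lborel f"
  shows "integrable lborel (\<lambda>x. f (c - x))" "(LINT x|lborel. f (c - x)) = (LINT x|lborel. f x)"
proof -
  have [measurable]: "f \<in> borel_measurable borel" using assms by auto
  have "integrable (distr lborel borel (\<lambda>x. c - x)) f" using assms by (simp add: lborel_distr_reflect)
  then show "integrable lborel (\<lambda>x. f (c - x))" by (subst (asm) integrable_distr_eq) auto
  have "(LINT x|lborel. f x) = (LINT x|distr lborel borel (\<lambda>x. c - x). f x)" by (simp add: lborel_distr_reflect)
  also have "\<dots> = (LINT x|lborel. f (c - x))" by (subst integral_distr) auto
  finally show "(LINT x|lborel. f (c - x)) = (LINT x|lborel. f x)" by simp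
qed

text \<open>By translation invariance every difference quotient of \<open>\<phi>\<close> in the
  direction \<open>e\<close> has integral 0; dominated convergence passes this to the
  derivative.\<close>

lemma integral_grad_eq_0:
  fixes \<phi> :: "'a::euclidean_space \<Rightarrow> real"
  assumes G: "has_grad \<phi> G" and K: "compact K" "\<And>x. x \<notin> K \<Longrightarrow> \<phi> x = 0"
  shows "(LINT x|lborel. G x \<bullet> e) = 0"
proof -
  have G0: "G x = 0" if "x \<notin> K" for x
    by (rule has_grad_off[OF G K that])
  have Gc: "continuous_on UNIV G" and \<phi>c: "continuous_on UNIV \<phi>"
    using has_gradD(1)[OF G] has_grad_continuous[OF G] by auto
  obtain B where B: "0 < B" "\<And>x. norm (G x) \<le> B"
    using compact_support_bounded[OF Gc K(1) G0] by blast
  obtain R where R: "K \<subseteq> cball 0 R" using compact_imp_bounded[OF K(1)] unfolding bounded_iff by (auto simp: subset_iff)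
  have int\<phi>: "integrable lborel \<phi>" by (rule integrable_compact_support[OF \<phi>c K])
  define s where "s n x = (\<phi> (inverse (real (Suc n)) *\<^sub>R e + x) - \<phi> x) / inverse (real (Suc n))" for n x
  have lim: "(\<lambda>n. s n x) \<longlonglongrightarrow> G x \<bullet> e" for x
  proof -
    have "((\<lambda>t. \<phi> (t *\<^sub>R e + x)) has_derivative (\<lambda>t. G x \<bullet> (t *\<^sub>R e))) (at 0)"
    proof (rule has_derivative_compose[where g = \<phi> and g' = "\<lambda>h. G x \<bullet> h" and f = "\<lambda>t. t *\<^sub>R e + x" and f' = "\<lambda>t. t *\<^sub>R e"])
      show "((\<lambda>t. t *\<^sub>R e + x) has_derivative (\<lambda>t. t *\<^sub>R e)) (at 0)"
        by (auto intro!: derivative_eq_intros)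
      show "(\<phi> has_derivative (\<lambda>h. G x \<bullet> h)) (at (0 *\<^sub>R e + x))"
        using has_gradD(2)[OF G, of x] by simp
    qed
    moreover have "(\<lambda>t. G x \<bullet> (t *\<^sub>R e)) = (*) (G x \<bullet> e)" by (auto simp: fun_eq_iff)
    ultimately have "((\<lambda>t. \<phi> (t *\<^sub>R e + x)) has_real_derivative (G x \<bullet> e)) (at 0)"
      by (simp add: has_field_derivative_def)
    then have "((\<lambda>t. (\<phi> (t *\<^sub>R e + x) - \<phi> x) / t) \<longlongrightarrow> G x \<bullet> e) (at 0)"
      by (simp add: DERIV_def)
    moreover have "filterlim (\<lambda>n. inverse (real (Suc n))) (at 0) sequentially"
      unfolding filterlim_at using LIMSEQ_inverse_real_of_nat by auto
    ultimately show ?thesis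
      unfolding s_def by (rule filterlim_compose)
  qed
  have int0: "(LINT x|lborel. s n x) = 0" for n
    unfolding s_def using integrable_translate[OF int\<phi>] int\<phi> by simp
  have "(\<lambda>n. LINT x|lborel. s n x) \<longlonglongrightarrow> (LINT x|lborel. G x \<bullet> e)"
  proof (rule integral_dominated_convergence)
    show "(\<lambda>x. G x \<bullet> e) \<in> borel_measurable lborel"
      by (auto intro!: borel_measurable_continuous_onI continuous_intros Gc)
    show "s i \<in> borel_measurable lborel" for i
      unfolding s_def using int\<phi> integrable_translate(1)[OF int\<phi>] by measurable
    \<comment> \<open>The steps have length at most \<open>norm e\<close>, so the quotients vanish
      outside the ball enlarged by that amount; inside, the Lipschitz constant \<open>B\<close>
      bounds them.\<close>
    show "integrable lborel (\<lambda>x. indicator (cball 0 (R + norm e)) x *\<^sub>R (B * norm e) :: real)"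
      by (intro borel_integrable_compact) auto
    show "AE x in lborel. norm (s i x) \<le> indicator (cball 0 (R + norm e)) x *\<^sub>R (B * norm e)" for i
    proof (rule AE_I2)
      fix x :: 'a
      show "norm (s i x) \<le> indicator (cball 0 (R + norm e)) x *\<^sub>R (B * norm e)"
      proof (cases "x \<in> cball 0 (R + norm e)")
        case True
        have "\<bar>\<phi> (inverse (real (Suc i)) *\<^sub>R e + x) - \<phi> x\<bar> \<le> B * norm (inverse (real (Suc i)) *\<^sub>R e)"
          using has_grad_lipschitz[OF G B(2), of "inverse (real (Suc i)) *\<^sub>R e + x" x] by simp
        then have "\<bar>\<phi> (inverse (real (Suc i)) *\<^sub>R e + x) - \<phi> x\<bar> / inverse (real (Suc i))
            \<le> B * norm (inverse (real (Suc i)) *\<^sub>R e) / inverse (real (Suc i))"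
          by (rule divide_right_mono) simp
        also have "\<dots> = B * norm e" by simp
        finally show ?thesis using True by (simp add: s_def abs_divide del: of_nat_Suc)
      next
        case False
        have "norm (inverse (real (Suc i)) *\<^sub>R e) \<le> norm e"
          by (simp add: field_simps mult_left_le)
        moreover have "norm x \<le> norm (inverse (real (Suc i)) *\<^sub>R e + x) + norm (inverse (real (Suc i)) *\<^sub>R e)"
          by (metis add_diff_cancel_left' norm_triangle_ineq4 add.commute)
        ultimately have "x \<notin> cball 0 R" "inverse (real (Suc i)) *\<^sub>R e + x \<notin> cball 0 R"
          using False norm_ge_zero[of e] unfolding mem_cball_0 by linarith+
        then have "\<phi> x = 0" "\<phi> (inverse (real (Suc i)) *\<^sub>R e + x) = 0" using K(2) R by blast+
        then show ?thesis using False by (simp add: s_def)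
      qed
    qed
  qed (use lim in auto)
  then show ?thesis using int0 LIMSEQ_unique[OF _ tendsto_const] by auto
qed

section \<open>Divergence-free fields\<close>

lemma C1_component_grad:
  fixes F :: "real^'n \<Rightarrow> real^'n"
  assumes "C1 F"
  obtains H where "\<And>j. has_grad (\<lambda>x. F x $ j) (H j)"
proof -
  obtain F' where F': "\<And>x. (F has_derivative blinfun_apply (F' x)) (at x)" "continuous_on UNIV F'"
    using assms by (auto simp: C1_def)
  have "C1 (\<lambda>x. F x $ j)" for j
    unfolding C1_def
  proof (intro exI[of _ "\<lambda>x. blinfun_inner_left (axis j 1) o\<^sub>L F' x"] conjI allI)
    show "continuous_on UNIV (\<lambda>x. blinfun_inner_left (axis j 1) o\<^sub>L F' x)"
      by (intro continuous_intros F')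
    show "((\<lambda>x. F x $ j) has_derivative blinfun_apply (blinfun_inner_left (axis j 1) o\<^sub>L F' x)) (at x)" for x
    proof -
      have "((\<lambda>x. F x $ j) has_derivative (\<lambda>h. blinfun_apply (F' x) h $ j)) (at x)"
        by (rule bounded_linear.has_derivative[OF bounded_linear_vec_nth F'(1)])
      moreover have "(\<lambda>h. blinfun_apply (F' x) h $ j) = blinfun_apply (blinfun_inner_left (axis j 1) o\<^sub>L F' x)"
        by (auto simp: fun_eq_iff inner_axis)
      ultimately show ?thesis by simp
    qed
  qed
  then have "\<forall>j. \<exists>H. has_grad (\<lambda>x. F x $ j) H" using C1_imp_has_grad by metis
  then show ?thesis using that by metis
qed

lemma divergence_eq_sum:
  fixes F :: "real^'n \<Rightarrow> real^'n"
  assumes "C1 F" "\<And>j. has_grad (\<lambda>x. F x $ j) (H j)"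
  shows "divergence F x = (\<Sum>j\<in>UNIV. H j x $ j)"
proof -
  obtain D where D: "(F has_derivative D) (at x)"
    using assms(1) by (auto simp: C1_def)
  have "D (axis j 1) $ j = H j x $ j" for j
  proof -
    have "((\<lambda>x. F x $ j) has_derivative (\<lambda>h. D h $ j)) (at x)"
      by (rule bounded_linear.has_derivative[OF bounded_linear_vec_nth D])
    from has_derivative_unique[OF this has_gradD(2)[OF assms(2)]]
    show ?thesis by (metis inner_axis inner_real_def mult.right_neutral)
  qed
  moreover have "frechet_derivative F (at x) = D" using frechet_derivative_at[OF D] by simp
  ultimately show ?thesis by (simp add: divergence_def jacobian_def trace_def matrix_def)
qed

text \<open>The divergence theorem for \<open>\<phi> F\<close>: its j-th component is differentiated
  in the j-th direction and each such integral vanishes. For divergence-free \<open>F\<close> this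
  is the integration by parts behind weak gradients; for the identity field it evaluates the
  mollifier integral.\<close>

lemma integral_divergence_eq_0:
  fixes F :: "real^'n \<Rightarrow> real^'n"
  assumes F: "C1 F" and G: "has_grad \<phi> G" and K: "compact K" "\<And>x. x \<notin> K \<Longrightarrow> \<phi> x = 0"
  shows "(LINT x|lborel. divergence F x * \<phi> x + G x \<bullet> F x) = 0"
proof -
  obtain H where H: "\<And>j. has_grad (\<lambda>x. F x $ j) (H j)" using C1_component_grad[OF F] by blast
  have G0: "G x = 0" if "x \<notin> K" for x
    by (rule has_grad_off[OF G K that])
  have *: "has_grad (\<lambda>x. \<phi> x * F x $ j) (\<lambda>x. \<phi> x *\<^sub>R H j x + F x $ j *\<^sub>R G x)" for j
    by (rule has_grad_mult[OF G H])
  have "(LINT x|lborel. divergence F x * \<phi> x + G x \<bullet> F x)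
    = (LINT x|lborel. (\<Sum>j\<in>UNIV. (\<phi> x *\<^sub>R H j x + F x $ j *\<^sub>R G x) \<bullet> axis j 1))"
  proof (intro Bochner_Integration.integral_cong refl)
    fix x
    have "(\<phi> x *\<^sub>R H j x + F x $ j *\<^sub>R G x) \<bullet> axis j 1 = H j x $ j * \<phi> x + G x $ j * F x $ j" for j
      by (simp add: inner_axis)
    then show "divergence F x * \<phi> x + G x \<bullet> F x = (\<Sum>j\<in>UNIV. (\<phi> x *\<^sub>R H j x + F x $ j *\<^sub>R G x) \<bullet> axis j 1)"
      by (simp add: divergence_eq_sum[OF F H] sum.distrib sum_distrib_right inner_vec_def)
  qed
  also have "\<dots> = (\<Sum>j\<in>UNIV. LINT x|lborel. (\<phi> x *\<^sub>R H j x + F x $ j *\<^sub>R G x) \<bullet> axis j 1)"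
  proof (rule Bochner_Integration.integral_sum)
    fix j :: 'n
    have "integrable lborel (\<lambda>x. \<phi> x *\<^sub>R H j x + F x $ j *\<^sub>R G x)"
      by (rule integrable_compact_support[OF has_gradD(1)[OF *] K(1)]) (use K(2) G0 in auto)
    then show "integrable lborel (\<lambda>x. (\<phi> x *\<^sub>R H j x + F x $ j *\<^sub>R G x) \<bullet> axis j 1)"
      by (rule integrable_inner_left[rotated]) 
  qed
  also have "\<dots> = 0"
    using integral_grad_eq_0[OF * K(1)] K(2) by simp
  finally show ?thesis .
qed

section \<open>Continuity of translations in the mean\<close>

text \<open>Translation is an isometry of L1, so the defect of \<open>u\<close> exceeds that of
  \<open>v\<close> by at most twice the distance between \<open>u\<close> and \<open>v\<close>. The
  property therefore passes to L1 limits.\<close>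

lemma L1_translation_approx:
  fixes u :: "'a::euclidean_space \<Rightarrow> real"
  assumes u: "integrable lborel u" and z: "z \<longlonglongrightarrow> 0"
    and approx: "\<And>e. 0 < e \<Longrightarrow> \<exists>v. integrable lborel v \<and> (LINT x|lborel. \<bar>u x - v x\<bar>) < e \<and>
      (\<lambda>n. LINT x|lborel. \<bar>v (z n + x) - v x\<bar>) \<longlonglongrightarrow> 0"
  shows "(\<lambda>n. LINT x|lborel. \<bar>u (z n + x) - u x\<bar>) \<longlonglongrightarrow> 0"
proof (rule LIMSEQ_I)
  fix r :: real assume "0 < r"
  then obtain v where v: "integrable lborel v" "(LINT x|lborel. \<bar>u x - v x\<bar>) < r / 4"
      "(\<lambda>n. LINT x|lborel. \<bar>v (z n + x) - v x\<bar>) \<longlonglongrightarrow> 0"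
    using approx[of "r / 4"] by auto
  obtain N where N: "\<And>n. n \<ge> N \<Longrightarrow> \<bar>LINT x|lborel. \<bar>v (z n + x) - v x\<bar>\<bar> < r / 4"
    using LIMSEQ_D[OF v(3), of "r / 4"] \<open>0 < r\<close> by auto
  have "\<bar>LINT x|lborel. \<bar>u (z n + x) - u x\<bar>\<bar> < r" if "n \<ge> N" for n
  proof -
    note tu = integrable_translate(1)[OF u, of "z n"] and tv = integrable_translate(1)[OF v(1), of "z n"]
    have uv: "integrable lborel (\<lambda>x. \<bar>u x - v x\<bar>)" using u v(1) by auto
    note tuv = integrable_translate[OF uv, of "z n"]
    have iv: "integrable lborel (\<lambda>x. \<bar>v (z n + x) - v x\<bar>)" using v(1) tv by auto
    have "(LINT x|lborel. \<bar>u (z n + x) - u x\<bar>)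
      \<le> (LINT x|lborel. \<bar>u (z n + x) - v (z n + x)\<bar> + \<bar>u x - v x\<bar> + \<bar>v (z n + x) - v x\<bar>)"
      by (rule integral_mono) (use u tu tuv(1) uv iv in \<open>auto intro!: Bochner_Integration.integrable_add\<close>)
    also have "\<dots> = 2 * (LINT x|lborel. \<bar>u x - v x\<bar>) + (LINT x|lborel. \<bar>v (z n + x) - v x\<bar>)"
      using tuv uv iv by simp
    also have "\<dots> < r" using v(2) N[OF that] \<open>0 < r\<close> by linarith
    finally show ?thesis by (simp add: abs_of_nonneg)
  qed
  then show "\<exists>N. \<forall>n\<ge>N. norm ((LINT x|lborel. \<bar>u (z n + x) - u x\<bar>) - 0) < r"
    by auto
qed

text \<open>At points of \<open>U\<close> translates eventually stay in \<open>U\<close>, but at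
  boundary points the indicator need not converge. Only the positive part \<open>m\<close> of the
  difference is therefore sent to 0, dominated by the indicator of \<open>U\<close>; the negative
  part has the same integral because both indicators do (Scheffe's argument).\<close>

lemma L1_translation_open:
  fixes U :: "'a::euclidean_space set"
  assumes U: "open U" "emeasure lborel U < \<infinity>" and z: "z \<longlonglongrightarrow> 0"
  shows "(\<lambda>n. LINT x|lborel. \<bar>indicator U (z n + x) - indicator U x :: real\<bar>) \<longlonglongrightarrow> 0"
proof -
  let ?u = "indicator U :: 'a \<Rightarrow> real"
  have [measurable]: "U \<in> sets borel" using U by auto
  have u: "integrable lborel ?u" using U by (auto simp: integrable_indicator_iff)
  have tu: "integrable lborel (\<lambda>x. ?u (z n + x))" "(LINT x|lborel. ?u (z n + x)) = (LINT x|lborel. ?u x)" for n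
    using integrable_translate[OF u] by blast+
  define m where "m n x = max 0 (?u x - ?u (z n + x))" for n x
  have m: "integrable lborel (m n)" for n
    unfolding m_def[abs_def] using u tu(1) by (intro integrable_max) auto
  have "(LINT x|lborel. \<bar>?u (z n + x) - ?u x\<bar>) = 2 * (LINT x|lborel. m n x)" for n
  proof -
    have "(LINT x|lborel. \<bar>?u (z n + x) - ?u x\<bar>) = (LINT x|lborel. (?u (z n + x) - ?u x) + 2 * m n x)"
      by (intro Bochner_Integration.integral_cong) (auto simp: m_def max_def)
    also have "\<dots> = 2 * (LINT x|lborel. m n x)" using u tu[of n] m[of n] by simp
    finally show ?thesis .
  qed
  moreover have "(\<lambda>n. LINT x|lborel. m n x) \<longlonglongrightarrow> (LINT x|(lborel :: 'a measure). (0::real))"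
  proof (rule integral_dominated_convergence[where w = ?u])
    show "AE x in lborel. (\<lambda>n. m n x) \<longlonglongrightarrow> 0"
    proof (rule AE_I2)
      fix x :: 'a
      have "\<forall>\<^sub>F n in sequentially. m n x = 0"
      proof (cases "x \<in> U")
        case True
        have "(\<lambda>n. z n + x) \<longlonglongrightarrow> 0 + x" by (intro tendsto_intros z)
        then have "\<forall>\<^sub>F n in sequentially. z n + x \<in> U"
          using U(1) True by (intro topological_tendstoD[of _ x]) auto
        then show ?thesis by eventually_elim (auto simp: m_def)
      qed (auto simp: m_def)
      then show "(\<lambda>n. m n x) \<longlonglongrightarrow> 0" by (rule tendsto_eventually)
    qed
    show "AE x in lborel. norm (m i x) \<le> ?u x" for i
      by (rule AE_I2) (auto simp: m_def indicator_def)
  qed (use m u in \<open>auto dest: borel_measurable_integrable\<close>)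
  ultimately show ?thesis using tendsto_mult_left[of "\<lambda>n. LINT x|lborel. m n x" 0 sequentially 2] by simp
qed

text \<open>Induction over integrable functions reduces the claim to indicators of sets of finite
  measure, and outer regularity reduces these to open sets.\<close>

lemma L1_translation:
  fixes u :: "'a::euclidean_space \<Rightarrow> real"
  assumes "integrable lborel u" and z: "z \<longlonglongrightarrow> 0"
  shows "(\<lambda>n. LINT x|lborel. \<bar>u (z n + x) - u x\<bar>) \<longlonglongrightarrow> 0"
  using assms(1)
proof (induction rule: integrable_induct)
  case (base A c)
  show ?case
  proof (rule L1_translation_approx[OF _ z])
    show "integrable lborel (\<lambda>x. indicator A x *\<^sub>R c)" using base by (auto simp: integrable_indicator_iff)
    fix e :: real assume "0 < e"
    \<comment> \<open>The summand 1 covers \<open>c = 0\<close> and makes the final inequality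
      strict.\<close>
    define e' where "e' = e / (\<bar>c\<bar> + 1)"
    have "0 < e'" using \<open>0 < e\<close> by (simp add: e'_def)
    have A: "A \<in> sets borel" using base by simp
    obtain U where U: "open U" "A \<subseteq> U" "emeasure lborel (U - A) < e'"
      using outer_regular_lborel[OF A \<open>0 < e'\<close>] by blast
    have Ub: "U \<in> sets lborel" "A \<in> sets lborel" using U(1) base by auto
    have fin: "emeasure lborel (U - A) < \<infinity>" using order.strict_trans[OF U(3) ennreal_less_top] by simp
    have "emeasure lborel U = emeasure lborel (U - A) + emeasure lborel A"
      using U(2) Ub by (subst plus_emeasure) (auto simp: Un_absorb2)
    then have Ufin: "emeasure lborel U < \<infinity>" using fin base(2) by simp
    have "(LINT x|lborel. \<bar>indicator A x *\<^sub>R c - indicator U x *\<^sub>R c\<bar>) = (LINT x|lborel. \<bar>c\<bar> * indicator (U - A) x)"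
      using U(2) by (intro Bochner_Integration.integral_cong) (auto simp: indicator_def)
    also have "\<dots> = \<bar>c\<bar> * measure lborel (U - A)" using Ub by simp
    also have "\<dots> \<le> \<bar>c\<bar> * e'"
      using U(3) \<open>0 < e'\<close> by (intro mult_left_mono) (auto simp: measure_def enn2real_leI less_imp_le)
    also have "\<dots> < e" using \<open>0 < e\<close> by (simp add: e'_def field_simps)
    finally have 1: "(LINT x|lborel. \<bar>indicator A x *\<^sub>R c - indicator U x *\<^sub>R c\<bar>) < e" .
    have "(LINT x|lborel. \<bar>indicator U (z n + x) *\<^sub>R c - indicator U x *\<^sub>R c\<bar>)
        = \<bar>c\<bar> * (LINT x|lborel. \<bar>indicator U (z n + x) - indicator U x\<bar>)" for n
      by (subst integral_mult_right_zero[symmetric], intro Bochner_Integration.integral_cong)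
         (auto simp: abs_mult[symmetric] algebra_simps)
    with tendsto_mult_left[OF L1_translation_open[OF U(1) Ufin z], of "\<bar>c\<bar>"]
    have "(\<lambda>n. LINT x|lborel. \<bar>indicator U (z n + x) *\<^sub>R c - indicator U x *\<^sub>R c\<bar>) \<longlonglongrightarrow> 0" by simp
    with 1 show "\<exists>v. integrable lborel v \<and> (LINT x|lborel. \<bar>indicator A x *\<^sub>R c - v x\<bar>) < e \<and>
      (\<lambda>n. LINT x|lborel. \<bar>v (z n + x) - v x\<bar>) \<longlonglongrightarrow> 0"
      using Ub Ufin by (intro exI[of _ "\<lambda>x. indicator U x *\<^sub>R c"]) (auto simp: integrable_indicator_iff)
  qed
next
  case (add f g)
  note f = add.hyps(1) and g = add.hyps(2)
  let ?F = "\<lambda>n x. \<bar>f (z n + x) - f x\<bar>" and ?G = "\<lambda>n x. \<bar>g (z n + x) - g x\<bar>"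
  have i: "integrable lborel (\<lambda>x. ?F n x)" "integrable lborel (\<lambda>x. ?G n x)" for n
    using f g integrable_translate(1)[OF f] integrable_translate(1)[OF g] by auto
  show ?case
  proof (rule tendsto_sandwich[OF _ _ tendsto_const])
    show "(\<lambda>n. (LINT x|lborel. ?F n x) + (LINT x|lborel. ?G n x)) \<longlonglongrightarrow> 0"
      using tendsto_add[OF add.IH] by simp
    show "\<forall>\<^sub>F n in sequentially. (LINT x|lborel. \<bar>f (z n + x) + g (z n + x) - (f x + g x)\<bar>)
       \<le> (LINT x|lborel. ?F n x) + (LINT x|lborel. ?G n x)"
    proof (intro always_eventually allI)
      fix n
      have "(LINT x|lborel. \<bar>f (z n + x) + g (z n + x) - (f x + g x)\<bar>)
        \<le> (LINT x|lborel. ?F n x + ?G n x)"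
        by (rule integral_mono)
           (use f g integrable_translate(1)[OF f] integrable_translate(1)[OF g] i in auto)
      also have "\<dots> = (LINT x|lborel. ?F n x) + (LINT x|lborel. ?G n x)"
        using i by simp
      finally show "(LINT x|lborel. \<bar>f (z n + x) + g (z n + x) - (f x + g x)\<bar>)
        \<le> (LINT x|lborel. ?F n x) + (LINT x|lborel. ?G n x)" .
    qed
  qed (auto intro!: always_eventually)
next
  case (lim f s)
  show ?case
  proof (rule L1_translation_approx[OF lim.hyps(4) z])
    fix e :: real assume "0 < e"
    have "(\<lambda>i. LINT x|lborel. \<bar>f x - s i x\<bar>) \<longlonglongrightarrow> (LINT x|(lborel :: 'a measure). (0::real))"
    \<comment> \<open>The approximating functions satisfy
      \<open>\<bar>s i x\<bar> \<le> 2 * \<bar>f x\<bar>\<close>, hence the factor 3 for the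
      difference.\<close>
    proof (rule integral_dominated_convergence[where w = "\<lambda>x. 3 * \<bar>f x\<bar>"])
      show "AE x in lborel. (\<lambda>i. \<bar>f x - s i x\<bar>) \<longlonglongrightarrow> 0"
      proof (rule AE_I2)
        fix x
        have "(\<lambda>i. \<bar>f x - s i x\<bar>) \<longlonglongrightarrow> \<bar>f x - f x\<bar>" by (intro tendsto_intros lim.hyps(2)) auto
        then show "(\<lambda>i. \<bar>f x - s i x\<bar>) \<longlonglongrightarrow> 0" by simp
      qed
      show "AE x in lborel. norm \<bar>f x - s i x\<bar> \<le> 3 * \<bar>f x\<bar>" for i
      proof (rule AE_I2)
        fix x show "norm \<bar>f x - s i x\<bar> \<le> 3 * \<bar>f x\<bar>" using lim.hyps(3)[of x i] by auto
      qed
    qed (use lim.hyps in \<open>auto dest: borel_measurable_integrable\<close>)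
    then have "\<forall>\<^sub>F i in sequentially. (LINT x|lborel. \<bar>f x - s i x\<bar>) < e"
      using \<open>0 < e\<close> by (intro order_tendstoD) auto
    then obtain i where "(LINT x|lborel. \<bar>f x - s i x\<bar>) < e" by (auto simp: eventually_sequentially)
    then show "\<exists>v. integrable lborel v \<and> (LINT x|lborel. \<bar>f x - v x\<bar>) < e \<and>
      (\<lambda>n. LINT x|lborel. \<bar>v (z n + x) - v x\<bar>) \<longlonglongrightarrow> 0"
      using lim.hyps lim.IH by blast
  qed
qed

lemma L1_translation_small:
  fixes u :: "'a::euclidean_space \<Rightarrow> real"
  assumes "integrable lborel u" "0 < e"
  obtains \<delta> where "0 < \<delta>" "\<And>z. norm z < \<delta> \<Longrightarrow> (LINT x|lborel. \<bar>u (x - z) - u x\<bar>) \<le> e"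
proof -
  have "((\<lambda>z. LINT x|lborel. \<bar>u (z + x) - u x\<bar>) \<longlongrightarrow> 0) (at 0)"
    unfolding tendsto_at_iff_sequentially comp_def using L1_translation[OF assms(1)] by blast
  then obtain \<delta> where \<delta>: "\<delta> > 0" "\<And>z. z \<noteq> 0 \<Longrightarrow> norm z < \<delta> \<Longrightarrow> \<bar>LINT x|lborel. \<bar>u (z + x) - u x\<bar>\<bar> < e"
    using assms(2) unfolding LIM_def by auto
  show ?thesis
  proof (rule that[OF \<delta>(1)])
    fix z :: 'a assume z: "norm z < \<delta>"
    show "(LINT x|lborel. \<bar>u (x - z) - u x\<bar>) \<le> e"
    proof (cases "z = 0")
      case False
      with \<delta>(2)[of "-z"] z show ?thesis by simp
    qed (use assms(2) in simp)
  qed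
qed

text \<open>After the substitution z = x - y and Tonelli, the inner integral for fixed z is a
  translation defect of \<open>u\<close> times \<open>k z\<close>. The kernel \<open>k\<close> will
  be both the mollifier and \<open>norm z * norm (G z)\<close>.\<close>

lemma nn_integral_average_le:
  fixes u k :: "'a::euclidean_space \<Rightarrow> real"
  assumes u: "integrable lborel u" and k: "integrable lborel k" "\<And>z. 0 \<le> k z" "\<And>z. \<delta> \<le> norm z \<Longrightarrow> k z = 0"
    and e: "\<And>z. norm z < \<delta> \<Longrightarrow> (LINT x|lborel. \<bar>u (x - z) - u x\<bar>) \<le> e" "0 \<le> e"
  shows "(\<integral>\<^sup>+x. \<integral>\<^sup>+y. ennreal (\<bar>u y - u x\<bar> * k (x - y)) \<partial>lborel \<partial>lborel) \<le> ennreal (e * (LINT z|lborel. k z))"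
proof -
  have [measurable]: "u \<in> borel_measurable borel" "k \<in> borel_measurable borel"
    using u k(1) by auto
  have "(\<integral>\<^sup>+y. ennreal (\<bar>u y - u x\<bar> * k (x - y)) \<partial>lborel)
      = (\<integral>\<^sup>+z. ennreal (\<bar>u (x - z) - u x\<bar> * k z) \<partial>lborel)" for x
  proof -
    have "(\<integral>\<^sup>+y. ennreal (\<bar>u y - u x\<bar> * k (x - y)) \<partial>lborel)
      = (\<integral>\<^sup>+y. ennreal (\<bar>u y - u x\<bar> * k (x - y)) \<partial>distr lborel borel (\<lambda>z. x - z))"
      by (simp add: lborel_distr_reflect)
    also have "\<dots> = (\<integral>\<^sup>+z. ennreal (\<bar>u (x - z) - u x\<bar> * k z) \<partial>lborel)"
      by (subst nn_integral_distr) auto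
    finally show ?thesis .
  qed
  then have "(\<integral>\<^sup>+x. \<integral>\<^sup>+y. ennreal (\<bar>u y - u x\<bar> * k (x - y)) \<partial>lborel \<partial>lborel)
    = (\<integral>\<^sup>+x. \<integral>\<^sup>+z. ennreal (\<bar>u (x - z) - u x\<bar> * k z) \<partial>lborel \<partial>lborel)" by simp
  also have "\<dots> = (\<integral>\<^sup>+z. \<integral>\<^sup>+x. ennreal (\<bar>u (x - z) - u x\<bar> * k z) \<partial>lborel \<partial>lborel)"
    by (rule lborel_pair.Fubini'[symmetric]) measurable
  also have "\<dots> \<le> (\<integral>\<^sup>+z. ennreal (e * k z) \<partial>lborel)"
  proof (rule nn_integral_mono)
    fix z :: 'a
    show "(\<integral>\<^sup>+x. ennreal (\<bar>u (x - z) - u x\<bar> * k z) \<partial>lborel) \<le> ennreal (e * k z)"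
    proof (cases "norm z < \<delta>")
      case True
      have i: "integrable lborel (\<lambda>x. \<bar>u (x - z) - u x\<bar>)"
        using u integrable_translate(1)[OF u, of "-z"] by auto
      have "(\<integral>\<^sup>+x. ennreal (\<bar>u (x - z) - u x\<bar> * k z) \<partial>lborel) = ennreal (LINT x|lborel. \<bar>u (x - z) - u x\<bar> * k z)"
        using i k(2) by (intro nn_integral_eq_integral) auto
      also have "\<dots> \<le> ennreal (e * k z)"
        using e(1)[OF True] k(2)[of z] i by (intro ennreal_leI) (simp add: mult_right_mono)
      finally show ?thesis .
    qed (use k(3) in simp)
  qed
  also have "\<dots> = ennreal (LINT z|lborel. e * k z)"
    using k e(2) by (intro nn_integral_eq_integral) auto
  also have "\<dots> = ennreal (e * (LINT z|lborel. k z))" by simp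
  finally show ?thesis .
qed

section \<open>Mollification\<close>

text \<open>Two points at distance below 1 either both lie in the ball of radius
  \<open>R + 1\<close>, which is compact, or both lie where \<open>G\<close> vanishes.\<close>

lemma compact_support_uniformly_continuous:
  fixes G :: "'a::euclidean_space \<Rightarrow> 'b::real_normed_vector"
  assumes G: "continuous_on UNIV G" and K: "compact K" "\<And>x. x \<notin> K \<Longrightarrow> G x = 0" and "0 < e"
  obtains d where "0 < d" "\<And>a b. norm (a - b) < d \<Longrightarrow> norm (G a - G b) \<le> e"
proof -
  obtain R where R: "K \<subseteq> cball 0 R"
    using compact_imp_bounded[OF K(1)] unfolding bounded_iff by (auto simp: subset_iff)
  have "uniformly_continuous_on (cball 0 (R + 1)) G"
    by (intro compact_uniformly_continuous continuous_on_subset[OF G]) auto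
  then obtain d where d: "d > 0" "\<And>a b. a \<in> cball 0 (R + 1) \<Longrightarrow> b \<in> cball 0 (R + 1) \<Longrightarrow> dist b a < d \<Longrightarrow> dist (G b) (G a) < e"
    using \<open>0 < e\<close> unfolding uniformly_continuous_on_def by metis
  show ?thesis
  proof (rule that[of "min d 1"])
    show "0 < min d 1" using d by simp
    fix a b :: 'a assume ab: "norm (a - b) < min d 1"
    show "norm (G a - G b) \<le> e"
    proof (cases "a \<in> cball 0 R \<or> b \<in> cball 0 R")
      case True
      have "norm a \<le> norm b + norm (a - b)" "norm b \<le> norm a + norm (a - b)"
        using norm_triangle_ineq2[of a b] norm_triangle_ineq3[of b a] by (auto simp: norm_minus_commute)
      then have "a \<in> cball 0 (R + 1)" "b \<in> cball 0 (R + 1)" using True ab by auto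
      then show ?thesis using d(2)[of b a] ab by (simp add: dist_norm)
    next
      case False
      then have "G a = 0" "G b = 0" using K(2) R by blast+
      then show ?thesis using \<open>0 < e\<close> by simp
    qed
  qed
qed

lemma integrable_mult_compact_support:
  fixes u :: "'a::euclidean_space \<Rightarrow> real" and H :: "'a \<Rightarrow> 'b::euclidean_space"
  assumes "integrable lborel u" "continuous_on UNIV H" "compact K" "\<And>x. x \<notin> K \<Longrightarrow> H x = 0"
  shows "integrable lborel (\<lambda>x. u x *\<^sub>R H x)"
proof -
  obtain B where B: "0 < B" "\<And>x. norm (H x) \<le> B" using compact_support_bounded[OF assms(2-4)] by blast
  have [measurable]: "u \<in> borel_measurable borel" "H \<in> borel_measurable borel"
    using assms(1,2) by (auto intro: borel_measurable_continuous_onI)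
  show ?thesis
    by (rule Bochner_Integration.integrable_bound[of _ "\<lambda>x. B * \<bar>u x\<bar>"])
       (use assms(1) B in \<open>auto simp: mult.commute[of B] intro!: mult_left_mono\<close>)
qed

lemma compact_reflect:
  fixes K :: "'a::euclidean_space set"
  assumes "compact K" shows "compact ((\<lambda>z. x - z) ` K)"
  by (intro compact_continuous_image continuous_intros assms)

text \<open>The variable \<open>x\<close> sits in the kernel, so that derivatives fall on
  \<open>\<rho>\<close> and \<open>u\<close> need only be integrable; \<open>conv_grad\<close> is
  the result of differentiating under the integral.\<close>

definition conv :: "('a::euclidean_space \<Rightarrow> real) \<Rightarrow> ('a \<Rightarrow> real) \<Rightarrow> 'a \<Rightarrow> real" where
  "conv \<rho> u x = (LINT y|lborel. u y * \<rho> (x - y))"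

definition conv_grad :: "('a::euclidean_space \<Rightarrow> 'a) \<Rightarrow> ('a \<Rightarrow> real) \<Rightarrow> 'a \<Rightarrow> 'a" where
  "conv_grad G u x = (LINT y|lborel. u y *\<^sub>R G (x - y))"

text \<open>A continuous compactly supported \<open>G\<close> is uniformly continuous, so the
  linearisation error of the kernel is small relative to the increment uniformly in the integration
  variable, and may be integrated against \<open>\<bar>u\<bar>\<close>.\<close>

lemma has_grad_conv:
  fixes \<rho> :: "'a::euclidean_space \<Rightarrow> real"
  assumes G: "has_grad \<rho> G" and K: "compact K" "\<And>x. x \<notin> K \<Longrightarrow> \<rho> x = 0" and u: "integrable lborel u"
  shows "has_grad (conv \<rho> u) (conv_grad G u)"
proof -
  have G0: "G x = 0" if "x \<notin> K" for x
    by (rule has_grad_off[OF G K that])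
  have Gc: "continuous_on UNIV G" and \<rho>c: "continuous_on UNIV \<rho>"
    using has_gradD(1)[OF G] has_grad_continuous[OF G] by auto
  have off: "x - y \<notin> K" if "y \<notin> (\<lambda>z. x - z) ` K" for x y
    using that by (auto simp: image_iff)
  have iG: "integrable lborel (\<lambda>y. u y *\<^sub>R G (x - y))" for x
    by (rule integrable_mult_compact_support[OF u _ compact_reflect[OF K(1), of x]])
       (auto intro!: continuous_on_compose2[OF Gc] continuous_intros G0 dest!: off)
  have i\<rho>: "integrable lborel (\<lambda>y. u y * \<rho> (x - y))" for x
  proof -
    have "integrable lborel (\<lambda>y. u y *\<^sub>R \<rho> (x - y))"
      by (rule integrable_mult_compact_support[OF u _ compact_reflect[OF K(1), of x]])
         (auto intro!: continuous_on_compose2[OF \<rho>c] continuous_intros K(2) dest!: off)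
    then show ?thesis by simp
  qed
  \<comment> \<open>Errors are divided by \<open>M + 1\<close> below, which is positive even if
    \<open>u\<close> vanishes almost everywhere.\<close>
  define M where "M = (LINT y|lborel. \<bar>u y\<bar>)"
  have M: "0 \<le> M" by (simp add: M_def)
  have unif: "\<exists>d>0. \<forall>a b. norm (a - b) < d \<longrightarrow> norm (G a - G b) \<le> e / (M + 1)" if "0 < e" for e
  proof -
    have "0 < e / (M + 1)" using that M by simp
    then obtain d where "0 < d" "\<And>a b. norm (a - b) < d \<Longrightarrow> norm (G a - G b) \<le> e / (M + 1)"
      using compact_support_uniformly_continuous[OF Gc K(1) G0, of "e / (M + 1)"] by blast
    then show ?thesis by blast
  qed
  have small: "M * (e / (M + 1)) \<le> e" if "0 < e" for e
    using M that by (simp add: field_simps)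
  show ?thesis
    unfolding has_grad_def
  proof (intro conjI allI)
    show "continuous_on UNIV (conv_grad G u)"
      unfolding continuous_on_iff
    proof (intro ballI allI impI)
      fix x :: 'a and e :: real assume "0 < e"
      obtain d where d: "d > 0" "\<And>a b. norm (a - b) < d \<Longrightarrow> norm (G a - G b) \<le> (e / 2) / (M + 1)"
        using unif[of "e / 2"] \<open>0 < e\<close> by auto
      have "dist (conv_grad G u x') (conv_grad G u x) < e" if "dist x' x < d" for x'
      proof -
        have "conv_grad G u x' - conv_grad G u x = (LINT y|lborel. u y *\<^sub>R (G (x' - y) - G (x - y)))"
          unfolding conv_grad_def using iG by (simp add: scaleR_diff_right)
        also have "norm \<dots> \<le> (LINT y|lborel. norm (u y *\<^sub>R (G (x' - y) - G (x - y))))"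
          by (rule integral_norm_bound)
        also have "\<dots> \<le> (LINT y|lborel. \<bar>u y\<bar> * ((e / 2) / (M + 1)))"
        proof (rule integral_mono)
          show "integrable lborel (\<lambda>y. norm (u y *\<^sub>R (G (x' - y) - G (x - y))))"
            using iG[of x'] iG[of x] by (auto simp: scaleR_diff_right)
          show "norm (u y *\<^sub>R (G (x' - y) - G (x - y))) \<le> \<bar>u y\<bar> * ((e / 2) / (M + 1))" for y
            unfolding norm_scaleR using that by (intro mult_left_mono d(2)) (auto simp: dist_norm)
        qed (use u in auto)
        also have "\<dots> = M * ((e / 2) / (M + 1))" unfolding M_def by (rule integral_mult_left_zero)
        also have "\<dots> \<le> e / 2" using small[of "e / 2"] \<open>0 < e\<close> by simp
        also have "\<dots> < e" using \<open>0 < e\<close> by simp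
        finally show ?thesis by (simp add: dist_norm)
      qed
      then show "\<exists>d>0. \<forall>x'\<in>UNIV. dist x' x < d \<longrightarrow> dist (conv_grad G u x') (conv_grad G u x) < e"
        using d(1) by auto
    qed
    fix x
    show "(conv \<rho> u has_derivative (\<lambda>h. conv_grad G u x \<bullet> h)) (at x)"
      unfolding has_derivative_at_alt
    proof (intro conjI allI impI bounded_linear_inner_right)
      fix e :: real assume "0 < e"
      obtain d where d: "d > 0" "\<And>a b. norm (a - b) < d \<Longrightarrow> norm (G a - G b) \<le> e / (M + 1)"
        using unif[of "e"] \<open>0 < e\<close> by auto
      have "norm (conv \<rho> u y - conv \<rho> u x - conv_grad G u x \<bullet> (y - x)) \<le> e * norm (y - x)"
        if y: "norm (y - x) < d" for y
      proof -
        have lin: "\<bar>\<rho> (y - t) - \<rho> (x - t) - G (x - t) \<bullet> (y - x)\<bar> \<le> norm (y - x) * (e / (M + 1))" for t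
        proof -
          have "norm (\<rho> (y - t) - \<rho> (x - t) - G (x - t) \<bullet> ((y - t) - (x - t))) \<le> norm ((y - t) - (x - t)) * (e / (M + 1))"
          proof (rule differentiable_bound_linearization[where S = "ball (x - t) d" and f' = "\<lambda>z h. G z \<bullet> h"])
            fix r :: real assume "r \<in> {0..1}"
            then have "norm (r *\<^sub>R (y - x)) \<le> norm (y - x)" by (auto simp: mult_left_le_one_le)
            then show "x - t + r *\<^sub>R (y - t - (x - t)) \<in> ball (x - t) d" using y by (simp add: dist_norm)
          next
            fix z assume "z \<in> ball (x - t) d"
            then have "norm (G z - G (x - t)) \<le> e / (M + 1)"
              by (intro d(2)) (simp add: dist_norm norm_minus_commute)
            then have "\<bar>G z \<bullet> h - G (x - t) \<bullet> h\<bar> \<le> e / (M + 1) * norm h" for h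
              unfolding inner_diff_left[symmetric]
              by (metis Cauchy_Schwarz_ineq2 mult_right_mono norm_ge_zero order_trans)
            then show "onorm ((\<bullet>) (G z) - (\<bullet>) (G (x - t))) \<le> e / (M + 1)"
              by (intro onorm_le) (simp add: fun_diff_def)
          qed (use d(1) has_gradD(2)[OF G] in \<open>auto intro: has_derivative_at_withinI\<close>)
          then show ?thesis by simp
        qed
        have "conv_grad G u x \<bullet> (y - x) = (LINT t|lborel. u t * (G (x - t) \<bullet> (y - x)))"
          unfolding conv_grad_def using iG[of x] by (subst integral_inner_left[symmetric]) auto
        moreover have iGi: "integrable lborel (\<lambda>t. u t * (G (x - t) \<bullet> (y - x)))"
          using integrable_inner_left[of "y - x" lborel, OF iG[of x]] by simp
        ultimately have "conv \<rho> u y - conv \<rho> u x - conv_grad G u x \<bullet> (y - x)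
          = (LINT t|lborel. u t * (\<rho> (y - t) - \<rho> (x - t) - G (x - t) \<bullet> (y - x)))"
          unfolding conv_def using i\<rho> by (simp add: right_diff_distrib)
        also have "norm \<dots> \<le> (LINT t|lborel. norm (u t * (\<rho> (y - t) - \<rho> (x - t) - G (x - t) \<bullet> (y - x))))"
          by (rule integral_norm_bound)
        also have "\<dots> \<le> (LINT t|lborel. \<bar>u t\<bar> * (norm (y - x) * (e / (M + 1))))"
        proof (rule integral_mono)
          show "integrable lborel (\<lambda>t. norm (u t * (\<rho> (y - t) - \<rho> (x - t) - G (x - t) \<bullet> (y - x))))"
            using i\<rho>[of y] i\<rho>[of x] iGi by (auto simp: right_diff_distrib)
          show "norm (u t * (\<rho> (y - t) - \<rho> (x - t) - G (x - t) \<bullet> (y - x))) \<le> \<bar>u t\<bar> * (norm (y - x) * (e / (M + 1)))" for t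
            unfolding real_norm_def abs_mult using lin by (intro mult_left_mono) auto
        qed (use u in auto)
        also have "\<dots> = M * (norm (y - x) * (e / (M + 1)))" unfolding M_def by (rule integral_mult_left_zero)
        also have "\<dots> = norm (y - x) * (M * (e / (M + 1)))" by simp
        also have "\<dots> \<le> norm (y - x) * e" using small[of e] \<open>0 < e\<close> by (intro mult_left_mono) auto
        finally show ?thesis by (simp add: mult.commute)
      qed
      then show "\<exists>d>0. \<forall>y. norm (y - x) < d \<longrightarrow>
          norm (conv \<rho> u y - conv \<rho> u x - conv_grad G u x \<bullet> (y - x)) \<le> e * norm (y - x)"
        using d(1) by blast
    qed
  qed
qed

section \<open>Construction of mollifiers\<close>

text \<open>Squaring the positive part removes its kink. This is the source of the C1 regularity of
  both the mollifier and the cutoff in the distance.\<close>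

lemma DERIV_max0_square: "((\<lambda>t::real. (max 0 t)\<^sup>2) has_real_derivative 2 * max 0 t) (at t)"
proof -
  consider "t > 0" | "t < 0" | "t = 0" by linarith
  then show ?thesis
  proof cases
    case 1
    have "((\<lambda>t::real. t\<^sup>2) has_real_derivative 2 * max 0 t) (at t)"
      using 1 by (auto intro!: derivative_eq_intros)
    then show ?thesis
      by (rule has_field_derivative_transform_within_open[of _ _ _ "{0<..}"]) (use 1 in auto)
  next
    case 2
    have "((\<lambda>t::real. 0) has_real_derivative 2 * max 0 t) (at t)"
      using 2 by (auto intro!: derivative_eq_intros)
    then show ?thesis
      by (rule has_field_derivative_transform_within_open[of _ _ _ "{..<0}"]) (use 2 in auto)
  next
    case 3
    have "((\<lambda>h::real. (max 0 h)\<^sup>2 / h) \<longlongrightarrow> 0) (at 0)"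
    proof (rule Lim_null_comparison)
      show "\<forall>\<^sub>F h::real in at 0. norm ((max 0 h)\<^sup>2 / h) \<le> \<bar>h\<bar>"
        by (auto intro!: always_eventually simp: max_def power2_eq_square)
      show "((\<lambda>h::real. \<bar>h\<bar>) \<longlongrightarrow> 0) (at 0)" by (auto intro!: tendsto_eq_intros)
    qed
    then show ?thesis using 3 by (simp add: DERIV_def)
  qed
qed

text \<open>The last condition, a bound for \<open>\<bar>z\<bar> \<bar>G z\<bar>\<close> independent of \<open>\<delta>\<close>, is what the commutator estimate
  needs. For a radially decreasing \<open>\<rho>\<close> it is the identity \<open>\<integral> div (\<rho>(z) z) dz = 0\<close>.\<close>

definition mollifier :: "real \<Rightarrow> (real^'n \<Rightarrow> real) \<Rightarrow> (real^'n \<Rightarrow> real^'n) \<Rightarrow> bool" where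
  "mollifier \<delta> \<rho> G \<longleftrightarrow> has_grad \<rho> G \<and> (\<forall>z. 0 \<le> \<rho> z) \<and> (\<forall>z. \<delta> \<le> norm z \<longrightarrow> \<rho> z = 0 \<and> G z = 0) \<and>
     (LINT z|lborel. \<rho> z) = 1 \<and> (LINT z|lborel. norm z * norm (G z)) = CARD('n)"

lemma divergence_id: "divergence (\<lambda>x::real^'n. x) x = CARD('n)"
proof -
  have "frechet_derivative (\<lambda>x::real^'n. x) (at x) = (\<lambda>h. h)"
    using frechet_derivative_at[OF has_derivative_ident[of "at x"]] by simp
  then show ?thesis by (simp add: divergence_def jacobian_def trace_def matrix_def axis_def)
qed

lemma C1_id: "C1 (\<lambda>x::'a::euclidean_space. x)"
  unfolding C1_def by (intro exI[of _ "\<lambda>_. id_blinfun"]) auto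

text \<open>The profile is the squared positive part of
  \<open>\<delta>\<^sup>2 - z \<bullet> z\<close>, normalised: of class C1, supported in the ball of
  radius \<open>\<delta>\<close>, and radially decreasing.\<close>

lemma mollifier_exists:
  assumes "0 < \<delta>"
  shows "\<exists>(\<rho> :: real^'n \<Rightarrow> real) G. mollifier \<delta> \<rho> G"
proof -
  define r :: "real^'n \<Rightarrow> real" where "r z = (max 0 (\<delta>\<^sup>2 - z \<bullet> z))\<^sup>2" for z
  define m :: "real^'n \<Rightarrow> real" where "m z = max 0 (\<delta>\<^sup>2 - z \<bullet> z)" for z
  have sq: "has_grad (\<lambda>z::real^'n. z \<bullet> z) (\<lambda>z. 2 *\<^sub>R z)"
    unfolding has_grad_def by (auto intro!: continuous_intros derivative_eq_intros simp: inner_commute)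
  have "has_grad r (\<lambda>z. (2 * max 0 (\<delta>\<^sup>2 - z \<bullet> z) * -1) *\<^sub>R (2 *\<^sub>R z))"
    unfolding r_def
  proof (rule has_grad_compose[OF sq])
    show "((\<lambda>t. (max 0 (\<delta>\<^sup>2 - t))\<^sup>2) has_real_derivative 2 * max 0 (\<delta>\<^sup>2 - t) * -1) (at t)" for t
      by (rule DERIV_chain'[of "\<lambda>t. \<delta>\<^sup>2 - t" "-1" t UNIV "\<lambda>t. (max 0 t)\<^sup>2"])
         (auto intro!: derivative_eq_intros DERIV_max0_square)
  qed (intro continuous_intros)
  then have r: "has_grad r (\<lambda>z. (- 4 * m z) *\<^sub>R z)" by (simp add: m_def mult.commute)
  have off: "\<delta>\<^sup>2 - z \<bullet> z \<le> 0" if "\<delta> \<le> norm z" for z :: "real^'n"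
    using that assms by (simp add: power2_norm_eq_inner[symmetric])
  then have r0: "r z = 0" "m z = 0" if "\<delta> \<le> norm z" for z using that by (auto simp: r_def m_def)
  have K0: "r z = 0" if "z \<notin> cball 0 \<delta>" for z using r0 that by auto
  have ir: "integrable lborel r"
    by (rule integrable_compact_support[OF has_grad_continuous[OF r] compact_cball K0])
  define Z where "Z = (LINT z|lborel. r z)"
  \<comment> \<open>A nonnegative function with integral 0 vanishes almost everywhere, but
    \<open>r\<close> is positive on a ball of positive measure.\<close>
  have "Z \<noteq> 0"
  proof
    assume "Z = 0"
    then have "AE z in lborel. r z = 0"
      using integral_nonneg_eq_0_iff_AE[OF ir] by (simp add: Z_def) (simp add: r_def)
    moreover have "r z \<noteq> 0" if "z \<in> ball 0 \<delta>" for z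
      using that assms power_strict_mono[of "norm z" \<delta> 2] by (auto simp: r_def power2_norm_eq_inner[symmetric])
    ultimately have "AE z in lborel. z \<notin> ball (0::real^'n) \<delta>" by (auto elim!: eventually_mono)
    then have "emeasure lborel (ball (0::real^'n) \<delta>) = 0"
      by (subst (asm) AE_iff_measurable[OF _ refl]) (auto simp: ball_def dist_norm)
    then show False using content_ball_pos[OF assms, of "0::real^'n"] by (simp add: measure_def)
  qed
  moreover have "0 \<le> Z" by (simp add: Z_def r_def)
  ultimately have Z: "0 < Z" by simp
  define \<rho> where "\<rho> z = r z * (1 / Z)" for z
  define G where "G z = (- 4 * m z / Z) *\<^sub>R z" for z
  have "has_grad \<rho> G"
    using has_grad_mult[OF r has_grad_const[of "1 / Z"]] by (simp add: \<rho>_def[abs_def] G_def[abs_def])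
  moreover have "(LINT z|lborel. \<rho> z) = 1" using Z by (simp add: \<rho>_def Z_def)
  moreover have "(LINT z|lborel. norm z * norm (G z)) = CARD('n)"
  proof -
    have \<rho>0: "\<rho> z = 0" if "z \<notin> cball 0 \<delta>" for z using K0 that by (simp add: \<rho>_def)
    have i\<rho>: "integrable lborel \<rho>" unfolding \<rho>_def using ir by simp
    \<comment> \<open>\<open>G z\<close> is a nonpositive multiple of z, so Cauchy-Schwarz is an
      equality up to sign; the divergence theorem for the identity field, of divergence N, then
      gives the integral.\<close>
    have "norm z * norm (G z) = - (G z \<bullet> z)" for z
      using Z by (simp add: G_def m_def power2_norm_eq_inner[symmetric] power2_eq_square abs_mult)
    moreover have "(LINT z|lborel. divergence (\<lambda>x. x) z * \<rho> z + G z \<bullet> z) = 0"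
      by (rule integral_divergence_eq_0[OF C1_id \<open>has_grad \<rho> G\<close> compact_cball \<rho>0])
    moreover have "integrable lborel (\<lambda>z. G z \<bullet> z)"
    proof (rule integrable_compact_support[OF _ compact_cball[of 0 \<delta>]])
      show "continuous_on UNIV (\<lambda>z. G z \<bullet> z)"
        by (rule continuous_on_inner[OF has_gradD(1)[OF \<open>has_grad \<rho> G\<close>] continuous_on_id])
    qed (use r0 in \<open>auto simp: G_def\<close>)
    ultimately show ?thesis using i\<rho> \<open>(LINT z|lborel. \<rho> z) = 1\<close> by (simp add: divergence_id)
  qed
  ultimately have "mollifier \<delta> \<rho> G"
    using Z r0 by (auto simp: mollifier_def \<rho>_def G_def r_def)
  then show ?thesis by blast
qed

text \<open>A C1 field need not be globally Lipschitz. On a ball the derivative is bounded, and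
  convexity of the ball permits the mean value inequality.\<close>

lemma C1_lipschitz_compact:
  fixes Y :: "real^'n \<Rightarrow> real^'n"
  assumes "C1 Y"
  obtains B where "0 < B" "\<And>x y. x \<in> cball 0 R \<Longrightarrow> y \<in> cball 0 R \<Longrightarrow> norm (Y x - Y y) \<le> B * norm (x - y)"
proof -
  obtain F' where F': "\<And>x. (Y has_derivative blinfun_apply (F' x)) (at x)" "continuous_on UNIV F'"
    using assms by (auto simp: C1_def)
  have "bounded (F' ` cball 0 R)"
    by (intro compact_imp_bounded compact_continuous_image continuous_on_subset[OF F'(2)]) auto
  then obtain B where B: "B > 0" "\<And>x. x \<in> cball 0 R \<Longrightarrow> norm (F' x) \<le> B"
    by (auto simp: bounded_pos)
  show ?thesis
  proof (rule that[OF B(1)])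
    fix x y :: "real^'n" assume "x \<in> cball 0 R" "y \<in> cball 0 R"
    then show "norm (Y x - Y y) \<le> B * norm (x - y)"
      by (intro differentiable_bound[OF convex_cball[of 0 R], where f' = "\<lambda>x. blinfun_apply (F' x)"])
         (use F'(1) B(2) in \<open>auto intro: has_derivative_at_withinI simp: norm_blinfun.rep_eq[symmetric]\<close>)
  qed
qed

lemma mollifierD:
  fixes \<rho> :: "real^'n \<Rightarrow> real"
  assumes "mollifier \<delta> \<rho> G"
  shows "has_grad \<rho> G" "0 \<le> \<rho> z" "\<delta> \<le> norm z \<Longrightarrow> \<rho> z = 0" "\<delta> \<le> norm z \<Longrightarrow> G z = 0"
    "(LINT z|lborel. \<rho> z) = 1" "(LINT z|lborel. norm z * norm (G z)) = CARD('n)"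
    "integrable lborel \<rho>" "integrable lborel (\<lambda>z. norm z * norm (G z))"
proof -
  show h: "has_grad \<rho> G" and z: "\<delta> \<le> norm z \<Longrightarrow> \<rho> z = 0" "\<delta> \<le> norm z \<Longrightarrow> G z = 0" for z
    using assms by (auto simp: mollifier_def)
  show "0 \<le> \<rho> z" "(LINT z|lborel. \<rho> z) = 1" "(LINT z|lborel. norm z * norm (G z)) = CARD('n)"
    using assms by (auto simp: mollifier_def)
  show "integrable lborel \<rho>"
    by (rule integrable_compact_support[OF has_grad_continuous[OF h] compact_cball[of 0 \<delta>]]) (simp add: z)
  show "integrable lborel (\<lambda>z. norm z * norm (G z))"
  proof (rule integrable_compact_support[OF _ compact_cball[of 0 \<delta>]])
    show "continuous_on UNIV (\<lambda>z. norm z * norm (G z))"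
      by (intro continuous_intros has_gradD(1)[OF h])
  qed (simp add: z)
qed

lemma C1_continuous:
  assumes "C1 F" shows "continuous_on S F"
  using assms unfolding C1_def
  by (meson continuous_at_imp_continuous_on has_derivative_continuous)

text \<open>The kernel as a function of the integration variable is the test function inserted into
  the weak identities; the reflection supplies the minus sign.\<close>

lemma has_grad_reflect:
  assumes "has_grad \<rho> G"
  shows "has_grad (\<lambda>y. \<rho> (x - y)) (\<lambda>y. - G (x - y))"
  unfolding has_grad_def
proof (intro conjI allI)
  show "continuous_on UNIV (\<lambda>y. - G (x - y))"
    by (auto intro!: continuous_intros continuous_on_compose2[OF has_gradD(1)[OF assms]])
  fix y
  have "((\<lambda>y. x - y) has_derivative (\<lambda>h. - h)) (at y)" by (auto intro!: derivative_eq_intros)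
  from has_derivative_compose[OF this has_gradD(2)[OF assms]]
  show "((\<lambda>y. \<rho> (x - y)) has_derivative (\<lambda>h. - G (x - y) \<bullet> h)) (at y)" by simp
qed

lemma mollifier_integral_translate:
  fixes \<rho> :: "real^'n \<Rightarrow> real"
  assumes "mollifier \<delta> \<rho> G"
  shows "integrable lborel (\<lambda>y. \<rho> (x - y))" "(LINT y|lborel. \<rho> (x - y)) = 1"
  using integrable_reflect[OF mollifierD(7)[OF assms], of x] mollifierD(5)[OF assms] by auto

lemma mollifier_off:
  fixes \<rho> :: "real^'n \<Rightarrow> real"
  assumes "mollifier \<delta> \<rho> G" "y \<notin> cball x \<delta>"
  shows "\<rho> (x - y) = 0" "G (x - y) = 0"
  using assms mollifierD(3,4)[OF assms(1), of "x - y"] by (auto simp: dist_norm)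

lemma integrable_conv:
  fixes \<rho> :: "real^'n \<Rightarrow> real"
  assumes m: "mollifier \<delta> \<rho> G" and g: "integrable lborel g"
  shows "integrable lborel (\<lambda>y. g y * \<rho> (x - y))"
proof -
  have "integrable lborel (\<lambda>y. g y *\<^sub>R \<rho> (x - y))"
    by (rule integrable_mult_compact_support[OF g has_grad_continuous[OF has_grad_reflect[OF mollifierD(1)[OF m]]]
        compact_cball[of x \<delta>]]) (rule mollifier_off(1)[OF m])
  then show ?thesis by simp
qed

lemma conv_diff_eq:
  fixes \<rho> :: "real^'n \<Rightarrow> real"
  assumes m: "mollifier \<delta> \<rho> G" and g: "integrable lborel g"
  shows "integrable lborel (\<lambda>y. (g y - g x) * \<rho> (x - y))"
    "conv \<rho> g x - g x = (LINT y|lborel. (g y - g x) * \<rho> (x - y))"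
  using integrable_conv[OF m g, of x] mollifier_integral_translate[OF m, of x]
  by (simp_all add: left_diff_distrib conv_def)

lemma conv_diff_le:
  fixes \<rho> :: "real^'n \<Rightarrow> real"
  assumes m: "mollifier \<delta> \<rho> G" and g: "integrable lborel g"
  shows "ennreal \<bar>conv \<rho> g x - g x\<bar> \<le> (\<integral>\<^sup>+y. ennreal (\<bar>g y - g x\<bar> * \<rho> (x - y)) \<partial>lborel)"
proof -
  note i = conv_diff_eq[OF m g, of x]
  have "ennreal \<bar>conv \<rho> g x - g x\<bar> \<le> ennreal (LINT y|lborel. norm ((g y - g x) * \<rho> (x - y)))"
    unfolding i(2) real_norm_def[symmetric] by (intro ennreal_leI integral_norm_bound)
  also have "\<dots> = (\<integral>\<^sup>+y. ennreal (norm ((g y - g x) * \<rho> (x - y))) \<partial>lborel)"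
    using i(1) by (intro nn_integral_eq_integral[symmetric]) auto
  also have "\<dots> = (\<integral>\<^sup>+y. ennreal (\<bar>g y - g x\<bar> * \<rho> (x - y)) \<partial>lborel)"
    using mollifierD(2)[OF m] by (simp add: abs_mult)
  finally show ?thesis .
qed

section \<open>Friedrichs' lemma\<close>

text \<open>The threshold serves all mollifiers of smaller scale at once, so that thresholds from
  different estimates can be combined by taking minima. The error is an average of translation
  defects with total weight one.\<close>

lemma conv_L1:
  fixes g :: "real^'n \<Rightarrow> real"
  assumes g: "integrable lborel g" and "0 < e"
  shows "\<exists>\<delta>0>0. \<forall>\<delta> \<rho> G. 0 < \<delta> \<and> \<delta> < \<delta>0 \<and> mollifier \<delta> \<rho> G \<longrightarrow>
    (\<integral>\<^sup>+x. ennreal \<bar>conv \<rho> g x - g x\<bar> \<partial>lborel) \<le> ennreal e"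
proof -
  obtain \<delta>0 where \<delta>0: "0 < \<delta>0" "\<And>z. norm z < \<delta>0 \<Longrightarrow> (LINT x|lborel. \<bar>g (x - z) - g x\<bar>) \<le> e"
    using L1_translation_small[OF g \<open>0 < e\<close>] by blast
  have "(\<integral>\<^sup>+x. ennreal \<bar>conv \<rho> g x - g x\<bar> \<partial>lborel) \<le> ennreal e"
    if "\<delta> < \<delta>0" and m: "mollifier \<delta> \<rho> G" for \<delta> \<rho> G
  proof -
    have "(\<integral>\<^sup>+x. ennreal \<bar>conv \<rho> g x - g x\<bar> \<partial>lborel)
      \<le> (\<integral>\<^sup>+x. \<integral>\<^sup>+y. ennreal (\<bar>g y - g x\<bar> * \<rho> (x - y)) \<partial>lborel \<partial>lborel)"
      by (intro nn_integral_mono conv_diff_le[OF m g])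
    also have "\<dots> \<le> ennreal (e * (LINT z|lborel. \<rho> z))"
      by (rule nn_integral_average_le[OF g mollifierD(7)[OF m] mollifierD(2)[OF m] mollifierD(3)[OF m]])
         (use \<delta>0(2) that(1) \<open>0 < e\<close> in auto)
    finally show ?thesis using mollifierD(5)[OF m] by simp
  qed
  then show ?thesis using \<delta>0(1) by blast
qed

lemma conv_uniform:
  fixes g :: "real^'n \<Rightarrow> real"
  assumes g: "continuous_on UNIV g" "compact K" "\<And>x. x \<notin> K \<Longrightarrow> g x = 0" and "0 < e"
  shows "\<exists>\<delta>0>0. \<forall>\<delta> \<rho> G x. 0 < \<delta> \<and> \<delta> < \<delta>0 \<and> mollifier \<delta> \<rho> G \<longrightarrow> \<bar>conv \<rho> g x - g x\<bar> \<le> e"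
proof -
  have ig: "integrable lborel g" by (rule integrable_compact_support[OF g])
  obtain d where d: "0 < d" "\<And>a b. norm (a - b) < d \<Longrightarrow> norm (g a - g b) \<le> e"
    using compact_support_uniformly_continuous[OF g \<open>0 < e\<close>] by blast
  have "\<bar>conv \<rho> g x - g x\<bar> \<le> e" if "\<delta> < d" and m: "mollifier \<delta> \<rho> G" for \<delta> \<rho> G x
  proof -
    note i = conv_diff_eq[OF m ig, of x]
    have "\<bar>conv \<rho> g x - g x\<bar> \<le> (LINT y|lborel. norm ((g y - g x) * \<rho> (x - y)))"
      unfolding i(2) real_norm_def[symmetric] by (rule integral_norm_bound)
    also have "\<dots> \<le> (LINT y|lborel. e * \<rho> (x - y))"
    proof (rule integral_mono)
      show "norm ((g y - g x) * \<rho> (x - y)) \<le> e * \<rho> (x - y)" for y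
      proof (cases "norm (y - x) < d")
        case True
        then show ?thesis using d(2)[of y x] mollifierD(2)[OF m, of "x - y"]
          by (simp add: abs_mult mult_right_mono)
      next
        case False
        then show ?thesis using mollifierD(3)[OF m, of "x - y"] that(1) by (simp add: norm_minus_commute)
      qed
    qed (use i(1) mollifier_integral_translate(1)[OF m] in auto)
    also have "\<dots> = e" using mollifier_integral_translate(2)[OF m] by simp
    finally show ?thesis .
  qed
  then show ?thesis using d(1) by blast
qed

text \<open>The commutator of the field with the convolution equals
  \<open>\<integral> (u y - u x) G (x - y) \<bullet> (Y x - Y y) dy\<close>: subtracting \<open>u x\<close> costs nothing because \<open>Y\<close> is
  divergence free. As \<open>Y\<close> is Lipschitz, the kernel is bounded by \<open>\<bar>z\<bar> \<bar>G z\<bar>\<close>, whose integral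
  does not depend on the scale of the mollifier.\<close>

lemma commutator_pointwise:
  fixes Y :: "real^'n \<Rightarrow> real^'n"
  assumes Y: "C1 Y" "\<And>x. divergence Y x = 0" and u: "integrable lborel u" and g: "integrable lborel g"
    and weak: "\<And>\<phi> \<Phi> K. has_grad \<phi> \<Phi> \<Longrightarrow> compact K \<Longrightarrow> K \<subseteq> V \<Longrightarrow> (\<And>x. x \<notin> K \<Longrightarrow> \<phi> x = 0) \<Longrightarrow>
      (LINT x|lborel. u x * (\<Phi> x \<bullet> Y x)) = - (LINT x|lborel. \<phi> x * g x)"
    and m: "mollifier \<delta> \<rho> G" and x: "cball x \<delta> \<subseteq> V"
    and B: "\<And>y. y \<in> cball x \<delta> \<Longrightarrow> norm (Y x - Y y) \<le> B * norm (x - y)" "0 \<le> B"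
  shows "ennreal \<bar>conv_grad G u x \<bullet> Y x - g x\<bar>
    \<le> (\<integral>\<^sup>+y. ennreal (\<bar>g y - g x\<bar> * \<rho> (x - y)) \<partial>lborel) +
      ennreal B * (\<integral>\<^sup>+y. ennreal (\<bar>u y - u x\<bar> * (norm (x - y) * norm (G (x - y)))) \<partial>lborel)"
proof -
  let ?k = "\<lambda>y. norm (x - y) * norm (G (x - y))" and ?w = "\<lambda>y. (u y - u x) * (G (x - y) \<bullet> (Y x - Y y))"
  note r = has_grad_reflect[OF mollifierD(1)[OF m], of x]
  have Gc: "continuous_on UNIV (\<lambda>y. G (x - y))"
    using continuous_on_minus[OF has_gradD(1)[OF r]] by simp
  have Yc: "continuous_on UNIV Y"
    by (rule C1_continuous[OF Y(1)])
  have G0: "G (x - y) = 0" if "y \<notin> cball x \<delta>" for y using mollifier_off(2)[OF m that] .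
  have \<rho>0: "\<rho> (x - y) = 0" if "y \<notin> cball x \<delta>" for y using mollifier_off(1)[OF m that] .
  have "integrable lborel (\<lambda>y. u y *\<^sub>R G (x - y))"
    by (rule integrable_mult_compact_support[OF u Gc compact_cball G0])
  then have 1: "conv_grad G u x \<bullet> Y x = (LINT y|lborel. u y * (G (x - y) \<bullet> Y x))"
    unfolding conv_grad_def by (subst integral_inner_left[symmetric]) auto
  \<comment> \<open>The sign in the weak identity cancels against the sign of the reflected
    gradient.\<close>
  have 2: "conv \<rho> g x = (LINT y|lborel. u y * (G (x - y) \<bullet> Y y))"
    using weak[OF r compact_cball x \<rho>0] by (simp add: conv_def mult.commute)
  have 3: "(LINT y|lborel. G (x - y) \<bullet> Y y) = 0"
    using integral_divergence_eq_0[OF Y(1) r compact_cball \<rho>0] Y(2) by simp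
  have 4: "(LINT y|lborel. G (x - y) \<bullet> Y x) = 0"
    using integral_grad_eq_0[OF r compact_cball \<rho>0] by simp
  have c1: "continuous_on UNIV (\<lambda>y. G (x - y) \<bullet> Y x)" and c2: "continuous_on UNIV (\<lambda>y. G (x - y) \<bullet> Y y)"
    by (intro continuous_intros Gc Yc)+
  have z1: "G (x - y) \<bullet> Y x = 0" and z2: "G (x - y) \<bullet> Y y = 0" if "y \<notin> cball x \<delta>" for y
    using G0[OF that] by auto
  have i1: "integrable lborel (\<lambda>y. G (x - y) \<bullet> Y x)" "integrable lborel (\<lambda>y. u y * (G (x - y) \<bullet> Y x))"
    using integrable_compact_support[OF c1 compact_cball z1] integrable_mult_compact_support[OF u c1 compact_cball z1] by auto
  have i2: "integrable lborel (\<lambda>y. G (x - y) \<bullet> Y y)" "integrable lborel (\<lambda>y. u y * (G (x - y) \<bullet> Y y))"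
    using integrable_compact_support[OF c2 compact_cball z2] integrable_mult_compact_support[OF u c2 compact_cball z2] by auto
  have eq: "?w y
     = (u y * (G (x - y) \<bullet> Y x) - u y * (G (x - y) \<bullet> Y y)) - (u x * (G (x - y) \<bullet> Y x) - u x * (G (x - y) \<bullet> Y y))" for y
    by (simp add: inner_diff_right algebra_simps)
  have i: "integrable lborel (\<lambda>y. ?w y)"
    unfolding eq using i1 i2 by auto
  have "(LINT y|lborel. ?w y) = conv_grad G u x \<bullet> Y x - conv \<rho> g x"
    unfolding eq using i1 i2 1 2 3 4 by simp
  then have "\<bar>conv_grad G u x \<bullet> Y x - g x\<bar>
    \<le> \<bar>conv \<rho> g x - g x\<bar> + \<bar>LINT y|lborel. ?w y\<bar>" by linarith
  then have "ennreal \<bar>conv_grad G u x \<bullet> Y x - g x\<bar>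
    \<le> ennreal \<bar>conv \<rho> g x - g x\<bar> + ennreal \<bar>LINT y|lborel. ?w y\<bar>"
    by (simp flip: ennreal_plus)
  also have "\<dots> \<le> (\<integral>\<^sup>+y. ennreal (\<bar>g y - g x\<bar> * \<rho> (x - y)) \<partial>lborel) +
      ennreal B * (\<integral>\<^sup>+y. ennreal (\<bar>u y - u x\<bar> * ?k y) \<partial>lborel)"
  proof (rule add_mono[OF conv_diff_le[OF m g]])
    have [measurable]: "u \<in> borel_measurable borel" "(\<lambda>y. G (x - y)) \<in> borel_measurable borel"
      using u borel_measurable_continuous_onI[OF Gc] by auto
    have "ennreal \<bar>LINT y|lborel. ?w y\<bar>
      \<le> ennreal (LINT y|lborel. norm (?w y))"
      unfolding real_norm_def[symmetric] by (intro ennreal_leI integral_norm_bound)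
    also have "\<dots> = (\<integral>\<^sup>+y. ennreal (norm (?w y)) \<partial>lborel)"
      using i by (intro nn_integral_eq_integral[symmetric]) auto
    also have "\<dots> \<le> (\<integral>\<^sup>+y. ennreal B * ennreal (\<bar>u y - u x\<bar> * ?k y) \<partial>lborel)"
    proof (rule nn_integral_mono)
      fix y
      have "\<bar>G (x - y) \<bullet> (Y x - Y y)\<bar> \<le> B * ?k y"
      proof (cases "y \<in> cball x \<delta>")
        case True
        have "\<bar>G (x - y) \<bullet> (Y x - Y y)\<bar> \<le> norm (G (x - y)) * norm (Y x - Y y)" by (rule Cauchy_Schwarz_ineq2)
        also have "\<dots> \<le> norm (G (x - y)) * (B * norm (x - y))" by (intro mult_left_mono B(1)[OF True]) simp
        finally show ?thesis by (simp add: mult_ac)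
      qed (simp add: G0)
      then have "norm (?w y) \<le> \<bar>u y - u x\<bar> * (B * ?k y)"
        unfolding real_norm_def abs_mult by (rule mult_left_mono) simp
      also have "\<dots> = B * (\<bar>u y - u x\<bar> * ?k y)" by (simp add: mult_ac)
      finally show "ennreal (norm (?w y))
         \<le> ennreal B * ennreal (\<bar>u y - u x\<bar> * ?k y)"
        using B(2) by (simp flip: ennreal_mult add: ennreal_leI)
    qed
    also have "\<dots> = ennreal B * (\<integral>\<^sup>+y. ennreal (\<bar>u y - u x\<bar> * ?k y) \<partial>lborel)"
      by (rule nn_integral_cmult) measurable
    finally show "ennreal \<bar>LINT y|lborel. ?w y\<bar> \<le> \<dots>" .
  qed
  finally show ?thesis .
qed

text \<open>Integrating the pointwise bound over \<open>L\<close> leaves two averages of translation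
  defects, of \<open>g\<close> with weight 1 and of \<open>u\<close> with weight N. Neither weight
  depends on the scale, so both averages tend to 0 with it.\<close>

lemma friedrichs:
  fixes Y :: "real^'n \<Rightarrow> real^'n"
  assumes Y: "C1 Y" "\<And>x. divergence Y x = 0" and u: "integrable lborel u" and g: "integrable lborel g"
    and V: "open V" "compact L" "L \<subseteq> V"
    and weak: "\<And>\<phi> \<Phi> K. has_grad \<phi> \<Phi> \<Longrightarrow> compact K \<Longrightarrow> K \<subseteq> V \<Longrightarrow> (\<And>x. x \<notin> K \<Longrightarrow> \<phi> x = 0) \<Longrightarrow>
      (LINT x|lborel. u x * (\<Phi> x \<bullet> Y x)) = - (LINT x|lborel. \<phi> x * g x)"
    and "0 < e"
  shows "\<exists>\<delta>0>0. \<forall>\<delta> \<rho> G. 0 < \<delta> \<and> \<delta> < \<delta>0 \<and> mollifier \<delta> \<rho> G \<longrightarrow>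
    (\<integral>\<^sup>+x\<in>L. ennreal \<bar>conv_grad G u x \<bullet> Y x - g x\<bar> \<partial>lborel) \<le> ennreal e"
proof -
  have mg[measurable]: "u \<in> borel_measurable borel" "g \<in> borel_measurable borel" using u g by auto
  obtain R where R: "L \<subseteq> cball 0 R"
    using compact_imp_bounded[OF V(2)] unfolding bounded_iff by (auto simp: subset_iff)
  obtain B where B: "0 < B" "\<And>x y. x \<in> cball 0 (R + 1) \<Longrightarrow> y \<in> cball 0 (R + 1) \<Longrightarrow> norm (Y x - Y y) \<le> B * norm (x - y)"
    using C1_lipschitz_compact[OF Y(1), of "R + 1"] by blast
  obtain r where r: "0 < r" "(\<Union>x\<in>L. cball x r) \<subseteq> V"
    by (rule compact_subset_open_imp_cball_epsilon_subset[OF V(2,1,3)])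
  \<comment> \<open>The kernel has mass \<open>CARD('n)\<close> and carries the Lipschitz constant
    \<open>B\<close>, so the commutator part amounts to e / 2.\<close>
  define e1 where "e1 = e / (2 * (B * CARD('n)))"
  have "0 < e1" using \<open>0 < e\<close> B(1) by (simp add: e1_def)
  obtain \<delta>u where \<delta>u: "0 < \<delta>u" "\<And>z. norm z < \<delta>u \<Longrightarrow> (LINT x|lborel. \<bar>u (x - z) - u x\<bar>) \<le> e1"
    using L1_translation_small[OF u \<open>0 < e1\<close>] by blast
  obtain \<delta>g where \<delta>g: "0 < \<delta>g" "\<And>z. norm z < \<delta>g \<Longrightarrow> (LINT x|lborel. \<bar>g (x - z) - g x\<bar>) \<le> e / 2"
    using L1_translation_small[OF g, of "e / 2"] \<open>0 < e\<close> by auto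
  \<comment> \<open>\<open>r\<close> keeps the support of the kernel inside \<open>V\<close>, where
    the weak identity holds; 1 keeps it in the ball of radius \<open>R + 1\<close>, where
    \<open>B\<close> is a Lipschitz constant.\<close>
  define \<delta>0 where "\<delta>0 = min (min \<delta>u \<delta>g) (min r 1)"
  have "(\<integral>\<^sup>+x\<in>L. ennreal \<bar>conv_grad G u x \<bullet> Y x - g x\<bar> \<partial>lborel) \<le> ennreal e"
    if \<delta>: "\<delta> < \<delta>0" and m: "mollifier \<delta> \<rho> G" for \<delta> \<rho> G
  proof -
    have [measurable]: "\<rho> \<in> borel_measurable borel" "G \<in> borel_measurable borel"
      using has_gradD(1)[OF mollifierD(1)[OF m]] has_grad_continuous[OF mollifierD(1)[OF m]]
      by (auto intro: borel_measurable_continuous_onI)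
    let ?A = "\<lambda>x. \<integral>\<^sup>+y. ennreal (\<bar>g y - g x\<bar> * \<rho> (x - y)) \<partial>lborel"
    let ?B = "\<lambda>x. \<integral>\<^sup>+y. ennreal (\<bar>u y - u x\<bar> * (norm (x - y) * norm (G (x - y)))) \<partial>lborel"
    have "(\<integral>\<^sup>+x\<in>L. ennreal \<bar>conv_grad G u x \<bullet> Y x - g x\<bar> \<partial>lborel) \<le> (\<integral>\<^sup>+x. ?A x + ennreal B * ?B x \<partial>lborel)"
    proof (rule nn_integral_mono)
      fix x
      show "ennreal \<bar>conv_grad G u x \<bullet> Y x - g x\<bar> * indicator L x \<le> ?A x + ennreal B * ?B x"
      proof (cases "x \<in> L")
        case True
        have "cball x \<delta> \<subseteq> cball x r" using \<delta> by (intro subset_cball) (simp add: \<delta>0_def)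
        then have xV: "cball x \<delta> \<subseteq> V" using r(2) True by blast
        have x: "norm x \<le> R" using R True by auto
        have "norm (Y x - Y y) \<le> B * norm (x - y)" if "y \<in> cball x \<delta>" for y
        proof -
          have "norm y \<le> norm x + norm (x - y)" using norm_triangle_ineq4[of x "x - y"] by simp
          then have "norm y \<le> R + 1" using that \<delta> x by (simp add: dist_norm \<delta>0_def)
          then show ?thesis using x by (intro B(2)) auto
        qed
        note lip = this
        have "ennreal \<bar>conv_grad G u x \<bullet> Y x - g x\<bar> \<le> ?A x + ennreal B * ?B x"
        proof (rule commutator_pointwise[OF Y u g _ m xV lip])
          fix \<phi> \<Phi> K assume "has_grad \<phi> \<Phi>" "compact K" "K \<subseteq> V" "\<And>x. x \<notin> K \<Longrightarrow> \<phi> x = 0"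
          then show "(LINT x|lborel. u x * (\<Phi> x \<bullet> Y x)) = - (LINT x|lborel. \<phi> x * g x)" by (rule weak)
        qed (use B(1) in auto)
        then show ?thesis using True by simp
      qed simp
    qed
    also have "\<dots> = (\<integral>\<^sup>+x. ?A x \<partial>lborel) + ennreal B * (\<integral>\<^sup>+x. ?B x \<partial>lborel)"
    proof -
      have [measurable]: "?A \<in> borel_measurable borel" by measurable
      have [measurable]: "?B \<in> borel_measurable borel" by measurable
      have "(\<integral>\<^sup>+x. ?A x + ennreal B * ?B x \<partial>lborel) = (\<integral>\<^sup>+x. ?A x \<partial>lborel) + (\<integral>\<^sup>+x. ennreal B * ?B x \<partial>lborel)"
        by (rule nn_integral_add) measurable
      also have "(\<integral>\<^sup>+x. ennreal B * ?B x \<partial>lborel) = ennreal B * (\<integral>\<^sup>+x. ?B x \<partial>lborel)"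
        by (rule nn_integral_cmult) measurable
      finally show ?thesis .
    qed
    also have "\<dots> \<le> ennreal (e / 2 * (LINT z|lborel. \<rho> z)) + ennreal B * ennreal (e1 * (LINT z|lborel. norm z * norm (G z)))"
    proof (intro add_mono mult_left_mono)
      show "(\<integral>\<^sup>+x. ?A x \<partial>lborel) \<le> ennreal (e / 2 * (LINT z|lborel. \<rho> z))"
        by (rule nn_integral_average_le[OF g mollifierD(7)[OF m] mollifierD(2)[OF m] mollifierD(3)[OF m]])
           (use \<delta>g(2) \<delta> \<open>0 < e\<close> in \<open>auto simp: \<delta>0_def\<close>)
      show "(\<integral>\<^sup>+x. ?B x \<partial>lborel) \<le> ennreal (e1 * (LINT z|lborel. norm z * norm (G z)))"
        by (rule nn_integral_average_le[OF u mollifierD(8)[OF m], of \<delta>])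
           (use \<delta>u(2) \<delta> \<open>0 < e1\<close> mollifierD(4)[OF m] in \<open>auto simp: \<delta>0_def\<close>)
    qed simp
    also have "\<dots> = ennreal (e / 2 + B * (e1 * CARD('n)))"
      using mollifierD(5,6)[OF m] B(1) \<open>0 < e\<close> \<open>0 < e1\<close> by (simp flip: ennreal_plus ennreal_mult)
    also have "e / 2 + B * (e1 * CARD('n)) = e" using B(1) by (simp add: e1_def field_simps)
    finally show ?thesis .
  qed
  moreover have "0 < \<delta>0" using \<delta>u(1) \<delta>g(1) r(1) by (simp add: \<delta>0_def)
  ultimately show ?thesis by blast
qed

section \<open>Weak gradients\<close>

lemma grad_eq:
  assumes "has_grad \<phi> \<Phi>" shows "grad X \<phi> x = (\<chi> i. \<Phi> x \<bullet> X i x)"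
  using frechet_derivative_at[OF has_gradD(2)[OF assms, of x]] by (simp add: grad_def)

lemma subgradientD:
  assumes "subgradient X"
  shows "C1 (X i)" "divergence (X i) x = 0" "continuous_on S (X i)"
  using assms by (auto simp: subgradient_def intro: C1_continuous)

lemma continuous_lebesgue_measurable:
  fixes f :: "'a::euclidean_space \<Rightarrow> 'b::euclidean_space"
  assumes "continuous_on UNIV f" shows "f \<in> borel_measurable lebesgue"
  by (rule measurable_completion) (simp add: borel_measurable_continuous_onI[OF assms])

lemma grad_continuous:
  fixes X :: "'k::finite \<Rightarrow> real^'n \<Rightarrow> real^'n"
  assumes "subgradient X" "has_grad \<phi> \<Phi>" shows "continuous_on UNIV (grad X \<phi>)"
  unfolding grad_eq[OF assms(2), abs_def]
  by (intro continuous_intros has_gradD(1)[OF assms(2)] subgradientD(3)[OF assms(1)])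

lemma grad_off:
  assumes "has_grad \<phi> \<Phi>" "compact K" "\<And>x. x \<notin> K \<Longrightarrow> \<phi> x = 0" "x \<notin> K"
  shows "grad X \<phi> x = 0"
proof -
  have "\<Phi> x \<bullet> X i x = 0" for i using has_grad_off[OF assms] by simp
  then show ?thesis by (simp add: grad_eq[OF assms(1)] vec_eq_iff)
qed

lemma locally_integrable_cutoff:
  assumes "locally_integrable_on U g" "compact K" "K \<subseteq> U"
  shows "integrable lebesgue (\<lambda>x. indicator K x *\<^sub>R g x)"
  using assms by (auto simp: locally_integrable_on_def set_integrable_def)

lemma integrable_mult_cutoff:
  fixes g :: "real^'n \<Rightarrow> 'b::euclidean_space"
  assumes g: "locally_integrable_on U g" "compact K" "K \<subseteq> U"
    and \<psi>: "continuous_on UNIV \<psi>" "\<And>x. x \<notin> K \<Longrightarrow> \<psi> x = 0"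
  shows "integrable lebesgue (\<lambda>x. \<psi> x *\<^sub>R g x)"
proof -
  obtain B where B: "\<And>x. norm (\<psi> x) \<le> B" using compact_support_bounded[OF \<psi>(1) g(2) \<psi>(2)] by blast
  note i = locally_integrable_cutoff[OF g]
  have [measurable]: "\<psi> \<in> borel_measurable lebesgue" by (rule continuous_lebesgue_measurable[OF \<psi>(1)])
  have "integrable lebesgue (\<lambda>x. \<psi> x *\<^sub>R (indicator K x *\<^sub>R g x))"
  proof (rule Bochner_Integration.integrable_bound[of _ "\<lambda>x. B * norm (indicator K x *\<^sub>R g x)"])
    show "(\<lambda>x. \<psi> x *\<^sub>R (indicator K x *\<^sub>R g x)) \<in> borel_measurable lebesgue"
      by (rule borel_measurable_scaleR[OF _ borel_measurable_integrable[OF i]]) measurable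
    show "AE x in lebesgue. norm (\<psi> x *\<^sub>R (indicator K x *\<^sub>R g x)) \<le> norm (B * norm (indicator K x *\<^sub>R g x))"
    proof (rule AE_I2)
      fix x
      have "norm (\<psi> x *\<^sub>R (indicator K x *\<^sub>R g x)) = norm (\<psi> x) * norm (indicator K x *\<^sub>R g x)"
        by (simp only: norm_scaleR real_norm_def)
      also have "\<dots> \<le> B * norm (indicator K x *\<^sub>R g x)" by (rule mult_right_mono[OF B]) simp
      also have "\<dots> \<le> norm (B * norm (indicator K x *\<^sub>R g x))" unfolding real_norm_def by (rule abs_ge_self)
      finally show "norm (\<psi> x *\<^sub>R (indicator K x *\<^sub>R g x)) \<le> norm (B * norm (indicator K x *\<^sub>R g x))" .
    qed
  qed (intro integrable_mult_right integrable_norm i)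
  also have "(\<lambda>x. \<psi> x *\<^sub>R (indicator K x *\<^sub>R g x)) = (\<lambda>x. \<psi> x *\<^sub>R g x)"
  proof
    fix x show "\<psi> x *\<^sub>R (indicator K x *\<^sub>R g x) = \<psi> x *\<^sub>R g x" using \<psi>(2)[of x] by (cases "x \<in> K") auto
  qed
  finally show ?thesis .
qed

lemma integrable_cutoff_mult:
  fixes u :: "real^'n \<Rightarrow> real" and H :: "real^'n \<Rightarrow> real^'m"
  assumes u: "locally_integrable_on U u" "compact K" "K \<subseteq> U"
    and H: "continuous_on UNIV H" "\<And>x. x \<notin> K \<Longrightarrow> H x = 0"
  shows "integrable lebesgue (\<lambda>x. u x *\<^sub>R H x)"
proof -
  obtain B where B: "0 < B" "\<And>x. norm (H x) \<le> B" using compact_support_bounded[OF H(1) u(2) H(2)] by blast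
  note i = locally_integrable_cutoff[OF u]
  have eq: "(\<lambda>x. u x *\<^sub>R H x) = (\<lambda>x. (indicator K x *\<^sub>R u x) *\<^sub>R H x)"
  proof
    fix x show "u x *\<^sub>R H x = (indicator K x *\<^sub>R u x) *\<^sub>R H x" using H(2)[of x] by (cases "x \<in> K") auto
  qed
  have *: "(\<lambda>x. (indicator K x *\<^sub>R u x) *\<^sub>R H x) \<in> borel_measurable lebesgue"
    by (rule borel_measurable_scaleR[OF borel_measurable_integrable[OF i] continuous_lebesgue_measurable[OF H(1)]])
  have "integrable lebesgue (\<lambda>x. (indicator K x *\<^sub>R u x) *\<^sub>R H x)"
  proof (rule Bochner_Integration.integrable_bound[of _ "\<lambda>x. B * norm (indicator K x *\<^sub>R u x)", OF _ *])
    show "AE x in lebesgue. norm ((indicator K x *\<^sub>R u x) *\<^sub>R H x) \<le> norm (B * norm (indicator K x *\<^sub>R u x))"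
    proof (rule AE_I2)
      fix x
      have "norm ((indicator K x *\<^sub>R u x) *\<^sub>R H x) = norm (indicator K x *\<^sub>R u x) * norm (H x)"
        by (simp only: norm_scaleR real_norm_def)
      also have "\<dots> \<le> norm (indicator K x *\<^sub>R u x) * B" by (rule mult_left_mono[OF B(2)]) simp
      also have "\<dots> = B * norm (indicator K x *\<^sub>R u x)" by (rule mult.commute)
      also have "\<dots> \<le> norm (B * norm (indicator K x *\<^sub>R u x))" unfolding real_norm_def by (rule abs_ge_self)
      finally show "norm ((indicator K x *\<^sub>R u x) *\<^sub>R H x) \<le> norm (B * norm (indicator K x *\<^sub>R u x))" .
    qed
  qed (intro integrable_mult_right integrable_norm i)
  then show ?thesis unfolding eq .
qed

lemma test_functionI:
  fixes \<phi> :: "real^'n \<Rightarrow> real"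
  assumes "has_grad \<phi> \<Phi>" "compact K" "K \<subseteq> U" "\<And>x. x \<notin> K \<Longrightarrow> \<phi> x = 0"
  shows "test_function U \<phi>"
proof -
  have "closure {x. \<phi> x \<noteq> 0} \<subseteq> K"
    by (rule closure_minimal) (use assms compact_imp_closed in auto)
  moreover from this have "compact (closure {x. \<phi> x \<noteq> 0})"
    using compact_Int_closed[OF assms(2) closed_closure, of "{x. \<phi> x \<noteq> 0}"] by (simp add: Int_absorb1)
  ultimately show ?thesis using assms has_grad_imp_C1 by (auto simp: test_function_def)
qed

lemma test_functionE:
  fixes \<phi> :: "real^'n \<Rightarrow> real"
  assumes "test_function U \<phi>"
  obtains \<Phi> K where "has_grad \<phi> \<Phi>" "compact K" "K \<subseteq> U" "\<forall>x. x \<notin> K \<longrightarrow> \<phi> x = 0"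
proof -
  have t: "C1 \<phi>" "compact (closure {x. \<phi> x \<noteq> 0})" "closure {x. \<phi> x \<noteq> 0} \<subseteq> U"
    using assms by (auto simp: test_function_def)
  obtain \<Phi> where \<Phi>: "has_grad \<phi> \<Phi>" by (rule C1_imp_has_grad[OF t(1)])
  have "\<phi> x = 0" if "x \<notin> closure {x. \<phi> x \<noteq> 0}" for x using that closure_subset[of "{x. \<phi> x \<noteq> 0}"] by auto
  then show ?thesis using that[OF \<Phi> t(2,3)] by blast
qed

text \<open>Components may be taken under the integral once both sides are integrable, which the
  compact support of \<open>\<phi>\<close> inside \<open>U\<close> guarantees.\<close>

lemma weak_gradient_component:
  fixes X :: "'k::finite \<Rightarrow> real^'n \<Rightarrow> real^'n"
  assumes X: "subgradient X" and w: "weak_gradient_on U X u g"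
    and \<phi>: "has_grad \<phi> \<Phi>" and K: "compact K" "K \<subseteq> U" "\<And>x. x \<notin> K \<Longrightarrow> \<phi> x = 0"
  shows "(LINT x|lebesgue. u x * (\<Phi> x \<bullet> X i x)) = - (LINT x|lebesgue. \<phi> x * g x $ i)"
proof -
  have u: "locally_integrable_on U u" and g: "locally_integrable_on U g"
    and eq: "(LINT x|lebesgue. u x *\<^sub>R grad X \<phi> x) = - (LINT x|lebesgue. \<phi> x *\<^sub>R g x)"
    using w test_functionI[OF \<phi> K] by (auto simp: weak_gradient_on_def)
  have 1: "integrable lebesgue (\<lambda>x. u x *\<^sub>R grad X \<phi> x)"
    by (rule integrable_cutoff_mult[OF u K(1,2) grad_continuous[OF X \<phi>]]) (rule grad_off[OF \<phi> K(1,3)])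
  have 2: "integrable lebesgue (\<lambda>x. \<phi> x *\<^sub>R g x)"
    by (rule integrable_mult_cutoff[OF g K(1,2) has_grad_continuous[OF \<phi>] K(3)])
  have "(LINT x|lebesgue. (u x *\<^sub>R grad X \<phi> x) $ i) = - (LINT x|lebesgue. (\<phi> x *\<^sub>R g x) $ i)"
    using eq integral_bounded_linear[OF bounded_linear_vec_nth 1, of i] integral_bounded_linear[OF bounded_linear_vec_nth 2, of i]
    by simp
  then show ?thesis by (simp add: grad_eq[OF \<phi>])
qed

text \<open>Constants have weak gradient 0: this is vanishing divergence, applied to each field of
  the family.\<close>

lemma integral_grad_test_eq_0:
  fixes X :: "'k::finite \<Rightarrow> real^'n \<Rightarrow> real^'n"
  assumes X: "subgradient X" and \<phi>: "has_grad \<phi> \<Phi>" and K: "compact K" "\<And>x. x \<notin> K \<Longrightarrow> \<phi> x = 0"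
  shows "integrable lebesgue (grad X \<phi>)" "(LINT x|lebesgue. grad X \<phi> x) = 0"
proof -
  have i: "integrable lborel (grad X \<phi>)"
    by (rule integrable_compact_support[OF grad_continuous[OF X \<phi>] K(1)]) (rule grad_off[OF \<phi> K])
  then show "integrable lebesgue (grad X \<phi>)" by (simp add: integrable_completion)
  have "(LINT x|lborel. grad X \<phi> x) $ j = 0" for j
  proof -
    have "(LINT x|lborel. grad X \<phi> x) $ j = (LINT x|lborel. grad X \<phi> x $ j)"
      by (rule integral_bounded_linear[OF bounded_linear_vec_nth i, symmetric])
    also have "\<dots> = 0"
      using integral_divergence_eq_0[OF subgradientD(1)[OF X, of j] \<phi> K]
      by (simp add: grad_eq[OF \<phi>] subgradientD(2)[OF X])
    finally show ?thesis .
  qed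
  then show "(LINT x|lebesgue. grad X \<phi> x) = 0"
    using i by (simp add: integral_completion vec_eq_iff)
qed

text \<open>Weak gradients are local and insensitive to additive constants. This replaces a locally
  integrable function by a globally integrable one that can be convolved.\<close>

lemma weak_gradient_shift:
  fixes X :: "'k::finite \<Rightarrow> real^'n \<Rightarrow> real^'n"
  assumes X: "subgradient X" and w: "weak_gradient_on U X u g" and "V \<subseteq> U"
    and v: "integrable lebesgue v" "AE x in lebesgue. x \<in> V \<longrightarrow> v x = u x - c"
  shows "weak_gradient_on V X v g"
  unfolding weak_gradient_on_def
proof (intro conjI allI impI)
  show "locally_integrable_on V v"
    unfolding locally_integrable_on_def set_integrable_def
    by (intro allI impI integrable_mult_indicator v(1)) (auto simp: lmeasurable_compact fmeasurableD)
  show "locally_integrable_on V g"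
    using w \<open>V \<subseteq> U\<close> by (auto simp: weak_gradient_on_def locally_integrable_on_def)
  fix \<phi> assume \<phi>: "test_function V \<phi>"
  obtain \<Phi> K where t': "has_grad \<phi> \<Phi>" "compact K" "K \<subseteq> V" "\<forall>x. x \<notin> K \<longrightarrow> \<phi> x = 0"
    by (rule test_functionE[OF \<phi>])
  note t = t'(1-3) t'(4)[rule_format]
  have KU: "K \<subseteq> U" using t(3) \<open>V \<subseteq> U\<close> by blast
  note off = grad_off[OF t(1,2,4)]
  have "locally_integrable_on U u" using w by (simp add: weak_gradient_on_def)
  then have i: "integrable lebesgue (\<lambda>x. u x *\<^sub>R grad X \<phi> x)"
    by (rule integrable_cutoff_mult[OF _ t(2) KU grad_continuous[OF X t(1)] off])
  note i0 = integral_grad_test_eq_0[OF X t(1,2,4)]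
  have "AE x in lebesgue. v x *\<^sub>R grad X \<phi> x = u x *\<^sub>R grad X \<phi> x - c *\<^sub>R grad X \<phi> x"
    using v(2) by eventually_elim (metis off scaleR_left_diff_distrib scaleR_zero_right subsetD t(3) diff_zero)
  moreover have "(\<lambda>x. v x *\<^sub>R grad X \<phi> x) \<in> borel_measurable lebesgue"
    using v(1) continuous_lebesgue_measurable[OF grad_continuous[OF X t(1)]] by (intro borel_measurable_scaleR) auto
  moreover have "(\<lambda>x. u x *\<^sub>R grad X \<phi> x - c *\<^sub>R grad X \<phi> x) \<in> borel_measurable lebesgue"
    using i i0(1) by auto
  ultimately have "(LINT x|lebesgue. v x *\<^sub>R grad X \<phi> x) = (LINT x|lebesgue. u x *\<^sub>R grad X \<phi> x - c *\<^sub>R grad X \<phi> x)"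
    by (intro integral_cong_AE)
  also have "\<dots> = (LINT x|lebesgue. u x *\<^sub>R grad X \<phi> x)" using i i0 by simp
  also have "\<dots> = - (LINT x|lebesgue. \<phi> x *\<^sub>R g x)"
    using w test_functionI[OF t(1,2) KU t(4)] by (auto simp: weak_gradient_on_def)
  finally show "(LINT x|lebesgue. v x *\<^sub>R grad X \<phi> x) = - (LINT x|lebesgue. \<phi> x *\<^sub>R g x)" .
qed

lemma compact_nbhd:
  fixes L :: "'a::euclidean_space set"
  assumes "compact L" "open U" "L \<subseteq> U"
  obtains V K where "open V" "compact K" "L \<subseteq> V" "V \<subseteq> K" "K \<subseteq> U"
proof -
  obtain r where r: "0 < r" "(\<Union>x\<in>L. cball x r) \<subseteq> U"
    by (rule compact_subset_open_imp_cball_epsilon_subset[OF assms])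
  have eq: "(\<Union>x\<in>L. cball x r) = {x + y |x y. x \<in> L \<and> y \<in> cball 0 r}"
    by (auto simp: dist_norm) (metis add_diff_cancel_left' diff_add_cancel norm_minus_commute add.commute)+
  show ?thesis
  proof (rule that[of "\<Union>x\<in>L. ball x r" "\<Union>x\<in>L. cball x r"])
    show "compact (\<Union>x\<in>L. cball x r)" unfolding eq by (intro compact_sums assms compact_cball)
    show "L \<subseteq> (\<Union>x\<in>L. ball x r)" "(\<Union>x\<in>L. ball x r) \<subseteq> (\<Union>x\<in>L. cball x r)" using r(1) by force+
  qed (use r in auto)
qed

text \<open>Translations and Tonelli are used over \<open>lborel\<close>, whereas weak gradients are
  only Lebesgue measurable; a change on a null set mediates.\<close>

lemma lebesgue_integrable_borel_version:
  fixes g :: "'a::euclidean_space \<Rightarrow> real"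
  assumes "integrable lebesgue g"
  obtains g' where "integrable lborel g'" "AE x in lebesgue. g x = g' x"
proof -
  obtain g' where g': "g' \<in> borel_measurable lborel" "AE x in lborel. g x = g' x"
    using completion_ex_borel_measurable_real[of g lborel] assms by auto
  then have AE: "AE x in lebesgue. g x = g' x" by (simp add: AE_completion)
  have "integrable lebesgue g'"
    by (rule iffD1[OF integrable_cong_AE[OF borel_measurable_integrable[OF assms] measurable_completion[OF g'(1)] AE] assms])
  then have "integrable lborel g'" using g'(1) by (simp add: integrable_completion)
  with AE show ?thesis using that by blast
qed

text \<open>Friedrichs' lemma for each component. As \<open>g\<close> is only locally integrable it
  is cut off to \<open>K\<close>, and replaced by a Borel version; test functions supported in
  \<open>V\<close>, which lies in \<open>K\<close>, do not notice.\<close>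

lemma weak_gradient_mollify:
  fixes X :: "'k::finite \<Rightarrow> real^'n \<Rightarrow> real^'n"
  assumes X: "subgradient X" and u: "integrable lborel u" and w: "weak_gradient_on U X u g"
    and U: "open U" and L: "compact L" "L \<subseteq> U" and "0 < e"
  shows "\<exists>\<delta>0>0. \<forall>\<delta> \<rho> G. 0 < \<delta> \<and> \<delta> < \<delta>0 \<and> mollifier \<delta> \<rho> G \<longrightarrow>
    (\<integral>\<^sup>+x\<in>L. ennreal (norm (grad X (conv \<rho> u) x - g x)) \<partial>lebesgue) \<le> ennreal e"
proof -
  let ?n = "\<lambda>G i x. ennreal \<bar>conv_grad G u x \<bullet> X i x - g x $ i\<bar>"
  obtain V K where VK: "open V" "compact K" "L \<subseteq> V" "V \<subseteq> K" "K \<subseteq> U"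
    by (rule compact_nbhd[OF L(1) U L(2)])
  have g: "locally_integrable_on U g" using w by (simp add: weak_gradient_on_def)
  note ig = locally_integrable_cutoff[OF g VK(2,5)]
  define P where "P i \<delta>0 \<longleftrightarrow> 0 < \<delta>0 \<and> (\<forall>\<delta> \<rho> G. 0 < \<delta> \<and> \<delta> < \<delta>0 \<and> mollifier \<delta> \<rho> G \<longrightarrow>
    (\<integral>\<^sup>+x\<in>L. ?n G i x \<partial>lebesgue) \<le> ennreal (e / CARD('k)))" for i \<delta>0
  have "\<exists>\<delta>0. P i \<delta>0" for i
  proof -
    have "integrable lebesgue (\<lambda>x. (indicator K x *\<^sub>R g x) $ i)"
      by (rule integrable_bounded_linear[OF bounded_linear_vec_nth ig])
    then obtain g' where g': "integrable lborel g'" "AE x in lebesgue. (indicator K x *\<^sub>R g x) $ i = g' x"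
      using lebesgue_integrable_borel_version by blast
    have g'L: "AE x in lebesgue. x \<in> K \<longrightarrow> g x $ i = g' x" using g'(2) by eventually_elim auto
    have "\<exists>\<delta>0>0. \<forall>\<delta> \<rho> G. 0 < \<delta> \<and> \<delta> < \<delta>0 \<and> mollifier \<delta> \<rho> G \<longrightarrow>
      (\<integral>\<^sup>+x\<in>L. ennreal \<bar>conv_grad G u x \<bullet> X i x - g' x\<bar> \<partial>lborel) \<le> ennreal (e / CARD('k))"
    proof (rule friedrichs[OF subgradientD(1,2)[OF X] u g'(1) VK(1) L(1) VK(3)])
      fix \<phi> \<Phi> K' assume t: "has_grad \<phi> \<Phi>" "compact K'" "K' \<subseteq> V" "\<And>x. x \<notin> K' \<Longrightarrow> \<phi> x = 0"
      have um: "u \<in> borel_measurable lborel" and g'm: "g' \<in> borel_measurable lborel" using u g' by auto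
      have \<phi>c: "continuous_on UNIV \<phi>" by (rule has_grad_continuous[OF t(1)])
      have "continuous_on UNIV (\<lambda>x. \<Phi> x \<bullet> X i x)"
        by (intro continuous_intros has_gradD(1)[OF t(1)] subgradientD(3)[OF X])
      then have "(LINT x|lborel. u x * (\<Phi> x \<bullet> X i x)) = (LINT x|lebesgue. u x * (\<Phi> x \<bullet> X i x))"
        using um by (intro integral_completion[symmetric] borel_measurable_times) (auto intro: borel_measurable_continuous_onI)
      also have "\<dots> = - (LINT x|lebesgue. \<phi> x * g x $ i)"
        using t VK by (intro weak_gradient_component[OF X w t(1,2)]) auto
      also have "(LINT x|lebesgue. \<phi> x * g x $ i) = (LINT x|lebesgue. \<phi> x * g' x)"
      proof (rule integral_cong_AE)
        have "K' \<subseteq> U" using t(3) VK by blast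
        from integrable_mult_cutoff[OF g t(2) this \<phi>c t(4)]
        have "integrable lebesgue (\<lambda>x. (\<phi> x *\<^sub>R g x) $ i)" by (rule integrable_bounded_linear[OF bounded_linear_vec_nth])
        then show "(\<lambda>x. \<phi> x * g x $ i) \<in> borel_measurable lebesgue" by auto
        show "(\<lambda>x. \<phi> x * g' x) \<in> borel_measurable lebesgue"
          using measurable_completion[OF g'm] continuous_lebesgue_measurable[OF \<phi>c] by (rule borel_measurable_times[rotated])
        have sub: "x \<in> K" if "x \<in> K'" for x using that t(3) VK(4) by blast
        show "AE x in lebesgue. \<phi> x * g x $ i = \<phi> x * g' x"
          using g'L by eventually_elim (metis sub t(4) mult_zero_left)
      qed
      also have "(LINT x|lebesgue. \<phi> x * g' x) = (LINT x|lborel. \<phi> x * g' x)"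
        using g'm \<phi>c by (intro integral_completion borel_measurable_times) (auto intro: borel_measurable_continuous_onI)
      finally show "(LINT x|lborel. u x * (\<Phi> x \<bullet> X i x)) = - (LINT x|lborel. \<phi> x * g' x)" .
    qed (use \<open>0 < e\<close> in simp)
    moreover have "(\<integral>\<^sup>+x\<in>L. ?n G i x \<partial>lebesgue)
      = (\<integral>\<^sup>+x\<in>L. ennreal \<bar>conv_grad G u x \<bullet> X i x - g' x\<bar> \<partial>lborel)" for G
    proof -
      have "(\<integral>\<^sup>+x\<in>L. ?n G i x \<partial>lebesgue)
        = (\<integral>\<^sup>+x\<in>L. ennreal \<bar>conv_grad G u x \<bullet> X i x - g' x\<bar> \<partial>lebesgue)"
      proof (rule nn_integral_cong_AE)
        have sub: "x \<in> K" if "x \<in> L" for x using that VK by blast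
        from g'L show "AE x in lebesgue. ?n G i x * indicator L x
            = ennreal \<bar>conv_grad G u x \<bullet> X i x - g' x\<bar> * indicator L x"
          by eventually_elim (use sub in \<open>auto simp: indicator_def\<close>)
      qed
      then show ?thesis by (simp only: nn_integral_completion)
    qed
    ultimately show ?thesis unfolding P_def by simp
  qed
  then obtain D where "\<And>i. P i (D i)" by metis
  then have D: "0 < D i" "0 < \<delta> \<Longrightarrow> \<delta> < D i \<Longrightarrow> mollifier \<delta> \<rho> G \<Longrightarrow>
    (\<integral>\<^sup>+x\<in>L. ?n G i x \<partial>lebesgue) \<le> ennreal (e / CARD('k))" for i \<delta> \<rho> G
    unfolding P_def by blast+
  \<comment> \<open>Each component has its own threshold and a share e / k of the error; there are
    finitely many, so the minimum is positive.\<close>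
  define \<delta>0 where "\<delta>0 = Min (range D)"
  have "0 < \<delta>0" using D(1) by (simp add: \<delta>0_def)
  moreover have "(\<integral>\<^sup>+x\<in>L. ennreal (norm (grad X (conv \<rho> u) x - g x)) \<partial>lebesgue) \<le> ennreal e"
    if \<delta>: "0 < \<delta>" "\<delta> < \<delta>0" and m: "mollifier \<delta> \<rho> G" for \<delta> \<rho> G
  proof -
    have c: "has_grad (conv \<rho> u) (conv_grad G u)"
      by (rule has_grad_conv[OF mollifierD(1)[OF m] compact_cball[of 0 \<delta>] _ u]) (simp add: mollifierD(3)[OF m])
    have meas: "(\<lambda>x. ?n G i x * indicator L x) \<in> borel_measurable lebesgue" for i
    proof -
      have "integrable lebesgue (\<lambda>x. (indicator L x *\<^sub>R g x) $ i)"
        by (rule integrable_bounded_linear[OF bounded_linear_vec_nth locally_integrable_cutoff[OF g L]])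
      then have [measurable]: "(\<lambda>x. (indicator L x *\<^sub>R g x) $ i) \<in> borel_measurable lebesgue" by auto
      have [measurable]: "(\<lambda>x. conv_grad G u x \<bullet> X i x) \<in> borel_measurable lebesgue"
        by (intro continuous_lebesgue_measurable continuous_intros has_gradD(1)[OF c] subgradientD(3)[OF X])
      have [measurable]: "L \<in> sets lebesgue" using L(1) by (simp add: lmeasurable_compact fmeasurableD)
      have "(\<lambda>x. ennreal \<bar>conv_grad G u x \<bullet> X i x - (indicator L x *\<^sub>R g x) $ i\<bar> * indicator L x) \<in> borel_measurable lebesgue"
        by measurable
      also have "(\<lambda>x. ennreal \<bar>conv_grad G u x \<bullet> X i x - (indicator L x *\<^sub>R g x) $ i\<bar> * indicator L x)
        = (\<lambda>x. ?n G i x * indicator L x)" by (auto simp: indicator_def)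
      finally show ?thesis .
    qed
    have "(\<integral>\<^sup>+x\<in>L. ennreal (norm (grad X (conv \<rho> u) x - g x)) \<partial>lebesgue)
      \<le> (\<integral>\<^sup>+x. (\<Sum>i\<in>UNIV. ?n G i x * indicator L x) \<partial>lebesgue)"
    proof (rule nn_integral_mono)
      fix x
      have "norm (grad X (conv \<rho> u) x - g x) \<le> (\<Sum>i\<in>UNIV. \<bar>conv_grad G u x \<bullet> X i x - g x $ i\<bar>)"
        using norm_le_l1_cart[of "grad X (conv \<rho> u) x - g x"] by (simp add: grad_eq[OF c])
      then have "ennreal (norm (grad X (conv \<rho> u) x - g x)) \<le> (\<Sum>i\<in>UNIV. ?n G i x)"
        by (simp add: ennreal_leI)
      then show "ennreal (norm (grad X (conv \<rho> u) x - g x)) * indicator L x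
        \<le> (\<Sum>i\<in>UNIV. ?n G i x * indicator L x)"
        by (auto simp: indicator_def)
    qed
    also have "\<dots> = (\<Sum>i\<in>UNIV. \<integral>\<^sup>+x\<in>L. ?n G i x \<partial>lebesgue)"
      by (rule nn_integral_sum) (rule meas)
    also have "\<dots> \<le> (\<Sum>i\<in>(UNIV::'k set). ennreal (e / CARD('k)))"
      using \<delta> m by (intro sum_mono D(2)) (auto simp: \<delta>0_def)
    also have "\<dots> = ennreal e" using \<open>0 < e\<close> by (simp add: ennreal_of_nat_eq_real_of_nat flip: ennreal_mult)
    finally show ?thesis .
  qed
  ultimately show ?thesis by blast
qed

section \<open>Uniqueness of weak gradients and truncation of the distance\<close>

text \<open>Both candidates are approximated in L1 on \<open>L\<close> by the classical gradients of
  the same mollifications of \<open>u\<close>.\<close>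

lemma weak_gradient_unique:
  fixes X :: "'k::finite \<Rightarrow> real^'n \<Rightarrow> real^'n"
  assumes X: "subgradient X" and u: "integrable lborel u"
    and w1: "weak_gradient_on U X u g1" and w2: "weak_gradient_on U X u g2"
    and U: "open U" and L: "compact L" "L \<subseteq> U"
  shows "AE x in lebesgue. x \<in> L \<longrightarrow> g1 x = g2 x"
proof -
  let ?g1 = "\<lambda>x. indicator L x *\<^sub>R g1 x" and ?g2 = "\<lambda>x. indicator L x *\<^sub>R g2 x"
  let ?v = "\<lambda>\<rho> x. indicator L x *\<^sub>R grad X (conv \<rho> u) x"
  let ?I = "\<integral>\<^sup>+x. ennreal (norm (?g1 x - ?g2 x)) \<partial>lebesgue"
  have g: "locally_integrable_on U g1" "locally_integrable_on U g2" using w1 w2 by (auto simp: weak_gradient_on_def)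
  have [measurable]: "(\<lambda>x. ?g1 x) \<in> borel_measurable lebesgue" "(\<lambda>x. ?g2 x) \<in> borel_measurable lebesgue"
    using locally_integrable_cutoff[OF g(1) L] locally_integrable_cutoff[OF g(2) L] by auto
  have [measurable]: "L \<in> sets lebesgue" using L(1) by (simp add: lmeasurable_compact fmeasurableD)
  have small: "?I \<le> 0 + ennreal e" if "0 < e" for e
  proof -
    have "0 < e / 2" using that by simp
    from weak_gradient_mollify[OF X u w1 U L this] weak_gradient_mollify[OF X u w2 U L this]
    obtain \<delta>1 \<delta>2 where "0 < \<delta>1" "0 < \<delta>2"
      and *: "\<And>\<delta> \<rho> G. 0 < \<delta> \<and> \<delta> < \<delta>1 \<and> mollifier \<delta> \<rho> G \<Longrightarrow>
          (\<integral>\<^sup>+x\<in>L. ennreal (norm (grad X (conv \<rho> u) x - g1 x)) \<partial>lebesgue) \<le> ennreal (e / 2)"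
        "\<And>\<delta> \<rho> G. 0 < \<delta> \<and> \<delta> < \<delta>2 \<and> mollifier \<delta> \<rho> G \<Longrightarrow>
          (\<integral>\<^sup>+x\<in>L. ennreal (norm (grad X (conv \<rho> u) x - g2 x)) \<partial>lebesgue) \<le> ennreal (e / 2)"
      by blast
    \<comment> \<open>A scale below both thresholds makes a single mollification close to both
      fields.\<close>
    define \<delta> where "\<delta> = min \<delta>1 \<delta>2 / 2"
    have \<delta>: "0 < \<delta>" "\<delta> < \<delta>1" "\<delta> < \<delta>2" using \<open>0 < \<delta>1\<close> \<open>0 < \<delta>2\<close> by (auto simp: \<delta>_def)
    obtain \<rho> :: "real^'n \<Rightarrow> real" and G where m: "mollifier \<delta> \<rho> G" using mollifier_exists[OF \<delta>(1)] by blast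
    have "has_grad (conv \<rho> u) (conv_grad G u)"
      by (rule has_grad_conv[OF mollifierD(1)[OF m] compact_cball[of 0 \<delta>] _ u]) (simp add: mollifierD(3)[OF m])
    then have [measurable]: "grad X (conv \<rho> u) \<in> borel_measurable lebesgue"
      by (intro continuous_lebesgue_measurable grad_continuous[OF X])
    let ?N = "\<lambda>g x. ennreal (norm (?v \<rho> x - indicator L x *\<^sub>R g x))"
    have N: "(\<integral>\<^sup>+x. ?N g x \<partial>lebesgue) = (\<integral>\<^sup>+x\<in>L. ennreal (norm (grad X (conv \<rho> u) x - g x)) \<partial>lebesgue)" for g
      by (intro nn_integral_cong) (auto simp: indicator_def)
    have "?I
      \<le> (\<integral>\<^sup>+x. ?N g1 x + ?N g2 x \<partial>lebesgue)"
    proof (rule nn_integral_mono)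
      fix x
      have "norm (?g1 x - ?g2 x)
        \<le> norm (?v \<rho> x - ?g1 x) + norm (?v \<rho> x - ?g2 x)"
        by (metis (no_types, lifting) dist_norm dist_triangle2 norm_minus_commute dist_commute)
      then show "ennreal (norm (?g1 x - ?g2 x)) \<le> ?N g1 x + ?N g2 x"
        by (simp flip: ennreal_plus add: ennreal_leI)
    qed
    also have "\<dots> = (\<integral>\<^sup>+x. ?N g1 x \<partial>lebesgue) + (\<integral>\<^sup>+x. ?N g2 x \<partial>lebesgue)"
      by (rule nn_integral_add) measurable
    also have "\<dots> \<le> ennreal (e / 2) + ennreal (e / 2)"
      unfolding N using *(1)[of \<delta> \<rho> G] *(2)[of \<delta> \<rho> G] \<delta> m by (intro add_mono) auto
    also have "\<dots> = ennreal e" using that by (simp flip: ennreal_plus)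
    finally show ?thesis by simp
  qed
  have "?I \<le> 0"
    by (rule ennreal_le_epsilon) (rule small)
  then have "?I = 0" by simp
  then have "AE x in lebesgue. ennreal (norm (?g1 x - ?g2 x)) = 0"
    by (subst (asm) nn_integral_0_iff_AE) measurable
  then show ?thesis by eventually_elim (auto simp: indicator_def)
qed

text \<open>\<open>c\<close> is subtracted before truncating so that the function vanishes where d
  exceeds \<open>c\<close>. Its support is then compact, and on the set where d is below
  \<open>c\<close> it differs from d by a constant.\<close>

lemma weak_gradient_truncation:
  fixes X :: "'k::finite \<Rightarrow> real^'n \<Rightarrow> real^'n" and d :: "real^'n \<Rightarrow> real"
  assumes X: "subgradient X" and d: "continuous_on UNIV d" "\<And>r. compact {x. d x \<le> r}"
    and w: "weak_gradient_on {x. 1 < d x} X d g"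
  shows "integrable lborel (\<lambda>x. min (d x - c) 0)"
    and "weak_gradient_on {x. 1 < d x \<and> d x < c} X (\<lambda>x. min (d x - c) 0) g"
proof -
  have u: "continuous_on UNIV (\<lambda>x. min (d x - c) 0)" by (intro continuous_intros d(1))
  show iu: "integrable lborel (\<lambda>x. min (d x - c) 0)" by (rule integrable_compact_support[OF u d(2)[of c]]) simp
  show "weak_gradient_on {x. 1 < d x \<and> d x < c} X (\<lambda>x. min (d x - c) 0) g"
  proof (rule weak_gradient_shift[OF X w, where c = c])
    show "integrable lebesgue (\<lambda>x. min (d x - c) 0)" using iu by (subst integrable_completion) auto
    show "AE x in lebesgue. x \<in> {x. 1 < d x \<and> d x < c} \<longrightarrow> min (d x - c) 0 = d x - c" by (rule AE_I2) auto
  qed auto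
qed

lemma compact_annulus:
  fixes d :: "'a::topological_space \<Rightarrow> real"
  assumes "continuous_on UNIV d" "\<And>r. compact {x. d x \<le> r}"
  shows "compact {x. r \<le> d x \<and> d x \<le> s}"
proof -
  have "{x. r \<le> d x \<and> d x \<le> s} = {x. d x \<le> s} \<inter> {x. r \<le> d x}" by auto
  moreover have "closed {x. r \<le> d x}" by (intro closed_Collect_le continuous_intros assms(1))
  ultimately show ?thesis using assms(2) by (simp add: compact_Int_closed)
qed

section \<open>Sequences of mollifications\<close>

definition mollifiers :: "(nat \<Rightarrow> real^'n \<Rightarrow> real) \<Rightarrow> (nat \<Rightarrow> real^'n \<Rightarrow> real^'n) \<Rightarrow> bool" where
  "mollifiers \<rho> G \<longleftrightarrow> (\<forall>m. mollifier (inverse (real (Suc m))) (\<rho> m) (G m))"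

lemma mollifiers_exist: "\<exists>(\<rho> :: nat \<Rightarrow> real^'n \<Rightarrow> real) G. mollifiers \<rho> G"
proof -
  have "\<forall>m. \<exists>(\<rho> :: real^'n \<Rightarrow> real) G. mollifier (inverse (real (Suc m))) \<rho> G"
    using mollifier_exists by (metis inverse_positive_iff_positive of_nat_0_less_iff zero_less_Suc)
  then show ?thesis unfolding mollifiers_def by metis
qed

lemma mollifiers_eventually:
  assumes "mollifiers \<rho> G" and "\<exists>\<delta>0>0. \<forall>\<delta> r H. 0 < \<delta> \<and> \<delta> < \<delta>0 \<and> mollifier \<delta> r H \<longrightarrow> P r"
  shows "\<forall>\<^sub>F m in sequentially. P (\<rho> m)"
proof -
  obtain \<delta>0 where \<delta>0: "\<delta>0 > 0" "\<And>\<delta> r H. 0 < \<delta> \<and> \<delta> < \<delta>0 \<and> mollifier \<delta> r H \<Longrightarrow> P r" using assms(2) by blast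
  have "\<forall>\<^sub>F m in sequentially. inverse (real (Suc m)) < \<delta>0"
    using order_tendstoD(2)[OF LIMSEQ_inverse_real_of_nat \<delta>0(1)] .
  then show ?thesis
  proof eventually_elim
    case (elim m)
    show ?case by (rule \<delta>0(2)[of "inverse (real (Suc m))" _ "G m"]) (use elim assms(1) in \<open>auto simp: mollifiers_def\<close>)
  qed
qed

lemma mollifiers_has_grad:
  assumes "mollifiers \<rho> G" "integrable lborel u"
  shows "has_grad (conv (\<rho> m) u) (conv_grad (G m) u)"
proof -
  have m: "mollifier (inverse (real (Suc m))) (\<rho> m) (G m)" using assms(1) by (simp add: mollifiers_def)
  show ?thesis
    by (rule has_grad_conv[OF mollifierD(1)[OF m] compact_cball[of 0 "inverse (real (Suc m))"] _ assms(2)])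
       (simp add: mollifierD(3)[OF m] del: of_nat_Suc)
qed

text \<open>Passes from the estimates in nonnegative extended integrals, where Tonelli was used, to
  limits of real integrals.\<close>

lemma integral_tendsto_0:
  fixes s :: "nat \<Rightarrow> 'a \<Rightarrow> real"
  assumes "\<And>m. integrable M (s m)" "\<And>m x. 0 \<le> s m x"
    and "\<And>e. 0 < e \<Longrightarrow> \<forall>\<^sub>F m in sequentially. (\<integral>\<^sup>+x. ennreal (s m x) \<partial>M) \<le> ennreal e"
  shows "(\<lambda>m. LINT x|M. s m x) \<longlonglongrightarrow> 0"
proof (rule tendstoI)
  fix e :: real assume "0 < e"
  then have "\<forall>\<^sub>F m in sequentially. (\<integral>\<^sup>+x. ennreal (s m x) \<partial>M) \<le> ennreal (e / 2)" by (intro assms(3)) simp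
  then show "\<forall>\<^sub>F m in sequentially. dist (LINT x|M. s m x) 0 < e"
  proof eventually_elim
    case (elim m)
    have "ennreal (LINT x|M. s m x) \<le> ennreal (e / 2)"
      using elim nn_integral_eq_integral[OF assms(1)[of m] AE_I2[OF assms(2)[of m]]] by simp
    then have "(LINT x|M. s m x) \<le> e / 2" using \<open>0 < e\<close> by (simp add: ennreal_le_iff)
    moreover have "0 \<le> (LINT x|M. s m x)" using assms(2) by simp
    ultimately show ?case using \<open>0 < e\<close> by simp
  qed
qed

lemma weak_gradient_sequence:
  fixes X :: "'k::finite \<Rightarrow> real^'n \<Rightarrow> real^'n"
  assumes X: "subgradient X" and u: "integrable lborel u" and w: "weak_gradient_on U X u g"
    and U: "open U" and L: "compact L" "L \<subseteq> U" and m: "mollifiers \<rho> G"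
  shows "integrable lebesgue (\<lambda>x. indicator L x * norm (grad X (conv (\<rho> m) u) x - g x))"
    "(\<lambda>m. LINT x|lebesgue. indicator L x * norm (grad X (conv (\<rho> m) u) x - g x)) \<longlonglongrightarrow> 0"
proof -
  let ?n = "\<lambda>m x. norm (grad X (conv (\<rho> m) u) x - g x)"
  have g: "locally_integrable_on U g" using w by (simp add: weak_gradient_on_def)
  show i: "integrable lebesgue (\<lambda>x. indicator L x * ?n m x)" for m
  proof -
    have "integrable lborel (\<lambda>x. indicator L x *\<^sub>R grad X (conv (\<rho> m) u) x)"
      by (intro borel_integrable_compact L continuous_on_subset[OF grad_continuous[OF X mollifiers_has_grad[OF m u]]]) auto
    then have "integrable lebesgue (\<lambda>x. indicator L x *\<^sub>R grad X (conv (\<rho> m) u) x)"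
      by (simp add: integrable_completion)
    then have "integrable lebesgue (\<lambda>x. norm (indicator L x *\<^sub>R grad X (conv (\<rho> m) u) x - indicator L x *\<^sub>R g x))"
      using locally_integrable_cutoff[OF g L] by (intro integrable_norm Bochner_Integration.integrable_diff)
    then show ?thesis by (simp add: scaleR_diff_right[symmetric])
  qed
  show "(\<lambda>m. LINT x|lebesgue. indicator L x * ?n m x) \<longlonglongrightarrow> 0"
  proof (rule integral_tendsto_0[OF i])
    fix e :: real assume "0 < e"
    from mollifiers_eventually[OF m weak_gradient_mollify[OF X u w U L this]]
    show "\<forall>\<^sub>F m in sequentially. (\<integral>\<^sup>+x. ennreal (indicator L x * ?n m x) \<partial>lebesgue) \<le> ennreal e"
    proof eventually_elim
      case (elim m)
      have "(\<integral>\<^sup>+x. ennreal (indicator L x * ?n m x) \<partial>lebesgue)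
        = (\<integral>\<^sup>+x\<in>L. ennreal (?n m x) \<partial>lebesgue)"
        by (intro nn_integral_cong) (auto simp: indicator_def)
      with elim show ?case by simp
    qed
  qed simp
qed

lemma conv_sequence:
  fixes u :: "real^'n \<Rightarrow> real"
  assumes u: "integrable lborel u" and L: "compact L" and m: "mollifiers \<rho> G"
  shows "integrable lebesgue (\<lambda>x. indicator L x * \<bar>conv (\<rho> m) u x - u x\<bar>)"
    "(\<lambda>m. LINT x|lebesgue. indicator L x * \<bar>conv (\<rho> m) u x - u x\<bar>) \<longlonglongrightarrow> 0"
proof -
  let ?n = "\<lambda>m x. \<bar>conv (\<rho> m) u x - u x\<bar>"
  show i: "integrable lebesgue (\<lambda>x. indicator L x * (?n m x))" for m
  proof -
    have 1: "integrable lborel (\<lambda>x. indicator L x *\<^sub>R conv (\<rho> m) u x)"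
      by (intro borel_integrable_compact L has_grad_continuous[OF mollifiers_has_grad[OF m u]])
    have 2: "integrable lborel (\<lambda>x. indicator L x *\<^sub>R u x)"
      by (rule integrable_mult_indicator[OF _ u]) (use compact_imp_closed[OF L] in auto)
    have "integrable lborel (\<lambda>x. norm (indicator L x *\<^sub>R conv (\<rho> m) u x - indicator L x *\<^sub>R u x))"
      using 1 2 by (intro integrable_norm Bochner_Integration.integrable_diff)
    then have "integrable lborel (\<lambda>x. indicator L x * (?n m x))"
      by (simp add: right_diff_distrib[symmetric] abs_mult)
    then show ?thesis by (subst integrable_completion) auto
  qed
  show "(\<lambda>m. LINT x|lebesgue. indicator L x * (?n m x)) \<longlonglongrightarrow> 0"
  proof (rule integral_tendsto_0[OF i])
    fix e :: real assume "0 < e"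
    from mollifiers_eventually[OF m conv_L1[OF u this]]
    show "\<forall>\<^sub>F m in sequentially. (\<integral>\<^sup>+x. ennreal (indicator L x * (?n m x)) \<partial>lebesgue) \<le> ennreal e"
    proof eventually_elim
      case (elim m)
      have "(\<integral>\<^sup>+x. ennreal (indicator L x * (?n m x)) \<partial>lebesgue)
        \<le> (\<integral>\<^sup>+x. ennreal (?n m x) \<partial>lebesgue)"
        by (intro nn_integral_mono) (auto simp: indicator_def)
      with elim show ?case by (simp add: nn_integral_completion)
    qed
  qed simp
qed

lemma dominated_on_compact:
  fixes s :: "nat \<Rightarrow> 'a::euclidean_space \<Rightarrow> real"
  assumes L: "compact L" and s: "\<And>m. s m \<in> borel_measurable lebesgue" and f: "f \<in> borel_measurable lebesgue"
    and b: "\<And>m. AE x in lebesgue. \<bar>s m x\<bar> \<le> C * indicator L x" and c: "\<And>x. (\<lambda>m. s m x) \<longlonglongrightarrow> f x"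
  shows "integrable lebesgue (s m)" "(\<lambda>m. LINT x|lebesgue. s m x) \<longlonglongrightarrow> (LINT x|lebesgue. f x)"
proof -
  have i: "integrable lebesgue (\<lambda>x. C * indicator L x)"
    using lmeasurable_compact[OF L] by (intro integrable_mult_right integrable_real_indicator) (auto simp: fmeasurable_def)
  show "integrable lebesgue (s m)"
    by (rule Bochner_Integration.integrable_bound[OF i s]) (use b[of m] in \<open>auto elim!: eventually_mono\<close>)
  show "(\<lambda>m. LINT x|lebesgue. s m x) \<longlonglongrightarrow> (LINT x|lebesgue. f x)"
    by (rule integral_dominated_convergence[OF f s i]) (use b c in auto)
qed

lemma has_grad_add_const:
  assumes "has_grad u G" shows "has_grad (\<lambda>x. c + u x) G"
  using assms by (auto simp: has_grad_def intro!: derivative_eq_intros)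

lemma has_real_derivative_continuous: 
  "(\<And>t. (s has_real_derivative s' t) (at t)) \<Longrightarrow> continuous_on UNIV s"
  by (meson DERIV_continuous_on has_field_derivative_at_within)

section \<open>The integrated Laplacian comparison\<close>

text \<open>The test function is \<open>A \<eta>(v)\<close> with \<open>v\<close> a mollification of \<open>min d c\<close>. Truncating \<open>d\<close> makes
  the convergence uniform on the whole space, so the supports eventually lie in \<open>L\<close>.\<close>

lemma laplacian_comparison:
  fixes X :: "'k::finite \<Rightarrow> real^'n \<Rightarrow> real^'n" and d :: "real^'n \<Rightarrow> real" and g :: "real^'n \<Rightarrow> real^'k"
  assumes X: "subgradient X" and d: "continuous_on UNIV d" "\<And>r. compact {x. d x \<le> r}"
    and w: "weak_gradient_on {x. 1 < d x} X d g"
    and lap: "\<And>\<phi>. test_function {x. 1 < d x} \<phi> \<Longrightarrow> (\<And>x. 0 \<le> \<phi> x) \<Longrightarrow>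
      - (LINT x|lebesgue. g x \<bullet> grad X \<phi> x) \<le> (LINT x|lebesgue. h x * \<phi> x)"
    and g1: "AE x in lebesgue. 1 < d x \<longrightarrow> norm (g x) \<le> 1" and h: "continuous_on UNIV h"
    and A: "has_grad A GA" "\<And>x. 0 \<le> A x"
    and \<eta>: "\<And>t. (\<eta> has_real_derivative \<eta>' t) (at t)" "continuous_on UNIV \<eta>'" "\<And>t. 0 \<le> \<eta> t"
      "\<And>t. t \<notin> {a..b} \<Longrightarrow> \<eta> t = 0" "\<And>t. t \<notin> {a..b} \<Longrightarrow> \<eta>' t = 0"
    and ab: "1 < a'" "a' < a" "b < b'"
    and L_def: "L = {x. a' \<le> d x \<and> d x \<le> b'}"
  shows "(LINT x|lebesgue. indicator L x * - (A x * \<eta>' (d x) * (norm (g x))\<^sup>2))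
    \<le> (LINT x|lebesgue. indicator L x * (h x * \<eta> (d x) * A x))
      + (LINT x|lebesgue. indicator L x * (\<eta> (d x) * norm (grad X A x)))"
proof -
  \<comment> \<open>Strictly above \<open>b'\<close>: then d equals its truncation on
    \<open>L\<close>, and where d exceeds \<open>b'\<close> so does \<open>min d c\<close>.\<close>
  define c where "c = b' + 1"
  define V where "V = {x. 1 < d x \<and> d x < c}"
  have L: "compact L" unfolding L_def by (rule compact_annulus[OF d(1,2)])
  have V: "open V" unfolding V_def by (intro open_Collect_conj open_Collect_less continuous_intros d(1))
  have LV: "L \<subseteq> V" "L \<subseteq> {x. 1 < d x}" using ab by (auto simp: L_def V_def c_def)
  have Lm[measurable]: "L \<in> sets lebesgue" using L by (simp add: lmeasurable_compact fmeasurableD)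
  define u where "u x = min (d x - c) 0" for x
  have u: "continuous_on UNIV u" unfolding u_def by (intro continuous_intros d(1))
  have u0: "u x = 0" if "x \<notin> {x. d x \<le> c}" for x using that by (simp add: u_def)
  have iu: "integrable lborel u" unfolding u_def by (rule weak_gradient_truncation(1)[OF X d w])
  have wu: "weak_gradient_on V X u g" unfolding V_def u_def by (rule weak_gradient_truncation(2)[OF X d w])
  obtain \<rho> :: "nat \<Rightarrow> real^'n \<Rightarrow> real" and G where m: "mollifiers \<rho> G" using mollifiers_exist by blast
  \<comment> \<open>Adding \<open>c\<close> back turns the mollification of \<open>u\<close> into
    one of \<open>min d c\<close>.\<close>
  define v where "v m x = c + conv (\<rho> m) u x" for m x
  have v: "has_grad (v m) (conv_grad (G m) u)" for m
    unfolding v_def by (intro has_grad_add_const mollifiers_has_grad[OF m iu])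
  have gradv: "grad X (v m) = grad X (conv (\<rho> m) u)" for m
    by (simp add: fun_eq_iff grad_eq[OF v] grad_eq[OF mollifiers_has_grad[OF m iu]])
  have unif: "\<forall>\<^sub>F m in sequentially. \<forall>x. \<bar>v m x - min (d x) c\<bar> \<le> e" if "0 < e" for e
  proof -
    have "\<exists>\<delta>0>0. \<forall>\<delta> \<rho> G. 0 < \<delta> \<and> \<delta> < \<delta>0 \<and> mollifier \<delta> \<rho> G \<longrightarrow> (\<forall>x. \<bar>conv \<rho> u x - u x\<bar> \<le> e)"
      using conv_uniform[OF u d(2) u0 that] by blast
    from mollifiers_eventually[OF m this] show ?thesis
    proof eventually_elim
      case (elim m)
      have "v m x - min (d x) c = conv (\<rho> m) u x - u x" for x by (auto simp: v_def u_def)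
      then show ?case using elim by simp
    qed
  qed
  have vlim: "(\<lambda>m. v m x) \<longlonglongrightarrow> d x" if "x \<in> L" for x
  proof (rule tendstoI)
    fix e :: real assume "0 < e"
    have "min (d x) c = d x" using that by (simp add: L_def c_def)
    with unif[of "e / 2"] \<open>0 < e\<close> show "\<forall>\<^sub>F m in sequentially. dist (v m x) (d x) < e"
      by (auto elim!: eventually_mono simp: dist_real_def) (smt (verit) field_sum_of_halves)
  qed
  have \<eta>c: "continuous_on UNIV \<eta>" by (rule has_real_derivative_continuous[OF \<eta>(1)])
  obtain B1 where B1: "0 < B1" "\<And>t. norm (\<eta> t) \<le> B1" using compact_support_bounded[OF \<eta>c compact_Icc \<eta>(4)] by blast
  obtain B2 where B2: "0 < B2" "\<And>t. norm (\<eta>' t) \<le> B2" using compact_support_bounded[OF \<eta>(2) compact_Icc \<eta>(5)] by blast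
  have bdd: "\<exists>B>0. \<forall>x\<in>L. \<bar>q x\<bar> \<le> B" if "continuous_on UNIV q" for q :: "real^'n \<Rightarrow> real"
  proof -
    have "bounded (q ` L)" by (intro compact_imp_bounded compact_continuous_image L continuous_on_subset[OF that]) auto
    then show ?thesis by (auto simp: bounded_pos)
  qed
  have Ac: "continuous_on UNIV A" by (rule has_grad_continuous[OF A(1)])
  obtain CA where CA: "0 < CA" "\<And>x. x \<in> L \<Longrightarrow> \<bar>A x\<bar> \<le> CA" using bdd[OF Ac] by blast
  obtain CH where CH: "0 < CH" "\<And>x. x \<in> L \<Longrightarrow> \<bar>h x\<bar> \<le> CH" using bdd[OF h] by blast
  have gAc: "continuous_on UNIV (\<lambda>x. norm (grad X A x))" by (intro continuous_intros grad_continuous[OF X A(1)])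
  obtain CG where CG: "0 < CG" "\<And>x. x \<in> L \<Longrightarrow> \<bar>norm (grad X A x)\<bar> \<le> CG" using bdd[OF gAc] by blast
  define gl where "gl x = indicator L x *\<^sub>R g x" for x
  have igl: "integrable lebesgue gl"
    unfolding gl_def using w LV(2) L by (intro locally_integrable_cutoff) (auto simp: weak_gradient_on_def)
  have gl1: "AE x in lebesgue. norm (gl x) \<le> indicator L x"
    using g1 by eventually_elim (use LV(2) in \<open>auto simp: gl_def indicator_def\<close>)
  have meas: "gl \<in> borel_measurable lebesgue" "A \<in> borel_measurable lebesgue" "h \<in> borel_measurable lebesgue"
      "(\<lambda>x. norm (grad X A x)) \<in> borel_measurable lebesgue"
    using igl continuous_lebesgue_measurable[OF Ac] continuous_lebesgue_measurable[OF h] continuous_lebesgue_measurable[OF gAc] by auto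
  have meas2: "(\<lambda>x. \<eta> (q x)) \<in> borel_measurable lebesgue" "(\<lambda>x. \<eta>' (q x)) \<in> borel_measurable lebesgue"
    if "continuous_on UNIV q" for q :: "real^'n \<Rightarrow> real"
    by (auto intro!: continuous_lebesgue_measurable continuous_on_compose2[OF \<eta>c] continuous_on_compose2[OF \<eta>(2)] that)
  note [measurable] = meas meas2[OF d(1)] meas2[OF has_grad_continuous[OF v]]
  have lim\<eta>: "(\<lambda>m. \<eta> (v m x)) \<longlonglongrightarrow> \<eta> (d x)" "(\<lambda>m. \<eta>' (v m x)) \<longlonglongrightarrow> \<eta>' (d x)" if "x \<in> L" for x
    using vlim[OF that] \<eta>c \<eta>(2) by (auto simp: continuous_on_eq_continuous_at intro: isCont_tendsto_compose)
  \<comment> \<open>\<open>T1\<close> is the term to be estimated, \<open>T2\<close> comes from the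
    Laplacian bound, \<open>T3\<close> from the gradient of \<open>A\<close>, and \<open>T4\<close>
    is the mollification error. In the first three, \<open>v m\<close> enters only through
    \<open>\<eta>\<close> and \<open>\<eta>'\<close>, so uniform bounds and pointwise convergence
    suffice; \<open>T4\<close> is the one handled by Friedrichs' lemma.\<close>
  define T1 where "T1 q x = - (A x * \<eta>' (q x) * (norm (gl x))\<^sup>2)" for q x
  define T2 where "T2 q x = indicator L x * (h x * \<eta> (q x) * A x)" for q x
  define T3 where "T3 q x = indicator L x * (\<eta> (q x) * norm (grad X A x))" for q x
  define T4 where "T4 m x = indicator L x * norm (grad X (v m) x - g x)" for m x
  have T1: "integrable lebesgue (T1 (v m))" "(\<lambda>m. LINT x|lebesgue. T1 (v m) x) \<longlonglongrightarrow> (LINT x|lebesgue. T1 d x)" for m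
  proof -
    have b: "AE x in lebesgue. \<bar>T1 (v m) x\<bar> \<le> (CA * B2) * indicator L x" for m
      using gl1
    proof eventually_elim
      case (elim x)
      show ?case
      proof (cases "x \<in> L")
        case True
        have "(norm (gl x))\<^sup>2 \<le> 1" using elim True by (simp add: power_le_one)
        then have "\<bar>A x\<bar> * \<bar>\<eta>' (v m x)\<bar> * (norm (gl x))\<^sup>2 \<le> (CA * B2) * 1"
          using CA(2)[OF True] B2(2)[of "v m x"] CA(1) B2(1) by (intro mult_mono) auto
        then show ?thesis using True by (simp add: T1_def abs_mult)
      qed (simp add: T1_def gl_def)
    qed
    have l: "(\<lambda>m. T1 (v m) x) \<longlonglongrightarrow> T1 d x" for x
      by (cases "x \<in> L") (auto simp: T1_def gl_def intro!: tendsto_intros lim\<eta>)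
    have "T1 (v m) \<in> borel_measurable lebesgue" "T1 d \<in> borel_measurable lebesgue" for m
      unfolding T1_def by measurable
    from dominated_on_compact[OF L this b l]
    show "integrable lebesgue (T1 (v m))" "(\<lambda>m. LINT x|lebesgue. T1 (v m) x) \<longlonglongrightarrow> (LINT x|lebesgue. T1 d x)" by auto
  qed
  have T2: "integrable lebesgue (T2 (v m))" "(\<lambda>m. LINT x|lebesgue. T2 (v m) x) \<longlonglongrightarrow> (LINT x|lebesgue. T2 d x)" for m
  proof -
    have b: "AE x in lebesgue. \<bar>T2 (v m) x\<bar> \<le> (CH * B1 * CA) * indicator L x" for m
    proof (rule AE_I2)
      fix x show "\<bar>T2 (v m) x\<bar> \<le> (CH * B1 * CA) * indicator L x"
      proof (cases "x \<in> L")
        case True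
        have "\<bar>h x\<bar> * \<bar>\<eta> (v m x)\<bar> * \<bar>A x\<bar> \<le> CH * B1 * CA"
          using CA(2)[OF True] CH(2)[OF True] B1(2)[of "v m x"] CA(1) CH(1) B1(1) by (intro mult_mono) auto
        then show ?thesis using True by (simp add: T2_def abs_mult)
      qed (simp add: T2_def)
    qed
    have l: "(\<lambda>m. T2 (v m) x) \<longlonglongrightarrow> T2 d x" for x
      by (cases "x \<in> L") (auto simp: T2_def intro!: tendsto_intros lim\<eta>)
    have "T2 (v m) \<in> borel_measurable lebesgue" "T2 d \<in> borel_measurable lebesgue" for m
      unfolding T2_def by measurable
    from dominated_on_compact[OF L this b l]
    show "integrable lebesgue (T2 (v m))" "(\<lambda>m. LINT x|lebesgue. T2 (v m) x) \<longlonglongrightarrow> (LINT x|lebesgue. T2 d x)" by auto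
  qed
  have T3: "integrable lebesgue (T3 (v m))" "(\<lambda>m. LINT x|lebesgue. T3 (v m) x) \<longlonglongrightarrow> (LINT x|lebesgue. T3 d x)" for m
  proof -
    have b: "AE x in lebesgue. \<bar>T3 (v m) x\<bar> \<le> (B1 * CG) * indicator L x" for m
    proof (rule AE_I2)
      fix x show "\<bar>T3 (v m) x\<bar> \<le> (B1 * CG) * indicator L x"
      proof (cases "x \<in> L")
        case True
        have "\<bar>\<eta> (v m x)\<bar> * norm (grad X A x) \<le> B1 * CG"
          using CG(2)[OF True] B1(2)[of "v m x"] CG(1) B1(1) by (intro mult_mono) auto
        then show ?thesis using True by (simp add: T3_def abs_mult)
      qed (simp add: T3_def)
    qed
    have l: "(\<lambda>m. T3 (v m) x) \<longlonglongrightarrow> T3 d x" for x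
      by (cases "x \<in> L") (auto simp: T3_def intro!: tendsto_intros lim\<eta>)
    have "T3 (v m) \<in> borel_measurable lebesgue" "T3 d \<in> borel_measurable lebesgue" for m
      unfolding T3_def by measurable
    from dominated_on_compact[OF L this b l]
    show "integrable lebesgue (T3 (v m))" "(\<lambda>m. LINT x|lebesgue. T3 (v m) x) \<longlonglongrightarrow> (LINT x|lebesgue. T3 d x)" by auto
  qed
  have T4: "integrable lebesgue (T4 m)" "(\<lambda>m. LINT x|lebesgue. T4 m x) \<longlonglongrightarrow> 0" for m
    using weak_gradient_sequence[OF X iu wu V L LV(1) m] by (auto simp: T4_def[abs_def] gradv)
  \<comment> \<open>Once \<open>v m\<close> is within \<open>\<tau>\<close> of
    \<open>min d c\<close>, it lies outside [a, b] at every point outside \<open>L\<close>, so the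
    test function is supported in \<open>L\<close>.\<close>
  define \<tau> where "\<tau> = min (a - a') (b' - b)"
  have "0 < \<tau>" "\<tau> \<le> a - a'" "\<tau> \<le> b' - b" using ab by (auto simp: \<tau>_def)
  have ineq: "\<forall>\<^sub>F m in sequentially. (LINT x|lebesgue. T1 (v m) x)
    \<le> (LINT x|lebesgue. T2 (v m) x) + (LINT x|lebesgue. T3 (v m) x) + (CA * B2) * (LINT x|lebesgue. T4 m x)"
    using unif[OF \<open>0 < \<tau>\<close>]
  proof eventually_elim
    case (elim m)
    define \<phi> where "\<phi> x = A x * \<eta> (v m x)" for x
    have \<phi>: "has_grad \<phi> (\<lambda>x. A x *\<^sub>R (\<eta>' (v m x) *\<^sub>R conv_grad (G m) u x) + \<eta> (v m x) *\<^sub>R GA x)"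
      unfolding \<phi>_def by (rule has_grad_mult[OF A(1) has_grad_compose[OF v \<eta>(1,2)]])
    have grad\<phi>: "grad X \<phi> x = (A x * \<eta>' (v m x)) *\<^sub>R grad X (v m) x + \<eta> (v m x) *\<^sub>R grad X A x" for x
      by (simp add: grad_eq[OF \<phi>] grad_eq[OF v] grad_eq[OF A(1)] vec_eq_iff inner_add_left algebra_simps)
    have \<phi>0: "\<phi> x = 0" if "x \<notin> L" for x
    proof -
      have "v m x \<notin> {a..b}"
        using that elim[rule_format, of x] \<open>\<tau> \<le> a - a'\<close> \<open>\<tau> \<le> b' - b\<close> by (auto simp: L_def c_def min_def split: if_splits)
      then show ?thesis using \<eta>(4) by (simp add: \<phi>_def)
    qed
    have t: "test_function {x. 1 < d x} \<phi>" by (rule test_functionI[OF \<phi> L LV(2) \<phi>0])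
    note off = grad_off[OF \<phi> L \<phi>0, where X = X]
    have gc: "continuous_on UNIV (grad X \<phi>)" by (rule grad_continuous[OF X \<phi>])
    obtain B where B: "0 < B" "\<And>x. norm (grad X \<phi> x) \<le> B" using compact_support_bounded[OF gc L off] by blast
    have gg: "g x \<bullet> grad X \<phi> x = gl x \<bullet> grad X \<phi> x" for x
      using off[of x] by (cases "x \<in> L") (auto simp: gl_def)
    have ig: "integrable lebesgue (\<lambda>x. g x \<bullet> grad X \<phi> x)"
      unfolding gg
    proof (rule Bochner_Integration.integrable_bound[of _ "\<lambda>x. B * norm (gl x)"])
      show "integrable lebesgue (\<lambda>x. B * norm (gl x))" by (intro integrable_mult_right integrable_norm igl)
      show "(\<lambda>x. gl x \<bullet> grad X \<phi> x) \<in> borel_measurable lebesgue"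
        by (intro borel_measurable_inner meas continuous_lebesgue_measurable gc)
      show "AE x in lebesgue. norm (gl x \<bullet> grad X \<phi> x) \<le> norm (B * norm (gl x))"
      proof (rule AE_I2)
        fix x
        have "\<bar>gl x \<bullet> grad X \<phi> x\<bar> \<le> norm (gl x) * norm (grad X \<phi> x)" by (rule Cauchy_Schwarz_ineq2)
        also have "\<dots> \<le> norm (gl x) * B" by (intro mult_left_mono B) simp
        finally show "norm (gl x \<bullet> grad X \<phi> x) \<le> norm (B * norm (gl x))" using B(1) by (simp add: mult.commute)
      qed
    qed
    have "(LINT x|lebesgue. T1 (v m) x) \<le> (LINT x|lebesgue. - (g x \<bullet> grad X \<phi> x) + T3 (v m) x + (CA * B2) * T4 m x)"
    proof (rule integral_mono_AE)
      show "AE x in lebesgue. T1 (v m) x \<le> - (g x \<bullet> grad X \<phi> x) + T3 (v m) x + (CA * B2) * T4 m x"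
        using gl1
      proof eventually_elim
        case (elim x)
        show ?case
        proof (cases "x \<in> L")
          case True
          then have gl: "gl x = g x" by (simp add: gl_def)
          have n: "norm (g x) \<le> 1" using elim True gl by simp
          have 1: "g x \<bullet> grad X \<phi> x = A x * \<eta>' (v m x) * (g x \<bullet> grad X (v m) x) + \<eta> (v m x) * (g x \<bullet> grad X A x)"
            by (simp add: grad\<phi> inner_add_right)
          \<comment> \<open>The differentiated test function contains the gradient of
            \<open>v m\<close> in place of \<open>g\<close>; splitting off the difference leaves an
            error whose cofactor is at most \<open>CA * B2\<close> since \<open>g\<close> has length
            at most 1.\<close>
          have 2: "(norm (g x))\<^sup>2 = g x \<bullet> grad X (v m) x - g x \<bullet> (grad X (v m) x - g x)"
            by (simp add: power2_norm_eq_inner inner_diff_right)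
          have "\<bar>g x \<bullet> grad X A x\<bar> \<le> norm (g x) * norm (grad X A x)" by (rule Cauchy_Schwarz_ineq2)
          also have "\<dots> \<le> norm (grad X A x)" using n by (simp add: mult_left_le_one_le)
          finally have 3: "\<eta> (v m x) * (g x \<bullet> grad X A x) \<le> \<eta> (v m x) * norm (grad X A x)"
            by (intro mult_left_mono \<eta>(3)) simp
          have "\<bar>g x \<bullet> (grad X (v m) x - g x)\<bar> \<le> norm (g x) * norm (grad X (v m) x - g x)" by (rule Cauchy_Schwarz_ineq2)
          also have "\<dots> \<le> norm (grad X (v m) x - g x)" using n by (simp add: mult_left_le_one_le)
          finally have 4: "\<bar>A x * \<eta>' (v m x)\<bar> * \<bar>g x \<bullet> (grad X (v m) x - g x)\<bar> \<le> (CA * B2) * norm (grad X (v m) x - g x)"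
            unfolding abs_mult[of "A x"] using CA(2)[OF True] B2(2)[of "v m x"] CA(1) B2(1) by (intro mult_mono) auto
          have 4: "A x * \<eta>' (v m x) * (g x \<bullet> (grad X (v m) x - g x)) \<le> (CA * B2) * norm (grad X (v m) x - g x)"
            by (rule order_trans[OF abs_ge_self]) (use 4 in \<open>simp only: abs_mult\<close>)
          have "T1 (v m) x = - (A x * \<eta>' (v m x) * (g x \<bullet> grad X (v m) x)) + A x * \<eta>' (v m x) * (g x \<bullet> (grad X (v m) x - g x))"
            unfolding T1_def gl 2 by (simp add: right_diff_distrib)
          also have "\<dots> = - (g x \<bullet> grad X \<phi> x) + \<eta> (v m x) * (g x \<bullet> grad X A x) + A x * \<eta>' (v m x) * (g x \<bullet> (grad X (v m) x - g x))"
            unfolding 1 by simp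
          also have "\<dots> \<le> - (g x \<bullet> grad X \<phi> x) + \<eta> (v m x) * norm (grad X A x) + (CA * B2) * norm (grad X (v m) x - g x)"
            using 3 4 by linarith
          finally show ?thesis using True by (simp add: T3_def T4_def)
        qed (simp add: T1_def T3_def T4_def gl_def off)
      qed
    qed (use ig T1(1) T3(1) T4(1) in auto)
    also have "\<dots> = - (LINT x|lebesgue. g x \<bullet> grad X \<phi> x) + (LINT x|lebesgue. T3 (v m) x) + (CA * B2) * (LINT x|lebesgue. T4 m x)"
      using ig T3(1)[of m] T4(1)[of m] by simp
    also have "- (LINT x|lebesgue. g x \<bullet> grad X \<phi> x) \<le> (LINT x|lebesgue. h x * \<phi> x)"
      by (rule lap[OF t]) (simp add: \<phi>_def A(2) \<eta>(3))
    also have "(LINT x|lebesgue. h x * \<phi> x) = (LINT x|lebesgue. T2 (v m) x)"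
    proof (intro Bochner_Integration.integral_cong refl)
      fix x show "h x * \<phi> x = T2 (v m) x" using \<phi>0[of x] by (cases "x \<in> L") (auto simp: T2_def \<phi>_def)
    qed
    finally show ?case by simp
  qed
  have lim: "(\<lambda>m. (LINT x|lebesgue. T2 (v m) x) + (LINT x|lebesgue. T3 (v m) x) + (CA * B2) * (LINT x|lebesgue. T4 m x))
    \<longlonglongrightarrow> (LINT x|lebesgue. T2 d x) + (LINT x|lebesgue. T3 d x) + (CA * B2) * 0"
    by (intro tendsto_intros T2(2) T3(2) T4(2))
  have "(LINT x|lebesgue. T1 d x) \<le> (LINT x|lebesgue. T2 d x) + (LINT x|lebesgue. T3 d x) + (CA * B2) * 0"
    by (rule tendsto_le[OF sequentially_bot lim T1(2) ineq])
  moreover have "indicator L x * - (A x * \<eta>' (d x) * (norm (g x))\<^sup>2) = T1 d x" for x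
    by (cases "x \<in> L") (auto simp: T1_def gl_def)
  ultimately show ?thesis by (simp add: T2_def T3_def)
qed

section \<open>From C1 factors to weakly differentiable f\<close>

text \<open>The regularised modulus lies between \<open>\<bar>s\<bar>\<close> and
  \<open>\<bar>s\<bar> + \<kappa>\<close>. The bound treats regularisation and approximation of f by
  \<open>s\<close> together.\<close>

lemma sqrt_perturb:
  fixes s t \<kappa> :: real
  assumes "0 \<le> \<kappa>" shows "\<bar>sqrt (s\<^sup>2 + \<kappa>\<^sup>2) - \<bar>t\<bar>\<bar> \<le> \<bar>s - t\<bar> + \<kappa>"
proof -
  have "sqrt (s\<^sup>2 + \<kappa>\<^sup>2) \<le> \<bar>s\<bar> + \<bar>\<kappa>\<bar>" by (rule sqrt_sum_squares_le_sum_abs)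
  moreover have "\<bar>s\<bar> \<le> sqrt (s\<^sup>2 + \<kappa>\<^sup>2)" by (rule real_le_rsqrt) simp
  ultimately show ?thesis using assms by linarith
qed

text \<open>The regularised modulus is smooth with derivative of absolute value at most 1, so it
  does not lengthen the gradient.\<close>

lemma grad_sqrt:
  fixes X :: "'k::finite \<Rightarrow> real^'n \<Rightarrow> real^'n"
  assumes f: "has_grad f F" and "0 < \<kappa>"
  obtains Q where "has_grad (\<lambda>x. sqrt ((f x)\<^sup>2 + \<kappa>\<^sup>2)) Q"
    "\<And>x. norm (grad X (\<lambda>x. sqrt ((f x)\<^sup>2 + \<kappa>\<^sup>2)) x) \<le> norm (grad X f x)"
proof -
  have pos: "0 < t\<^sup>2 + \<kappa>\<^sup>2" for t :: real using \<open>0 < \<kappa>\<close> by (simp add: add_nonneg_pos)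
  have D: "((\<lambda>t. sqrt (t\<^sup>2 + \<kappa>\<^sup>2)) has_real_derivative t / sqrt (t\<^sup>2 + \<kappa>\<^sup>2)) (at t)" for t
    using pos[of t] by (auto intro!: derivative_eq_intros simp: field_simps)
  have c: "continuous_on UNIV (\<lambda>t. t / sqrt (t\<^sup>2 + \<kappa>\<^sup>2))"
    using pos by (intro continuous_intros) (auto simp: less_imp_neq[symmetric])
  note h = has_grad_compose[OF f D c]
  have e: "grad X (\<lambda>x. sqrt ((f x)\<^sup>2 + \<kappa>\<^sup>2)) x = (f x / sqrt ((f x)\<^sup>2 + \<kappa>\<^sup>2)) *\<^sub>R grad X f x" for x
    by (simp add: grad_eq[OF h] grad_eq[OF f] vec_eq_iff)
  have b: "\<bar>t / sqrt (t\<^sup>2 + \<kappa>\<^sup>2)\<bar> \<le> 1" for t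
  proof -
    have "\<bar>t\<bar> \<le> sqrt (t\<^sup>2 + \<kappa>\<^sup>2)" by (rule real_le_rsqrt) simp
    then show ?thesis using pos[of t] by (simp add: abs_divide)
  qed
  have "norm (grad X (\<lambda>x. sqrt ((f x)\<^sup>2 + \<kappa>\<^sup>2)) x) \<le> norm (grad X f x)" for x
    unfolding e norm_scaleR using mult_right_mono[OF b[of "f x"] norm_ge_zero[of "grad X f x"]] by simp
  with h show ?thesis by (rule that)
qed

text \<open>Only behaviour on \<open>L\<close> matters, so f is cut off to a compact neighbourhood,
  which makes it integrable without changing its weak gradient near \<open>L\<close>.\<close>

lemma weak_gradient_local_approx:
  fixes X :: "'k::finite \<Rightarrow> real^'n \<Rightarrow> real^'n"
  assumes X: "subgradient X" and w: "weak_gradient_on UNIV X f fg" and L: "compact L"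
  obtains v D where "\<And>m::nat. has_grad (v m) (D m)"
    "\<And>m. integrable lebesgue (\<lambda>x. indicator L x * \<bar>v m x - f x\<bar>)"
    "(\<lambda>m. LINT x|lebesgue. indicator L x * \<bar>v m x - f x\<bar>) \<longlonglongrightarrow> 0"
    "\<And>m. integrable lebesgue (\<lambda>x. indicator L x * norm (grad X (v m) x - fg x))"
    "(\<lambda>m. LINT x|lebesgue. indicator L x * norm (grad X (v m) x - fg x)) \<longlonglongrightarrow> 0"
proof -
  obtain V K where VK: "open V" "compact K" "L \<subseteq> V" "V \<subseteq> K" "K \<subseteq> UNIV"
    by (rule compact_nbhd[OF L open_UNIV subset_UNIV])
  have lf: "locally_integrable_on UNIV f" using w by (simp add: weak_gradient_on_def)
  have "integrable lebesgue (\<lambda>x. indicator K x * f x)"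
    using locally_integrable_cutoff[OF lf VK(2)] by simp
  then obtain u where u: "integrable lborel u" "AE x in lebesgue. indicator K x * f x = u x"
    using lebesgue_integrable_borel_version by blast
  have uf: "AE x in lebesgue. x \<in> V \<longrightarrow> u x = f x - 0"
    using u(2) by eventually_elim (use VK(4) in auto)
  have "integrable lebesgue u" using u(1) by (subst integrable_completion) auto
  then have wu: "weak_gradient_on V X u fg" using weak_gradient_shift[OF X w _ _ uf] by simp
  obtain \<rho> :: "nat \<Rightarrow> real^'n \<Rightarrow> real" and G where m: "mollifiers \<rho> G" using mollifiers_exist by blast
  let ?v = "\<lambda>m. conv (\<rho> m) u"
  note cs = conv_sequence[OF u(1) L m] and gs = weak_gradient_sequence[OF X u(1) wu VK(1) L VK(3) m]
  have eq: "AE x in lebesgue. indicator L x * \<bar>?v m x - u x\<bar> = indicator L x * \<bar>?v m x - f x\<bar>" for m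
    using uf by eventually_elim (use VK(3) in \<open>auto simp: indicator_def\<close>)
  have ms: "(\<lambda>x. indicator L x * \<bar>?v m x - f x\<bar>) \<in> borel_measurable lebesgue" for m
  proof -
    have "(\<lambda>x. indicator L x *\<^sub>R f x) \<in> borel_measurable lebesgue"
      using locally_integrable_cutoff[OF lf L subset_UNIV] by (rule borel_measurable_integrable)
    moreover have "?v m \<in> borel_measurable lebesgue"
      by (intro continuous_lebesgue_measurable has_grad_continuous[OF mollifiers_has_grad[OF m u(1)]])
    moreover have "L \<in> sets lebesgue" using lmeasurable_compact[OF L] by (rule fmeasurableD)
    ultimately have "(\<lambda>x. \<bar>indicator L x * ?v m x - indicator L x *\<^sub>R f x\<bar>) \<in> borel_measurable lebesgue"
      by measurable
    then show ?thesis by (simp add: right_diff_distrib[symmetric] abs_mult)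
  qed
  have i: "integrable lebesgue (\<lambda>x. indicator L x * \<bar>?v m x - f x\<bar>)" for m
    using integrable_cong_AE[OF borel_measurable_integrable[OF cs(1)] ms eq] cs(1) by blast
  have "(LINT x|lebesgue. indicator L x * \<bar>?v m x - u x\<bar>) = (LINT x|lebesgue. indicator L x * \<bar>?v m x - f x\<bar>)" for m
    by (rule integral_cong_AE[OF borel_measurable_integrable[OF cs(1)] ms eq])
  with cs(2) have l: "(\<lambda>m. LINT x|lebesgue. indicator L x * \<bar>?v m x - f x\<bar>) \<longlonglongrightarrow> 0" by simp
  show ?thesis by (rule that[OF mollifiers_has_grad[OF m u(1)] i l gs])
qed

lemma integrable_bounded_coeff:
  fixes F c :: "'a \<Rightarrow> real"
  assumes "integrable M F" "c \<in> borel_measurable M" "AE x in M. \<bar>c x\<bar> \<le> C"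
  shows "integrable M (\<lambda>x. c x * F x)"
proof (rule Bochner_Integration.integrable_bound[of _ "\<lambda>x. C * F x"])
  show "AE x in M. norm (c x * F x) \<le> norm (C * F x)"
    using assms(3) by eventually_elim (auto simp: abs_mult intro!: mult_right_mono)
qed (use assms in auto)

text \<open>The comparison is applied with \<open>A\<close> the regularised modulus of a
  mollification of f. The weights are fixed and bounded, so each replacement of \<open>A\<close> by
  \<open>\<bar>f\<bar>\<close>, or of a gradient by \<open>fg\<close>, costs a constant times an L1
  error that tends to 0.\<close>

lemma weighted_inequality:
  fixes X :: "'k::finite \<Rightarrow> real^'n \<Rightarrow> real^'n" and d :: "real^'n \<Rightarrow> real" and g :: "real^'n \<Rightarrow> real^'k"
  assumes X: "subgradient X" and d: "continuous_on UNIV d" "\<And>r. compact {x. d x \<le> r}"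
    and w: "weak_gradient_on {x. 1 < d x} X d g"
    and lap: "\<And>\<phi>. test_function {x. 1 < d x} \<phi> \<Longrightarrow> (\<And>x. 0 \<le> \<phi> x) \<Longrightarrow>
      - (LINT x|lebesgue. g x \<bullet> grad X \<phi> x) \<le> (LINT x|lebesgue. h x * \<phi> x)"
    and g1: "AE x in lebesgue. 1 < d x \<longrightarrow> norm (g x) \<le> 1" and h: "continuous_on UNIV h"
    and \<eta>: "\<And>t. (\<eta> has_real_derivative \<eta>' t) (at t)" "continuous_on UNIV \<eta>'" "\<And>t. 0 \<le> \<eta> t"
      "\<And>t. t \<notin> {a..b} \<Longrightarrow> \<eta> t = 0" "\<And>t. t \<notin> {a..b} \<Longrightarrow> \<eta>' t = 0"
    and ab: "1 < a'" "a' < a" "b < b'"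
    and L_def: "L = {x. a' \<le> d x \<and> d x \<le> b'}"
    and f: "weak_gradient_on UNIV X f fg"
  shows "(LINT x|lebesgue. (- \<eta>' (d x) * (norm (indicator L x *\<^sub>R g x))\<^sup>2) * (indicator L x * \<bar>f x\<bar>))
    \<le> (LINT x|lebesgue. (h x * \<eta> (d x)) * (indicator L x * \<bar>f x\<bar>))
      + (LINT x|lebesgue. \<eta> (d x) * (indicator L x * norm (fg x)))" (is "?I1 \<le> ?I2 + ?I3")
    and "integrable lebesgue (\<lambda>x. (- \<eta>' (d x) * (norm (indicator L x *\<^sub>R g x))\<^sup>2) * (indicator L x * \<bar>f x\<bar>))"
    and "integrable lebesgue (\<lambda>x. (h x * \<eta> (d x)) * (indicator L x * \<bar>f x\<bar>))"
    and "integrable lebesgue (\<lambda>x. \<eta> (d x) * (indicator L x * norm (fg x)))"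
proof -
  have L: "compact L" unfolding L_def by (rule compact_annulus[OF d(1,2)])
  have LU: "L \<subseteq> {x. 1 < d x}" using ab by (auto simp: L_def)
  have Lm[measurable]: "L \<in> sets lebesgue" using lmeasurable_compact[OF L] by (rule fmeasurableD)
  obtain v D where v: "\<And>m::nat. has_grad (v m) (D m)"
    and iE: "\<And>m. integrable lebesgue (\<lambda>x. indicator L x * \<bar>v m x - f x\<bar>)"
    and E: "(\<lambda>m. LINT x|lebesgue. indicator L x * \<bar>v m x - f x\<bar>) \<longlonglongrightarrow> 0"
    and iF: "\<And>m. integrable lebesgue (\<lambda>x. indicator L x * norm (grad X (v m) x - fg x))"
    and F: "(\<lambda>m. LINT x|lebesgue. indicator L x * norm (grad X (v m) x - fg x)) \<longlonglongrightarrow> 0"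
    by (rule weak_gradient_local_approx[OF X f L]) blast
  have \<eta>c: "continuous_on UNIV \<eta>" by (rule has_real_derivative_continuous[OF \<eta>(1)])
  obtain B1 where B1: "0 < B1" "\<And>t. norm (\<eta> t) \<le> B1" using compact_support_bounded[OF \<eta>c compact_Icc \<eta>(4)] by blast
  obtain B2 where B2: "0 < B2" "\<And>t. norm (\<eta>' t) \<le> B2" using compact_support_bounded[OF \<eta>(2) compact_Icc \<eta>(5)] by blast
  have c1: "continuous_on UNIV (\<lambda>x. \<eta> (d x))" "continuous_on UNIV (\<lambda>x. \<eta>' (d x))"
    by (auto intro!: continuous_on_compose2[OF \<eta>c] continuous_on_compose2[OF \<eta>(2)] d(1))
  have c2: "continuous_on UNIV (\<lambda>x. h x * \<eta> (d x))" by (intro continuous_intros h c1)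
  have off: "\<eta> (d x) = 0" if "x \<notin> L" for x using \<eta>(4)[of "d x"] that ab by (auto simp: L_def)
  then have off': "h x * \<eta> (d x) = 0" if "x \<notin> L" for x using that by simp
  obtain B3 where B3: "0 < B3" "\<And>x. norm (h x * \<eta> (d x)) \<le> B3" using compact_support_bounded[OF c2 L off'] by blast
  define gl where "gl x = indicator L x *\<^sub>R g x" for x
  have igl: "integrable lebesgue gl"
    unfolding gl_def using w LU L by (intro locally_integrable_cutoff) (auto simp: weak_gradient_on_def)
  have gl1: "AE x in lebesgue. norm (gl x) \<le> 1"
    using g1 by eventually_elim (use LU in \<open>auto simp: gl_def indicator_def\<close>)
  have [measurable]: "gl \<in> borel_measurable lebesgue" "(\<lambda>x. \<eta>' (d x)) \<in> borel_measurable lebesgue"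
      "(\<lambda>x. \<eta> (d x)) \<in> borel_measurable lebesgue" "(\<lambda>x. h x * \<eta> (d x)) \<in> borel_measurable lebesgue"
    using igl continuous_lebesgue_measurable[OF c1(1)] continuous_lebesgue_measurable[OF c1(2)]
      continuous_lebesgue_measurable[OF c2] by auto
  define k where "k x = - \<eta>' (d x) * (norm (gl x))\<^sup>2" for x
  have km[measurable]: "k \<in> borel_measurable lebesgue" unfolding k_def by measurable
  have kb: "AE x in lebesgue. \<bar>k x\<bar> \<le> B2"
    using gl1
  proof eventually_elim
    case (elim x)
    have "(norm (gl x))\<^sup>2 \<le> 1" using elim by (simp add: power_le_one)
    then have "\<bar>\<eta>' (d x)\<bar> * (norm (gl x))\<^sup>2 \<le> B2 * 1" using B2(2)[of "d x"] B2(1) by (intro mult_mono) auto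
    then show ?case by (simp add: k_def abs_mult)
  qed
  have lf: "locally_integrable_on UNIV f" "locally_integrable_on UNIV fg" using f by (auto simp: weak_gradient_on_def)
  have if1: "integrable lebesgue (\<lambda>x. indicator L x * \<bar>f x\<bar>)"
    using integrable_norm[OF locally_integrable_cutoff[OF lf(1) L subset_UNIV]] by (simp add: abs_mult)
  have if2: "integrable lebesgue (\<lambda>x. indicator L x * norm (fg x))"
    using integrable_norm[OF locally_integrable_cutoff[OF lf(2) L subset_UNIV]] by simp
  have iL: "integrable lebesgue (\<lambda>x. indicator L x :: real)"
    using lmeasurable_compact[OF L] by (intro integrable_real_indicator) (auto simp: fmeasurable_def)
  have i1: "integrable lebesgue (\<lambda>x. k x * (indicator L x * \<bar>f x\<bar>))"
    by (rule integrable_bounded_coeff[OF if1 km kb])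
  have i2: "integrable lebesgue (\<lambda>x. (h x * \<eta> (d x)) * (indicator L x * \<bar>f x\<bar>))"
    by (rule integrable_bounded_coeff[OF if1, of _ B3]) (use B3(2) in auto)
  have i3: "integrable lebesgue (\<lambda>x. \<eta> (d x) * (indicator L x * norm (fg x)))"
    by (rule integrable_bounded_coeff[OF if2, of _ B1]) (use B1(2) in auto)
  show "integrable lebesgue (\<lambda>x. (- \<eta>' (d x) * (norm (indicator L x *\<^sub>R g x))\<^sup>2) * (indicator L x * \<bar>f x\<bar>))"
    using i1 by (simp add: k_def gl_def)
  show "integrable lebesgue (\<lambda>x. (h x * \<eta> (d x)) * (indicator L x * \<bar>f x\<bar>))" by (rule i2)
  show "integrable lebesgue (\<lambda>x. \<eta> (d x) * (indicator L x * norm (fg x)))" by (rule i3)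
  define \<kappa> where "\<kappa> m = inverse (real (Suc m))" for m
  have \<kappa>: "0 < \<kappa> m" for m by (simp add: \<kappa>_def)
  \<comment> \<open>Bounds the integral over \<open>L\<close> of the difference between the
    regularised modulus and \<open>\<bar>f\<bar>\<close>; \<open>S\<close> below does the same for
    the gradients.\<close>
  define R where "R m = (LINT x|lebesgue. indicator L x * \<bar>v m x - f x\<bar>) + \<kappa> m * (LINT x|lebesgue. indicator L x)" for m
  define S where "S m = (LINT x|lebesgue. indicator L x * norm (grad X (v m) x - fg x))" for m
  \<comment> \<open>\<open>B2\<close> bounds the weight on the left and \<open>B3\<close> the weight
    of the Laplacian term, and both meet the error \<open>R\<close>; \<open>B1\<close> bounds the
    weight of the gradient, which meets \<open>S\<close>.\<close>
  have key: "?I1 \<le> ?I2 + ?I3 + ((B2 + B3) * R m + B1 * S m)" for m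
  proof -
    define A where "A x = sqrt ((v m x)\<^sup>2 + (\<kappa> m)\<^sup>2)" for x
    obtain Q where Q: "has_grad A Q" and QA: "\<And>x. norm (grad X A x) \<le> norm (grad X (v m) x)"
      unfolding A_def by (rule grad_sqrt[OF v \<kappa>]) blast
    have A0: "0 \<le> A x" for x by (simp add: A_def)
    have AL: "\<bar>A x - \<bar>f x\<bar>\<bar> \<le> \<bar>v m x - f x\<bar> + \<kappa> m" for x
      unfolding A_def by (rule sqrt_perturb) (simp add: \<kappa> less_imp_le)
    define r where "r x = indicator L x * \<bar>v m x - f x\<bar> + \<kappa> m * indicator L x" for x
    have ir: "integrable lebesgue r" unfolding r_def using iE[of m] iL by simp
    have Rr: "(LINT x|lebesgue. r x) = R m" unfolding r_def R_def using iE[of m] iL by simp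
    have Lr: "\<bar>indicator L x * \<bar>f x\<bar> - indicator L x * A x\<bar> \<le> r x" for x
      using AL[of x] by (cases "x \<in> L") (auto simp: r_def abs_minus_commute)
    have iA: "integrable lebesgue (\<lambda>x. indicator L x * A x)"
    proof -
      have "integrable lborel (\<lambda>x. indicator L x *\<^sub>R A x)"
        by (intro borel_integrable_compact L has_grad_continuous[OF Q])
      then have "integrable lebesgue (\<lambda>x. indicator L x *\<^sub>R A x)" by (subst integrable_completion) auto
      then show ?thesis by simp
    qed
    have j1: "integrable lebesgue (\<lambda>x. k x * (indicator L x * A x))"
      by (rule integrable_bounded_coeff[OF iA km kb])
    have j2: "integrable lebesgue (\<lambda>x. (h x * \<eta> (d x)) * (indicator L x * A x))"
      by (rule integrable_bounded_coeff[OF iA, of _ B3]) (use B3(2) in auto)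
    have "?I1 = (LINT x|lebesgue. k x * (indicator L x * \<bar>f x\<bar>))" by (simp add: k_def gl_def)
    also have "\<dots> \<le> (LINT x|lebesgue. k x * (indicator L x * A x) + B2 * r x)"
    proof (rule integral_mono_AE)
      show "AE x in lebesgue. k x * (indicator L x * \<bar>f x\<bar>) \<le> k x * (indicator L x * A x) + B2 * r x"
        using kb
      proof eventually_elim
        case (elim x)
        have "k x * (indicator L x * \<bar>f x\<bar> - indicator L x * A x) \<le> \<bar>k x\<bar> * \<bar>indicator L x * \<bar>f x\<bar> - indicator L x * A x\<bar>"
          unfolding abs_mult[symmetric] by (rule abs_ge_self)
        also have "\<dots> \<le> B2 * r x" by (intro mult_mono elim Lr) (use B2(1) in auto)
        finally show ?case by (simp add: right_diff_distrib)
      qed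
    qed (use i1 j1 ir in auto)
    also have "\<dots> = (LINT x|lebesgue. k x * (indicator L x * A x)) + B2 * R m"
      using j1 ir by (simp add: Rr)
    also have "(LINT x|lebesgue. k x * (indicator L x * A x))
      = (LINT x|lebesgue. indicator L x * - (A x * \<eta>' (d x) * (norm (g x))\<^sup>2))"
      by (intro Bochner_Integration.integral_cong) (auto simp: k_def gl_def indicator_def)
    also have "\<dots> \<le> (LINT x|lebesgue. indicator L x * (h x * \<eta> (d x) * A x))
      + (LINT x|lebesgue. indicator L x * (\<eta> (d x) * norm (grad X A x)))"
      by (rule laplacian_comparison[OF X d w lap g1 h Q A0 \<eta> ab L_def])
    also have "(LINT x|lebesgue. indicator L x * (h x * \<eta> (d x) * A x)) = (LINT x|lebesgue. (h x * \<eta> (d x)) * (indicator L x * A x))"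
      by (simp add: mult_ac)
    also have "\<dots> \<le> (LINT x|lebesgue. (h x * \<eta> (d x)) * (indicator L x * \<bar>f x\<bar>) + B3 * r x)"
    proof (rule integral_mono_AE)
      show "AE x in lebesgue. (h x * \<eta> (d x)) * (indicator L x * A x) \<le> (h x * \<eta> (d x)) * (indicator L x * \<bar>f x\<bar>) + B3 * r x"
      proof (rule AE_I2)
        fix x
        have "(h x * \<eta> (d x)) * (indicator L x * A x - indicator L x * \<bar>f x\<bar>)
            \<le> \<bar>h x * \<eta> (d x)\<bar> * \<bar>indicator L x * A x - indicator L x * \<bar>f x\<bar>\<bar>"
          unfolding abs_mult[symmetric] by (rule abs_ge_self)
        also have "\<dots> \<le> B3 * r x"
          by (intro mult_mono) (use B3 Lr[of x] in \<open>auto simp: abs_minus_commute\<close>)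
        finally show "(h x * \<eta> (d x)) * (indicator L x * A x) \<le> (h x * \<eta> (d x)) * (indicator L x * \<bar>f x\<bar>) + B3 * r x"
          by (simp add: right_diff_distrib)
      qed
    qed (use i2 j2 ir in auto)
    also have "\<dots> = ?I2 + B3 * R m" using i2 ir by (simp add: Rr)
    also have "(LINT x|lebesgue. indicator L x * (\<eta> (d x) * norm (grad X A x)))
      \<le> (LINT x|lebesgue. \<eta> (d x) * (indicator L x * norm (fg x)) + B1 * (indicator L x * norm (grad X (v m) x - fg x)))"
    proof (rule integral_mono_AE)
      have "integrable lborel (\<lambda>x. indicator L x *\<^sub>R (\<eta> (d x) * norm (grad X A x)))"
        by (intro borel_integrable_compact L continuous_intros continuous_on_subset[OF c1(1)] continuous_on_subset[OF grad_continuous[OF X Q]]) auto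
      then have "integrable lebesgue (\<lambda>x. indicator L x *\<^sub>R (\<eta> (d x) * norm (grad X A x)))"
        by (subst integrable_completion) auto
      then show "integrable lebesgue (\<lambda>x. indicator L x * (\<eta> (d x) * norm (grad X A x)))" by simp
      show "AE x in lebesgue. indicator L x * (\<eta> (d x) * norm (grad X A x))
        \<le> \<eta> (d x) * (indicator L x * norm (fg x)) + B1 * (indicator L x * norm (grad X (v m) x - fg x))"
      proof (rule AE_I2)
        fix x
        have "norm (grad X A x) \<le> norm (fg x) + norm (grad X (v m) x - fg x)"
          using QA[of x] norm_triangle_sub[of "grad X (v m) x" "fg x"] by linarith
        then have "\<eta> (d x) * norm (grad X A x) \<le> \<eta> (d x) * norm (fg x) + \<eta> (d x) * norm (grad X (v m) x - fg x)"
          unfolding distrib_left[symmetric] by (intro mult_left_mono \<eta>(3))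
        also have "\<eta> (d x) * norm (grad X (v m) x - fg x) \<le> B1 * norm (grad X (v m) x - fg x)"
          using B1(2)[of "d x"] \<eta>(3)[of "d x"] by (intro mult_right_mono) auto
        finally show "indicator L x * (\<eta> (d x) * norm (grad X A x))
          \<le> \<eta> (d x) * (indicator L x * norm (fg x)) + B1 * (indicator L x * norm (grad X (v m) x - fg x))"
          by (cases "x \<in> L") auto
      qed
    qed (use i3 iF in auto)
    also have "\<dots> = ?I3 + B1 * S m" using i3 iF[of m] by (simp add: S_def)
    finally show ?thesis by (simp add: algebra_simps)
  qed
  have "R \<longlonglongrightarrow> 0 + 0 * (LINT x|lebesgue. indicator L x)"
    unfolding R_def \<kappa>_def by (intro tendsto_intros E LIMSEQ_inverse_real_of_nat)
  then have Rl: "R \<longlonglongrightarrow> 0" by simp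
  have Sl: "S \<longlonglongrightarrow> 0" unfolding S_def by (rule F)
  have "(\<lambda>m. ?I2 + ?I3 + ((B2 + B3) * R m + B1 * S m)) \<longlonglongrightarrow> ?I2 + ?I3 + ((B2 + B3) * 0 + B1 * 0)"
    by (intro tendsto_intros Rl Sl)
  then have "(\<lambda>m. ?I2 + ?I3 + ((B2 + B3) * R m + B1 * S m)) \<longlonglongrightarrow> ?I2 + ?I3" by simp
  then show "?I1 \<le> ?I2 + ?I3" by (rule LIMSEQ_le_const) (use key in blast)
qed

text \<open>Local uniqueness applies on compact subsets to a truncation of d; countably many annuli
  exhaust the exterior of the closed unit ball, so the exceptional null sets add up to a null
  set.\<close>

lemma distance_gradient_unique:
  fixes X :: "'k::finite \<Rightarrow> real^'n \<Rightarrow> real^'n" and d :: "real^'n \<Rightarrow> real"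
  assumes X: "subgradient X" and d: "continuous_on UNIV d" "\<And>r. compact {x. d x \<le> r}"
    and w: "weak_gradient_on {x. 1 < d x} X d g1" "weak_gradient_on {x. 1 < d x} X d g2"
  shows "AE x in lebesgue. 1 < d x \<longrightarrow> g1 x = g2 x"
proof -
  define L where "L n = {x. 1 + inverse (real (Suc n)) \<le> d x \<and> d x \<le> real n}" for n
  have "AE x in lebesgue. x \<in> L n \<longrightarrow> g1 x = g2 x" for n
  proof (rule weak_gradient_unique[OF X weak_gradient_truncation(1)[OF X d w(1)]
        weak_gradient_truncation(2)[OF X d w(1)] weak_gradient_truncation(2)[OF X d w(2)]])
    show "open {x. 1 < d x \<and> d x < real n + 1}" by (intro open_Collect_conj open_Collect_less continuous_intros d(1))
    show "compact (L n)" unfolding L_def by (rule compact_annulus[OF d(1,2)])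
    show "L n \<subseteq> {x. 1 < d x \<and> d x < real n + 1}"
    proof
      fix x assume "x \<in> L n"
      moreover have "0 < inverse (real (Suc n))" by simp
      ultimately show "x \<in> {x. 1 < d x \<and> d x < real n + 1}" unfolding L_def mem_Collect_eq by linarith
    qed
  qed
  then have "AE x in lebesgue. \<forall>n. x \<in> L n \<longrightarrow> g1 x = g2 x" unfolding AE_all_countable by blast
  then show ?thesis
  proof eventually_elim
    case (elim x)
    show ?case
    proof
      assume "1 < d x"
      then obtain k where k: "inverse (real (Suc k)) < d x - 1" using reals_Archimedean[of "d x - 1"] by auto
      obtain l :: nat where l: "d x \<le> real l" using real_arch_simple by blast
      \<comment> \<open>One index must serve both ends: \<open>k\<close> brings the inner radius
        below \<open>d x\<close> and \<open>l\<close> the outer radius above it, and the annuli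
        grow.\<close>
      have "inverse (real (Suc (max k l))) \<le> inverse (real (Suc k))" by (intro le_imp_inverse_le) auto
      then have "1 + inverse (real (Suc (max k l))) \<le> d x" using k by linarith
      moreover have "d x \<le> real (max k l)" by (rule order_trans[OF l]) simp
      ultimately have "x \<in> L (max k l)" unfolding L_def by blast
      then show "g1 x = g2 x" using elim by blast
    qed
  qed
qed

section \<open>Cutoff and conclusion\<close>

text \<open>The cutoff multiplies the term to be estimated and the one absorbing it alike, so the value
  \<open>1/20\<close> does not matter: all that counts is a lower bound and a bound for the derivative that do
  not depend on \<open>R\<close>.\<close>

lemma cutoff_exists:
  fixes R :: real assumes "1 \<le> R"
  obtains \<theta> \<theta>' :: "real \<Rightarrow> real" where
    "\<And>t. (\<theta> has_real_derivative \<theta>' t) (at t)" "continuous_on UNIV \<theta>'" "\<And>t. 0 \<le> \<theta> t" "\<And>t. \<theta> t \<le> 1"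
    "\<And>t. t \<notin> {3/2..R} \<Longrightarrow> \<theta> t = 0" "\<And>t. t \<notin> {3/2..R} \<Longrightarrow> \<theta>' t = 0" "\<And>t. \<bar>\<theta>' t\<bar> \<le> 3"
    "\<And>t. 2 \<le> t \<Longrightarrow> t \<le> R / 2 \<Longrightarrow> 1 / 20 \<le> \<theta> t"
proof -
  define P where "P t = max 0 (t - 3/2)" for t :: real
  define Q where "Q t = max 0 (R - t)" for t :: real
  \<comment> \<open>Rises from 0 at 3/2 and stays below 1, with derivative at most 1 because
    \<open>2 * P t \<le> 1 + (P t)\<^sup>2\<close>.\<close>
  define m where "m t = (P t)\<^sup>2 / (1 + (P t)\<^sup>2)" for t
  define m' where "m' t = 2 * P t / (1 + (P t)\<^sup>2)\<^sup>2" for t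
  \<comment> \<open>Falls to 0 at \<open>R\<close> and is C1 there. The scale \<open>R\<close> keeps
    its slope at most 2 / R, hence at most 2, on the half-line of nonnegative t.\<close>
  define q where "q t = (Q t)\<^sup>2 / R\<^sup>2" for t
  define q' where "q' t = - 2 * Q t / R\<^sup>2" for t
  have pos: "0 < 1 + (P t)\<^sup>2" "1 + (P t)\<^sup>2 \<noteq> 0" for t by (simp_all add: add_pos_nonneg add_nonneg_eq_0_iff)
  have DP: "((\<lambda>t. (P t)\<^sup>2) has_real_derivative 2 * P t) (at t)" for t
  proof -
    have "((\<lambda>t. t - 3/2) has_real_derivative 1) (at t)" by (auto intro!: derivative_eq_intros)
    from DERIV_chain'[OF this DERIV_max0_square] show ?thesis unfolding P_def by simp
  qed
  have DQ: "((\<lambda>t. (Q t)\<^sup>2) has_real_derivative - (2 * Q t)) (at t)" for t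
  proof -
    have "((\<lambda>t. R - t) has_real_derivative - 1) (at t)" by (auto intro!: derivative_eq_intros)
    from DERIV_chain'[OF this DERIV_max0_square] show ?thesis unfolding Q_def by simp
  qed
  have Dm: "(m has_real_derivative m' t) (at t)" for t
  proof -
    have "(m has_real_derivative (2 * P t * (1 + (P t)\<^sup>2) - (P t)\<^sup>2 * (2 * P t)) / ((1 + (P t)\<^sup>2) * (1 + (P t)\<^sup>2))) (at t)"
    proof -
      have "((\<lambda>t. 1 + (P t)\<^sup>2) has_real_derivative 2 * P t) (at t)"
        using DERIV_add[OF DERIV_const DP, of 1 t] by simp
      from DERIV_divide[OF DP this pos(2)] show ?thesis unfolding m_def .
    qed
    moreover have "(2 * P t * (1 + (P t)\<^sup>2) - (P t)\<^sup>2 * (2 * P t)) / ((1 + (P t)\<^sup>2) * (1 + (P t)\<^sup>2)) = m' t"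
      by (simp add: m'_def power2_eq_square algebra_simps)
    ultimately show ?thesis by simp
  qed
  have Dq: "(q has_real_derivative q' t) (at t)" for t
    unfolding q_def q'_def using DERIV_cdivide[OF DQ, of "R\<^sup>2" t] by simp
  have Pc: "continuous_on UNIV P" "continuous_on UNIV Q" unfolding P_def Q_def by (intro continuous_intros)+
  have c: "continuous_on UNIV m" "continuous_on UNIV m'" "continuous_on UNIV q" "continuous_on UNIV q'"
    unfolding m_def m'_def q_def q'_def using assms pos by (auto intro!: continuous_intros Pc)
  have mb: "0 \<le> m t" "m t \<le> 1" for t using pos(1)[of t] by (auto simp: m_def divide_le_eq)
  have m'b: "\<bar>m' t\<bar> \<le> 1" for t
  proof -
    have "0 \<le> P t" by (simp add: P_def)
    have "2 * P t \<le> 1 + (P t)\<^sup>2" using sum_squares_bound[of 1 "P t"] by simp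
    also have "\<dots> \<le> (1 + (P t)\<^sup>2)\<^sup>2" by (rule self_le_power) simp_all
    finally show ?thesis using \<open>0 \<le> P t\<close> pos[of t] by (simp add: m'_def abs_divide divide_le_eq)
  qed
  \<comment> \<open>The bounds fail for negative t, where \<open>q\<close> exceeds 1, but
    \<open>m\<close> and its derivative vanish there. The product rule then gives 1 + 2 = 3 as bound
    for the derivative.\<close>
  have qb: "0 \<le> q t" "q t \<le> 1" "\<bar>q' t\<bar> \<le> 2" if "0 \<le> t" for t
  proof -
    have Q: "0 \<le> Q t" "Q t \<le> R" using that assms by (auto simp: Q_def)
    then have "(Q t)\<^sup>2 \<le> R\<^sup>2" by (intro power_mono)
    then show "0 \<le> q t" "q t \<le> 1" using assms by (auto simp: q_def)
    have "R \<le> R\<^sup>2" using assms by (simp add: power2_eq_square)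
    then show "\<bar>q' t\<bar> \<le> 2" using Q assms by (simp add: q'_def abs_mult abs_divide divide_le_eq)
  qed
  have lo: "m t = 0" "m' t = 0" if "t \<le> 3/2" for t using that by (auto simp: m_def m'_def P_def)
  have hi: "q t = 0" "q' t = 0" if "R \<le> t" for t using that by (auto simp: q_def q'_def Q_def)
  show ?thesis
  proof (rule that[of "\<lambda>t. m t * q t" "\<lambda>t. m' t * q t + q' t * m t"])
    show "((\<lambda>t. m t * q t) has_real_derivative m' t * q t + q' t * m t) (at t)" for t
      by (rule DERIV_mult[OF Dm Dq])
    show "continuous_on UNIV (\<lambda>t. m' t * q t + q' t * m t)" by (intro continuous_intros c)
    fix t
    show "0 \<le> m t * q t" "m t * q t \<le> 1" "\<bar>m' t * q t + q' t * m t\<bar> \<le> 3"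
    proof -
      show "0 \<le> m t * q t" using mb(1)[of t] by (simp add: q_def)
      have "m t * q t \<le> 1 \<and> \<bar>m' t * q t + q' t * m t\<bar> \<le> 3"
      proof (cases "t \<le> 3/2")
        case False
        then have "0 \<le> t" by simp
        note qb = qb[OF this]
        have "\<bar>m' t * q t + q' t * m t\<bar> \<le> \<bar>m' t\<bar> * \<bar>q t\<bar> + \<bar>q' t\<bar> * \<bar>m t\<bar>"
          unfolding abs_mult[symmetric] by (rule abs_triangle_ineq)
        also have "\<dots> \<le> 1 * 1 + 2 * 1" using qb mb[of t] m'b[of t] by (intro add_mono mult_mono) auto
        finally show ?thesis using qb mb[of t] by (simp add: mult_le_one)
      qed (simp add: lo)
      then show "m t * q t \<le> 1" "\<bar>m' t * q t + q' t * m t\<bar> \<le> 3" by auto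
    qed
    show "m t * q t = 0" "m' t * q t + q' t * m t = 0" if "t \<notin> {3/2..R}"
      using that lo[of t] hi[of t] by (cases "t \<le> 3/2"; auto)+
    assume t: "2 \<le> t" "t \<le> R / 2"
    \<comment> \<open>From t = 2 on, the rising factor is at least (1/4) / (5/4) = 1/5; up to R / 2
      the falling factor is at least 1/4. Their product is 1/20.\<close>
    have "1 / 2 \<le> P t" using t by (simp add: P_def)
    then have "(1 / 2)\<^sup>2 \<le> (P t)\<^sup>2" by (intro power_mono) auto
    then have 1: "1 / 5 \<le> m t" using pos[of t] by (simp add: m_def le_divide_eq power2_eq_square)
    have "R / 2 \<le> Q t" using t by (simp add: Q_def)
    then have "(R / 2)\<^sup>2 \<le> (Q t)\<^sup>2" using assms by (intro power_mono) auto
    then have 2: "1 / 4 \<le> q t" using assms by (simp add: q_def le_divide_eq power2_eq_square)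
    have "1 / 5 * (1 / 4) \<le> m t * q t" using 1 2 by (intro mult_mono) auto
    then show "1 / 20 \<le> m t * q t" by simp
  qed
qed

text \<open>With \<open>max 1 t\<close> in place of \<open>t\<close> the power is continuous on the whole line; nothing changes where
  the cutoff is nonzero.\<close>

lemma weighted_cutoff_derivative:
  fixes \<theta> \<theta>' :: "real \<Rightarrow> real" and \<beta> p a :: real
  assumes \<theta>: "\<And>t. (\<theta> has_real_derivative \<theta>' t) (at t)" "continuous_on UNIV \<theta>'"
      "\<And>t. t < a \<Longrightarrow> \<theta> t = 0" "\<And>t. t < a \<Longrightarrow> \<theta>' t = 0" and "1 < a"
  defines "W \<equiv> \<lambda>t. exp (- \<beta> * max 1 t powr p)"
  shows "((\<lambda>t. \<theta> t * W t) has_real_derivative (\<theta>' t - \<theta> t * (\<beta> * p * max 1 t powr (p - 1))) * W t) (at t)"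
    and "continuous_on UNIV (\<lambda>t. (\<theta>' t - \<theta> t * (\<beta> * p * max 1 t powr (p - 1))) * W t)"
proof -
  have pc: "continuous_on UNIV (\<lambda>t::real. max 1 t powr q)" for q by (intro continuous_intros) auto
  show "continuous_on UNIV (\<lambda>t. (\<theta>' t - \<theta> t * (\<beta> * p * max 1 t powr (p - 1))) * W t)"
    unfolding W_def by (intro continuous_intros \<theta>(2) has_real_derivative_continuous[OF \<theta>(1)] pc)
  show "((\<lambda>t. \<theta> t * W t) has_real_derivative (\<theta>' t - \<theta> t * (\<beta> * p * max 1 t powr (p - 1))) * W t) (at t)"
  proof (cases "t < a")
    case True
    have "((\<lambda>t. 0) has_real_derivative (\<theta>' t - \<theta> t * (\<beta> * p * max 1 t powr (p - 1))) * W t) (at t)"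
      using True \<theta>(3,4) by simp
    then show ?thesis
      by (rule has_field_derivative_transform_within_open[of _ _ _ "{..<a}"]) (use True \<theta>(3) in auto)
  next
    case False
    then have t: "1 < t" using \<open>1 < a\<close> by simp
    have "((\<lambda>t. \<theta> t * exp (- \<beta> * t powr p)) has_real_derivative
        \<theta>' t * exp (- \<beta> * t powr p) + exp (- \<beta> * t powr p) * (- \<beta> * (p * t powr (p - 1))) * \<theta> t) (at t)"
      using t by (auto intro!: derivative_eq_intros \<theta>(1) simp: powr_diff field_simps)
    also have "\<theta>' t * exp (- \<beta> * t powr p) + exp (- \<beta> * t powr p) * (- \<beta> * (p * t powr (p - 1))) * \<theta> t
      = (\<theta>' t - \<theta> t * (\<beta> * p * max 1 t powr (p - 1))) * W t"
      using t by (simp add: W_def max_def algebra_simps)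
    finally show ?thesis
      by (rule has_field_derivative_transform_within_open[of _ _ _ "{1<..}"]) (use t in \<open>auto simp: W_def max_def\<close>)
  qed
qed

section \<open>The distance function, annular bounds and the limit\<close>

text \<open>Continuity is semicontinuity from both sides: open balls are open because the topologies
  agree, and closed balls are closed because they are compact.\<close>

lemma proper_metric_distance:
  fixes \<rho> :: "real^'n \<Rightarrow> real^'n \<Rightarrow> real"
  assumes "proper_metric \<rho>"
  shows "0 \<le> \<rho> z x" "compact {x. \<rho> z x \<le> r}" "continuous_on UNIV (\<rho> z)"
proof -
  interpret Metric_space UNIV \<rho> using assms by (simp add: proper_metric_def)
  show "0 \<le> \<rho> z x" by simp
  show c: "compact {x. \<rho> z x \<le> r}" for r using assms by (simp add: proper_metric_def)
  have top: "mtopology = euclidean" using assms by (simp add: proper_metric_def)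
  have o1: "open {x. \<rho> z x < r}" for r
  proof -
    have "openin mtopology (mball z r)" by (rule openin_mball)
    moreover have "mball z r = {x. \<rho> z x < r}" by (auto simp: mball_def)
    ultimately show ?thesis by (simp add: top)
  qed
  have o2: "open {x. r < \<rho> z x}" for r
  proof -
    have "{x. r < \<rho> z x} = - {x. \<rho> z x \<le> r}" by auto
    then show ?thesis using compact_imp_closed[OF c[of r]] by (simp add: open_Compl)
  qed
  show "continuous_on UNIV (\<rho> z)"
    unfolding continuous_on_def
  proof (intro ballI order_tendstoI)
    fix x r assume "r < \<rho> z x"
    then show "\<forall>\<^sub>F y in at x. r < \<rho> z y" unfolding eventually_at_topological using o2[of r] by blast
  next
    fix x r assume "\<rho> z x < r"
    then show "\<forall>\<^sub>F y in at x. \<rho> z y < r" unfolding eventually_at_topological using o1[of r] by blast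
  qed
qed

lemma locally_integrable_measurable:
  fixes f :: "real^'n \<Rightarrow> 'b::euclidean_space"
  assumes "locally_integrable_on UNIV f" shows "f \<in> borel_measurable lebesgue"
proof (rule borel_measurable_LIMSEQ_metric)
  show "(\<lambda>x. indicator (cball 0 (real n)) x *\<^sub>R f x) \<in> borel_measurable lebesgue" for n
    using locally_integrable_cutoff[OF assms compact_cball subset_UNIV] by (rule borel_measurable_integrable)
  fix x :: "real^'n"
  obtain N :: nat where "norm x \<le> real N" using real_arch_simple by blast
  then have "\<forall>\<^sub>F n in sequentially. indicator (cball 0 (real n)) x *\<^sub>R f x = f x"
    unfolding eventually_sequentially by (intro exI[of _ N]) auto
  then show "(\<lambda>n. indicator (cball 0 (real n)) x *\<^sub>R f x) \<longlonglongrightarrow> f x" by (rule tendsto_eventually)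
qed

text \<open>The weight is the cutoff times the exponential. Differentiating the exponential yields
  the factor d to the power p - 1, and the part of the Laplacian bound with the same growth is
  absorbed because the lower bound on the gradient beats \<open>\<epsilon>\<close>. The constants do
  not involve \<open>R\<close>, so the annulus can be exhausted.\<close>

lemma annulus_bound:
  fixes X :: "'k::finite \<Rightarrow> real^'n \<Rightarrow> real^'n" and d :: "real^'n \<Rightarrow> real" and g :: "real^'n \<Rightarrow> real^'k"
    and \<beta> p \<sigma> K \<epsilon> R c0 :: real
  assumes X: "subgradient X" and d: "continuous_on UNIV d" "\<And>r. compact {x. d x \<le> r}" "\<And>x. 0 \<le> d x"
    and "0 < \<beta>" "1 < p" "1 \<le> \<sigma>" "0 \<le> K" "0 \<le> \<epsilon>"
    and w: "weak_gradient_on {x. 1 < d x} X d g"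
    and lap: "\<And>\<phi>. test_function {x. 1 < d x} \<phi> \<Longrightarrow> (\<And>x. 0 \<le> \<phi> x) \<Longrightarrow>
      - (LINT x|lebesgue. g x \<bullet> grad X \<phi> x) \<le> (LINT x|lebesgue. (K + \<beta> * p * \<epsilon> * d x powr (p - 1)) * \<phi> x)"
    and gb: "AE x in lebesgue. 1 < d x \<longrightarrow> 1 / \<sigma> \<le> norm (g x) \<and> norm (g x) \<le> 1"
    and f: "weak_gradient_on UNIV X f fg" and "1 \<le> R"
    and c0: "c0 = \<beta> * p * (1 / \<sigma>\<^sup>2 - \<epsilon>)" "0 < c0"
  defines "W \<equiv> \<lambda>x. exp (- \<beta> * d x powr p)"
  shows "ennreal (c0 / 20) * (\<integral>\<^sup>+x\<in>{x. 2 \<le> d x \<and> d x \<le> R / 2}. ennreal (\<bar>f x\<bar> * d x powr (p - 1) * W x) \<partial>lebesgue)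
    \<le> (\<integral>\<^sup>+x. ennreal (norm (fg x) * W x) \<partial>lebesgue) + ennreal (K + 3) * (\<integral>\<^sup>+x. ennreal (\<bar>f x\<bar> * W x) \<partial>lebesgue)"
proof -
  obtain \<theta> \<theta>' :: "real \<Rightarrow> real" where \<theta>: "\<And>t. (\<theta> has_real_derivative \<theta>' t) (at t)" "continuous_on UNIV \<theta>'"
    "\<And>t. 0 \<le> \<theta> t" "\<And>t. \<theta> t \<le> 1"
    "\<And>t. t \<notin> {3/2..R} \<Longrightarrow> \<theta> t = 0" "\<And>t. t \<notin> {3/2..R} \<Longrightarrow> \<theta>' t = 0" "\<And>t. \<bar>\<theta>' t\<bar> \<le> 3"
    "\<And>t. 2 \<le> t \<Longrightarrow> t \<le> R / 2 \<Longrightarrow> 1 / 20 \<le> \<theta> t"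
    by (rule cutoff_exists[OF \<open>1 \<le> R\<close>]) blast
  define \<eta> where "\<eta> t = \<theta> t * exp (- \<beta> * max 1 t powr p)" for t
  define \<eta>' where "\<eta>' t = (\<theta>' t - \<theta> t * (\<beta> * p * max 1 t powr (p - 1))) * exp (- \<beta> * max 1 t powr p)" for t
  \<comment> \<open>The radii 5/4 and \<open>R + 1\<close> leave room around the support [3/2, R] of
    the cutoff and stay outside the closed unit ball, as the comparison requires.\<close>
  define L where "L = {x. 5/4 \<le> d x \<and> d x \<le> R + 1}"
  let ?k = "\<lambda>x. - \<eta>' (d x) * (norm (indicator L x *\<^sub>R g x))\<^sup>2"
  let ?S = "{x. 2 \<le> d x \<and> d x \<le> R / 2}" and ?h = "\<lambda>x. \<bar>f x\<bar> * d x powr (p - 1) * W x"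
  have \<eta>: "\<And>t. (\<eta> has_real_derivative \<eta>' t) (at t)" "continuous_on UNIV \<eta>'"
    unfolding \<eta>_def \<eta>'_def by (rule weighted_cutoff_derivative[OF \<theta>(1,2), of "3/2"]; use \<theta>(5,6) in simp)+
  have \<eta>2: "\<And>t. 0 \<le> \<eta> t" "\<And>t. t \<notin> {3/2..R} \<Longrightarrow> \<eta> t = 0" "\<And>t. t \<notin> {3/2..R} \<Longrightarrow> \<eta>' t = 0"
    using \<theta>(3,5,6) by (simp_all add: \<eta>_def \<eta>'_def)
  define h where "h x = K + \<beta> * p * \<epsilon> * d x powr (p - 1)" for x
  have dp: "continuous_on UNIV (\<lambda>x. d x powr q)" if "0 < q" for q
    by (rule continuous_on_powr'[OF d(1) continuous_on_const]) (use d(3) that in auto)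
  have hc: "continuous_on UNIV h" unfolding h_def using \<open>1 < p\<close> by (intro continuous_intros dp) simp
  have g1: "AE x in lebesgue. 1 < d x \<longrightarrow> norm (g x) \<le> 1" using gb by eventually_elim simp
  have ab: "1 < (5/4::real)" "5/4 < (3/2::real)" "R < R + 1" by simp_all
  note wi = weighted_inequality[OF X d(1,2) w lap[folded h_def] g1 hc \<eta> \<eta>2 ab L_def f]
  have L: "compact L" unfolding L_def by (rule compact_annulus[OF d(1,2)])
  define F where "F x = indicator L x * \<bar>f x\<bar>" for x
  define N where "N x = indicator L x * norm (fg x)" for x
  have F0: "0 \<le> F x" "F x \<le> \<bar>f x\<bar>" and N0: "0 \<le> N x" "N x \<le> norm (fg x)" for x
    by (auto simp: F_def N_def indicator_def)
  have lf: "locally_integrable_on UNIV f" "locally_integrable_on UNIV fg" using f by (auto simp: weak_gradient_on_def)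
  have iF: "integrable lebesgue F"
    unfolding F_def using integrable_norm[OF locally_integrable_cutoff[OF lf(1) L subset_UNIV]] by (simp add: abs_mult)
  have iN: "integrable lebesgue N"
    unfolding N_def using integrable_norm[OF locally_integrable_cutoff[OF lf(2) L subset_UNIV]] by simp
  have W: "0 \<le> W x" "W x \<le> 1" for x using \<open>0 < \<beta>\<close> by (auto simp: W_def)
  have Wc: "continuous_on UNIV W" unfolding W_def using \<open>1 < p\<close> by (intro continuous_intros dp) simp
  have \<theta>c: "continuous_on UNIV (\<lambda>x. \<theta> (d x))"
    by (rule continuous_on_compose2[OF has_real_derivative_continuous[OF \<theta>(1)] d(1)]) simp
  have Wm: "W \<in> borel_measurable lebesgue" by (rule continuous_lebesgue_measurable[OF Wc])
  have iWF: "integrable lebesgue (\<lambda>x. W x * F x)"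
    by (rule integrable_bounded_coeff[OF iF Wm, of 1]) (use W in auto)
  have iWN: "integrable lebesgue (\<lambda>x. W x * N x)"
    by (rule integrable_bounded_coeff[OF iN Wm, of 1]) (use W in auto)
  \<comment> \<open>The weight that survives absorption; \<open>c0\<close> is the gap between
    \<open>1 / \<sigma>\<^sup>2\<close> and \<open>\<epsilon>\<close>, scaled by
    \<open>\<beta> * p\<close>.\<close>
  define q where "q x = c0 * \<theta> (d x) * d x powr (p - 1) * W x" for x
  have q0: "0 \<le> q x" for x using c0(2) \<theta>(3) W by (simp add: q_def)
  have qc: "continuous_on UNIV q" unfolding q_def using \<open>1 < p\<close> by (intro continuous_intros \<theta>c dp Wc) simp
  have qoff: "q x = 0" if "x \<notin> L" for x
    using \<theta>(5)[of "d x"] that by (auto simp: q_def L_def)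
  obtain B where B: "\<And>x. norm (q x) \<le> B" using compact_support_bounded[OF qc L qoff] by blast
  have iq: "integrable lebesgue (\<lambda>x. q x * F x)"
    by (rule integrable_bounded_coeff[OF iF continuous_lebesgue_measurable[OF qc], of B]) (use B in auto)
  \<comment> \<open>A pointwise estimate. In \<open>- \<eta>'\<close> the part from the exponential
    is bounded below by the lower bound on \<open>norm (g x)\<close>, and subtracting the
    \<open>\<epsilon>\<close> part of \<open>h\<close> leaves \<open>q\<close>. The derivative of
    the cutoff costs at most 3, by the upper bound on \<open>norm (g x)\<close>, and the constant
    part of \<open>h\<close> at most \<open>K\<close>.\<close>
  have "(LINT x|lebesgue. q x * F x) \<le> (LINT x|lebesgue. ?k x * F x
      - (h x * \<eta> (d x)) * F x + (K + 3) * (W x * F x))"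
  proof (rule integral_mono_AE)
    show "AE x in lebesgue. q x * F x \<le> ?k x * F x
      - (h x * \<eta> (d x)) * F x + (K + 3) * (W x * F x)"
      using gb
    proof eventually_elim
      case (elim x)
      show ?case
      proof (cases "x \<in> L")
        case True
        then have d1: "1 < d x" by (simp add: L_def)
        then have m: "max 1 (d x) = d x" by simp
        define G where "G = (norm (g x))\<^sup>2"
        have gs: "1 / \<sigma> \<le> norm (g x)" "norm (g x) \<le> 1" using elim d1 by auto
        have "(1 / \<sigma>)\<^sup>2 \<le> G" unfolding G_def using gs \<open>1 \<le> \<sigma>\<close> by (intro power_mono) auto
        then have G: "1 / \<sigma>\<^sup>2 \<le> G" "0 \<le> G" "G \<le> 1" using gs by (auto simp: G_def power_one_over power_le_one)
        define D where "D = \<beta> * p * d x powr (p - 1)"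
        have D: "0 \<le> D" using \<open>0 < \<beta>\<close> \<open>1 < p\<close> by (simp add: D_def)
        have Wx: "exp (- \<beta> * d x powr p) = W x" by (simp add: W_def)
        have "\<theta> (d x) * D * (1 / \<sigma>\<^sup>2) \<le> \<theta> (d x) * D * G" using G D \<theta>(3) by (intro mult_left_mono) auto
        moreover have "\<theta>' (d x) * G \<le> 3"
        proof -
          have "\<theta>' (d x) * G \<le> \<bar>\<theta>' (d x)\<bar> * G" using G by (intro mult_right_mono) auto
          also have "\<dots> \<le> 3 * 1" using G \<theta>(7) by (intro mult_mono) auto
          finally show ?thesis by simp
        qed
        moreover have "K * \<theta> (d x) \<le> K" using \<open>0 \<le> K\<close> \<theta>(4) by (simp add: mult_left_le)
        ultimately have "\<theta> (d x) * D * (1 / \<sigma>\<^sup>2 - \<epsilon>)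
          \<le> - (\<theta>' (d x) - \<theta> (d x) * D) * G - (K + \<epsilon> * D) * \<theta> (d x) + (K + 3)"
          by (simp add: algebra_simps)
        then have "(\<theta> (d x) * D * (1 / \<sigma>\<^sup>2 - \<epsilon>)) * (W x * F x)
          \<le> (- (\<theta>' (d x) - \<theta> (d x) * D) * G - (K + \<epsilon> * D) * \<theta> (d x) + (K + 3)) * (W x * F x)"
          using W F0 by (intro mult_right_mono) auto
        moreover have "(\<theta> (d x) * D * (1 / \<sigma>\<^sup>2 - \<epsilon>)) * (W x * F x) = q x * F x"
          by (simp add: q_def c0 D_def)
        moreover have \<eta>x: "\<eta>' (d x) = (\<theta>' (d x) - \<theta> (d x) * D) * W x" "\<eta> (d x) = \<theta> (d x) * W x"
          unfolding \<eta>'_def \<eta>_def m Wx D_def by simp_all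
        moreover have hx: "h x = K + \<epsilon> * D" by (simp add: h_def D_def)
        moreover have Gx: "(norm (indicator L x *\<^sub>R g x))\<^sup>2 = G" using True by (simp add: G_def)
        moreover have "?k x * F x - (h x * \<eta> (d x)) * F x + (K + 3) * (W x * F x)
          = (- (\<theta>' (d x) - \<theta> (d x) * D) * G - (K + \<epsilon> * D) * \<theta> (d x) + (K + 3)) * (W x * F x)"
          unfolding \<eta>x hx Gx by (simp add: algebra_simps)
        ultimately show ?thesis by simp
      qed (simp add: F_def)
    qed
  qed (use iq wi(2,3) iWF in \<open>auto simp: F_def\<close>)
  also have "\<dots> = (LINT x|lebesgue. ?k x * F x)
      - (LINT x|lebesgue. (h x * \<eta> (d x)) * F x) + (K + 3) * (LINT x|lebesgue. W x * F x)"
    using wi(2,3) iWF unfolding F_def by simp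
  also have "\<dots> \<le> (LINT x|lebesgue. \<eta> (d x) * N x) + (K + 3) * (LINT x|lebesgue. W x * F x)"
  proof -
    have "(LINT x|lebesgue. ?k x * F x)
      \<le> (LINT x|lebesgue. (h x * \<eta> (d x)) * F x) + (LINT x|lebesgue. \<eta> (d x) * N x)"
      unfolding F_def N_def by (rule wi(1)) auto
    then show ?thesis by linarith
  qed
  also have "(LINT x|lebesgue. \<eta> (d x) * N x) \<le> (LINT x|lebesgue. W x * N x)"
  proof (rule integral_mono[OF _ iWN])
    show "integrable lebesgue (\<lambda>x. \<eta> (d x) * N x)" using wi(4) unfolding N_def .
    fix x
    show "\<eta> (d x) * N x \<le> W x * N x"
    proof (cases "x \<in> L")
      case True
      then have "\<eta> (d x) = \<theta> (d x) * W x" by (simp add: \<eta>_def W_def L_def max_def)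
      also have "\<dots> \<le> W x" using W \<theta>(3,4) by (simp add: mult_left_le_one_le)
      finally show ?thesis using N0 by (intro mult_right_mono) auto
    qed (simp add: N_def)
  qed
  finally have main: "(LINT x|lebesgue. q x * F x) \<le> (LINT x|lebesgue. W x * N x) + (K + 3) * (LINT x|lebesgue. W x * F x)"
    by simp
  have fm: "f \<in> borel_measurable lebesgue" by (rule locally_integrable_measurable[OF lf(1)])
  have pm: "(\<lambda>x. d x powr (p - 1)) \<in> borel_measurable lebesgue"
    using \<open>1 < p\<close> by (intro continuous_lebesgue_measurable dp) simp
  have dm: "d \<in> borel_measurable lebesgue" by (rule continuous_lebesgue_measurable[OF d(1)])
  note [measurable] = fm pm dm Wm
  have "ennreal (c0 / 20) * (\<integral>\<^sup>+x\<in>?S. ennreal (?h x) \<partial>lebesgue)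
    = (\<integral>\<^sup>+x. ennreal (c0 / 20) * (ennreal (?h x) * indicator ?S x) \<partial>lebesgue)"
    by (rule nn_integral_cmult[symmetric]) measurable
  also have "\<dots> \<le> (\<integral>\<^sup>+x. ennreal (q x * F x) \<partial>lebesgue)"
  proof (rule nn_integral_mono)
    fix x
    show "ennreal (c0 / 20) * (ennreal (?h x) * indicator ?S x) \<le> ennreal (q x * F x)"
    proof (cases "2 \<le> d x \<and> d x \<le> R / 2")
      case True
      then have "x \<in> L" using \<open>1 \<le> R\<close> by (auto simp: L_def)
      then have F: "F x = \<bar>f x\<bar>" by (simp add: F_def)
      have "1 / 20 * (c0 * (?h x)) \<le> \<theta> (d x) * (c0 * (?h x))"
        using \<theta>(8) True c0(2) W by (intro mult_right_mono) auto
      then have "c0 / 20 * (?h x) \<le> q x * F x"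
        unfolding F q_def by (simp add: mult_ac)
      then show ?thesis using True c0(2) by (simp add: ennreal_leI flip: ennreal_mult')
    qed simp
  qed
  also have "\<dots> = ennreal (LINT x|lebesgue. q x * F x)"
    using q0 F0 by (intro nn_integral_eq_integral iq) auto
  also have "\<dots> \<le> ennreal ((LINT x|lebesgue. W x * N x) + (K + 3) * (LINT x|lebesgue. W x * F x))"
    by (rule ennreal_leI[OF main])
  also have "\<dots> = ennreal (LINT x|lebesgue. W x * N x) + ennreal (K + 3) * ennreal (LINT x|lebesgue. W x * F x)"
    using \<open>0 \<le> K\<close> W F0 N0 by (simp add: ennreal_plus ennreal_mult integral_nonneg_AE)
  also have "ennreal (LINT x|lebesgue. W x * N x) = (\<integral>\<^sup>+x. ennreal (W x * N x) \<partial>lebesgue)"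
    using W N0 by (intro nn_integral_eq_integral[symmetric] iWN) auto
  also have "ennreal (LINT x|lebesgue. W x * F x) = (\<integral>\<^sup>+x. ennreal (W x * F x) \<partial>lebesgue)"
    using W F0 by (intro nn_integral_eq_integral[symmetric] iWF) auto
  also have "(\<integral>\<^sup>+x. ennreal (W x * N x) \<partial>lebesgue) + ennreal (K + 3) * (\<integral>\<^sup>+x. ennreal (W x * F x) \<partial>lebesgue)
    \<le> (\<integral>\<^sup>+x. ennreal (norm (fg x) * W x) \<partial>lebesgue) + ennreal (K + 3) * (\<integral>\<^sup>+x. ennreal (\<bar>f x\<bar> * W x) \<partial>lebesgue)"
    using W F0 N0 by (intro add_mono mult_left_mono nn_integral_mono ennreal_leI) (auto simp: mult.commute[of "W _"] intro!: mult_right_mono)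
  finally show ?thesis .
qed

theorem theorem2p1:
  fixes X :: "'k::finite \<Rightarrow> real^'n \<Rightarrow> real^'n"
    and \<rho> :: "real^'n \<Rightarrow> real^'n \<Rightarrow> real"
    and d :: "real^'n \<Rightarrow> real"
    and d_grad :: "real^'n \<Rightarrow> real^'k"
    and \<beta> p \<sigma> K \<epsilon> :: real
  assumes "subgradient X"
    and "proper_metric \<rho>"
    and "\<And>x. d x = \<rho> 0 x"
    and "0 < \<beta>" and "1 < p"
    and "prob_space (mu \<beta> p d)"
    and "1 \<le> \<sigma>"
    and "weak_gradient_on {x. 1 < d x} X d d_grad"
    and "AE x in lebesgue. 1 < d x \<longrightarrow> 1 / \<sigma> \<le> norm (d_grad x) \<and> norm (d_grad x) \<le> 1"
    and "0 \<le> K" and "0 \<le> \<epsilon>" and "\<epsilon> < 1 / \<sigma>\<^sup>2"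
    and "laplacian_le_on {x. 1 < d x} X d (\<lambda>x. K + \<beta> * p * \<epsilon> * d x powr (p - 1))"
  shows "\<exists>C D :: real. 0 < C \<and> 0 < D \<and>
    (\<forall>f f_grad. weak_gradient_on UNIV X f f_grad \<longrightarrow>
      (\<integral>\<^sup>+ x. ennreal (\<bar>f x\<bar> * d x powr (p - 1)) \<partial>mu \<beta> p d)
        \<le> ennreal C * (\<integral>\<^sup>+ x. ennreal (norm (f_grad x)) \<partial>mu \<beta> p d)
          + ennreal D * (\<integral>\<^sup>+ x. ennreal \<bar>f x\<bar> \<partial>mu \<beta> p d))"
proof -
  have d_eq: "d = \<rho> 0" using assms(3) by auto
  have d: "continuous_on UNIV d" "\<And>r. compact {x. d x \<le> r}" "\<And>x. 0 \<le> d x"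
    unfolding d_eq by (rule proper_metric_distance[OF assms(2)])+
  obtain g where g: "weak_gradient_on {x. 1 < d x} X d g"
    and lap: "\<And>\<phi>. test_function {x. 1 < d x} \<phi> \<Longrightarrow> (\<And>x. 0 \<le> \<phi> x) \<Longrightarrow>
      - (LINT x|lebesgue. g x \<bullet> grad X \<phi> x) \<le> (LINT x|lebesgue. (K + \<beta> * p * \<epsilon> * d x powr (p - 1)) * \<phi> x)"
    using assms(13) unfolding laplacian_le_on_def by blast
  \<comment> \<open>The gradient supplied with the Laplacian bound inherits the length bounds of
    \<open>d_grad\<close> by uniqueness.\<close>
  have gb: "AE x in lebesgue. 1 < d x \<longrightarrow> 1 / \<sigma> \<le> norm (g x) \<and> norm (g x) \<le> 1"
    using assms(9) distance_gradient_unique[OF assms(1) d(1,2) assms(8) g] by eventually_elim auto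
  define c0 where "c0 = \<beta> * p * (1 / \<sigma>\<^sup>2 - \<epsilon>)"
  have c0: "0 < c0" using assms(4,5,12) by (simp add: c0_def)
  \<comment> \<open>The inverse of the factor \<open>c0 / 20\<close> in the annular bound.
    \<open>D\<close> adds to the cost \<open>K + 3\<close> of that bound the maximum of the power of
    d on the region where d is below 2.\<close>
  define C where "C = 20 / c0"
  define D where "D = C * (K + 3) + 2 powr (p - 1)"
  have CD: "0 < C" "0 < D" using c0 assms(10) by (auto simp: C_def D_def intro!: add_pos_pos)
  define W where "W x = exp (- \<beta> * d x powr p)" for x
  define Z where "Z = (LINT y|lebesgue. W y)"
  have dp: "continuous_on UNIV (\<lambda>x. d x powr q)" if "0 < q" for q
    by (rule continuous_on_powr'[OF d(1) continuous_on_const]) (use d(3) that in auto)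
  have Wc: "continuous_on UNIV W" unfolding W_def using assms(5) by (intro continuous_intros dp) simp
  have [measurable]: "W \<in> borel_measurable lebesgue" "(\<lambda>x. d x powr (p - 1)) \<in> borel_measurable lebesgue"
      "d \<in> borel_measurable lebesgue"
    using assms(5) by (auto intro!: continuous_lebesgue_measurable Wc dp d(1))
  have W0: "0 \<le> W x" for x by (simp add: W_def)
  have Z0: "0 \<le> Z" unfolding Z_def using W0 by simp
  \<comment> \<open>The normalisation is a common factor of all three integrals, so it remains to
    compare integrals with weight \<open>W\<close>.\<close>
  have mu_eq: "(\<integral>\<^sup>+x. ennreal (\<phi> x) \<partial>mu \<beta> p d) = ennreal (1 / Z) * (\<integral>\<^sup>+x. ennreal (\<phi> x * W x) \<partial>lebesgue)"
    if "\<phi> \<in> borel_measurable lebesgue" "\<And>x. 0 \<le> \<phi> x" for \<phi>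
  proof -
    note [measurable] = that(1)
    have "(\<integral>\<^sup>+x. ennreal (\<phi> x) \<partial>mu \<beta> p d) = (\<integral>\<^sup>+x. ennreal (W x / Z) * ennreal (\<phi> x) \<partial>lebesgue)"
      unfolding mu_def W_def[symmetric] Z_def[symmetric] by (rule nn_integral_density) measurable
    also have "\<dots> = (\<integral>\<^sup>+x. ennreal (1 / Z) * ennreal (\<phi> x * W x) \<partial>lebesgue)"
      using W0 Z0 that(2) by (intro nn_integral_cong) (simp add: mult_ac flip: ennreal_mult)
    also have "\<dots> = ennreal (1 / Z) * (\<integral>\<^sup>+x. ennreal (\<phi> x * W x) \<partial>lebesgue)"
      by (rule nn_integral_cmult) measurable
    finally show ?thesis .
  qed
  have "(\<integral>\<^sup>+ x. ennreal (\<bar>f x\<bar> * d x powr (p - 1)) \<partial>mu \<beta> p d)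
        \<le> ennreal C * (\<integral>\<^sup>+ x. ennreal (norm (fg x)) \<partial>mu \<beta> p d) + ennreal D * (\<integral>\<^sup>+ x. ennreal \<bar>f x\<bar> \<partial>mu \<beta> p d)"
    if f: "weak_gradient_on UNIV X f fg" for f fg
  proof -
    have [measurable]: "f \<in> borel_measurable lebesgue" "fg \<in> borel_measurable lebesgue"
      using f by (auto simp: weak_gradient_on_def intro: locally_integrable_measurable)
    define u where "u x = ennreal (\<bar>f x\<bar> * d x powr (p - 1) * W x)" for x
    define S where "S n = {x. 2 \<le> d x \<and> d x \<le> real n}" for n
    define I where "I = (\<integral>\<^sup>+x. ennreal (norm (fg x) * W x) \<partial>lebesgue)"
    define J where "J = (\<integral>\<^sup>+x. ennreal (\<bar>f x\<bar> * W x) \<partial>lebesgue)"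
    have [measurable]: "u \<in> borel_measurable lebesgue" unfolding u_def by measurable
    have "ennreal (c0 / 20) * (\<integral>\<^sup>+x\<in>S n. u x \<partial>lebesgue) \<le> I + ennreal (K + 3) * J" for n
    \<comment> \<open>The annular bound is used with \<open>R = 2 * n\<close>, so that
      \<open>R / 2\<close> is the outer radius of \<open>S n\<close>. It requires
      \<open>1 \<le> R\<close>, which fails only for n = 0, and \<open>S 0\<close> is empty.\<close>
    proof (cases "n = 0")
      case False
      then have "1 \<le> 2 * real n" by (cases n) auto
      from annulus_bound[OF assms(1) d assms(4,5,7,10,11) g lap gb f this c0_def c0]
      show ?thesis unfolding S_def u_def I_def J_def W_def by simp
    qed (auto simp: S_def)
    then have n_bound: "(\<integral>\<^sup>+x\<in>S n. u x \<partial>lebesgue) \<le> ennreal C * (I + ennreal (K + 3) * J)" for n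
    proof -
      have "(\<integral>\<^sup>+x\<in>S n. u x \<partial>lebesgue) = ennreal C * (ennreal (c0 / 20) * (\<integral>\<^sup>+x\<in>S n. u x \<partial>lebesgue))"
        using c0 by (simp add: C_def mult.assoc[symmetric] flip: ennreal_mult)
      also have "\<dots> \<le> ennreal C * (I + ennreal (K + 3) * J)"
        by (intro mult_left_mono \<open>ennreal (c0 / 20) * _ \<le> _\<close>) simp
      finally show ?thesis .
    qed
    \<comment> \<open>Monotone convergence over the growing annuli, with a bound independent of n.
      No finiteness of the limit is presupposed.\<close>
    have "(\<integral>\<^sup>+x\<in>{x. 2 \<le> d x}. u x \<partial>lebesgue) = (\<integral>\<^sup>+x. (SUP n. u x * indicator (S n) x) \<partial>lebesgue)"
    proof (intro nn_integral_cong antisym)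
      fix x
      obtain n :: nat where "d x \<le> real n" using real_arch_simple by blast
      then have "u x * indicator {x. 2 \<le> d x} x \<le> u x * indicator (S n) x" by (auto simp: S_def indicator_def)
      also have "\<dots> \<le> (SUP n. u x * indicator (S n) x)" by (rule SUP_upper) simp
      finally show "u x * indicator {x. 2 \<le> d x} x \<le> (SUP n. u x * indicator (S n) x)" .
      show "(SUP n. u x * indicator (S n) x) \<le> u x * indicator {x. 2 \<le> d x} x"
        by (rule SUP_least) (auto simp: S_def indicator_def)
    qed
    also have "\<dots> = (SUP n. \<integral>\<^sup>+x\<in>S n. u x \<partial>lebesgue)"
    proof (rule nn_integral_monotone_convergence_SUP)
      show "incseq (\<lambda>n x. u x * indicator (S n) x)"
        by (intro incseq_SucI le_funI) (auto simp: S_def indicator_def)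
      show "(\<lambda>x. u x * indicator (S n) x) \<in> borel_measurable lebesgue" for n unfolding S_def by measurable
    qed
    also have "\<dots> \<le> ennreal C * (I + ennreal (K + 3) * J)" by (rule SUP_least) (rule n_bound)
    finally have far: "(\<integral>\<^sup>+x\<in>{x. 2 \<le> d x}. u x \<partial>lebesgue) \<le> ennreal C * (I + ennreal (K + 3) * J)" .
    \<comment> \<open>No differential inequality is available in the unit ball and the cutoff is
      small near it, but there the power of d is simply bounded.\<close>
    have near: "(\<integral>\<^sup>+x\<in>{x. d x < 2}. u x \<partial>lebesgue) \<le> ennreal (2 powr (p - 1)) * J"
    proof -
      have "(\<integral>\<^sup>+x\<in>{x. d x < 2}. u x \<partial>lebesgue) \<le> (\<integral>\<^sup>+x. ennreal (2 powr (p - 1)) * ennreal (\<bar>f x\<bar> * W x) \<partial>lebesgue)"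
      proof (rule nn_integral_mono)
        fix x
        show "u x * indicator {x. d x < 2} x \<le> ennreal (2 powr (p - 1)) * ennreal (\<bar>f x\<bar> * W x)"
        proof (cases "d x < 2")
          case True
          have "d x powr (p - 1) \<le> 2 powr (p - 1)" using True d(3)[of x] assms(5) by (intro powr_mono2) auto
          then have "d x powr (p - 1) * (\<bar>f x\<bar> * W x) \<le> 2 powr (p - 1) * (\<bar>f x\<bar> * W x)"
            using W0[of x] by (intro mult_right_mono) auto
          then have "\<bar>f x\<bar> * d x powr (p - 1) * W x \<le> 2 powr (p - 1) * (\<bar>f x\<bar> * W x)" by (simp add: mult_ac)
          then show ?thesis using True W0[of x] by (simp add: u_def ennreal_leI flip: ennreal_mult)
        qed simp
      qed
      also have "\<dots> = ennreal (2 powr (p - 1)) * J" unfolding J_def by (rule nn_integral_cmult) measurable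
      finally show ?thesis .
    qed
    have "(\<integral>\<^sup>+x. u x \<partial>lebesgue) = (\<integral>\<^sup>+x. u x * indicator {x. 2 \<le> d x} x + u x * indicator {x. d x < 2} x \<partial>lebesgue)"
      by (intro nn_integral_cong) (auto simp: indicator_def)
    also have "\<dots> = (\<integral>\<^sup>+x\<in>{x. 2 \<le> d x}. u x \<partial>lebesgue) + (\<integral>\<^sup>+x\<in>{x. d x < 2}. u x \<partial>lebesgue)"
      by (rule nn_integral_add) measurable
    also have "\<dots> \<le> ennreal C * (I + ennreal (K + 3) * J) + ennreal (2 powr (p - 1)) * J"
      by (rule add_mono[OF far near])
    also have "\<dots> = ennreal C * I + ennreal D * J"
      using CD assms(10) by (simp add: D_def ennreal_plus ennreal_mult distrib_left distrib_right mult.assoc add.assoc)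
    finally have "ennreal (1 / Z) * (\<integral>\<^sup>+x. u x \<partial>lebesgue) \<le> ennreal (1 / Z) * (ennreal C * I + ennreal D * J)"
      by (intro mult_left_mono zero_le)
    also have "\<dots> = ennreal C * (ennreal (1 / Z) * I) + ennreal D * (ennreal (1 / Z) * J)"
      by (simp add: distrib_left mult_ac)
    finally show ?thesis
      using mu_eq[of "\<lambda>x. \<bar>f x\<bar> * d x powr (p - 1)"] mu_eq[of "\<lambda>x. norm (fg x)"] mu_eq[of "\<lambda>x. \<bar>f x\<bar>"]
      by (simp add: u_def I_def J_def)
  qed
  then show ?thesis using CD by blast
qed

end
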